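(* Let $0<T_{\min}<T_{\max}$, $A\in\mathbb{R}^{n\times n}$, $B\in\mathbb{R}^{n\times p}$, $C_J\in\mathbb{R}^{q_J\times n}$, and consider the impulsive system with state $\begin{pmatrix}x\\ u\end{pmatrix}$, control inputs $\hat u$, $u_J$ and measurement outputs $y$, $y_J$ given by $$\begin{pmatrix}\dot x(t)\\ \dot u(t)\\ y(t)\end{pmatrix}=\begin{pmatrix}A&B&0\\ 0&0&0\\ 0&0&0\end{pmatrix}\begin{pmatrix}x(t)\\ u(t)\\ \hat u(t)\end{pmatrix},\qquad \begin{pmatrix}x(t_k)\\ u(t_k)\\ y_J(k)\end{pmatrix}=\begin{pmatrix}I&0&0\\ 0&0&I\\ C_J&0&0\end{pmatrix}\begin{pmatrix}x(t_k^-)\\ u(t_k^-)\\ u_J(k)\end{pmatrix},\qquad t\ge 0,\ k\in\mathbb{N}.$$ Let $\hat A=\begin{pmatrix}A&B\\ 0&0\end{pmatrix}\in\mathbb{R}^{(n+p)\times(n+p)}$ and let $V_J$ be a basis matrix of $\ker(C_J)$. Then there exists a clock-dependent dynamic output-feedback controller (as defined in the context) for this system such that the clock-dependent stability LMIs (as defined in the context) are feasible for the corresponding closed-loop system if and only if there exist continuously differentiable maps $X=\begin{pmatrix}X_1&\bullet\\ \bullet&\bullet\end{pmatrix}$, $Y=\begin{pmatrix}Y_1&\bullet\\ \bullet&\bullet\end{pmatrix}$ from $[0,T_{\max}]$ to $\mathbb{S}^{n+p}$, with upper left blocks $X_1,Y_1$ of size $n\times n$, satisfying $$\begin{pmatrix}Y(\tau)&I\\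 I&X(\tau)\end{pmatrix}\succ 0,\qquad \begin{pmatrix}I\\ \hat A\end{pmatrix}^T\begin{pmatrix}\dot X(\tau)&X(\tau)\\ X(\tau)&0\end{pmatrix}\begin{pmatrix}I\\ \hat A\end{pmatrix}\prec 0$$ and $$\begin{pmatrix}-\hat A^T\\ I\end{pmatrix}^T\begin{pmatrix}0&Y(\tau)\\ Y(\tau)&\dot Y(\tau)\end{pmatrix}\begin{pmatrix}-\hat A^T\\ I\end{pmatrix}\succ 0$$ for all $\tau\in[0,T_{\max}]$, as well as $$\begin{pmatrix}V_J&0\\ 0&I\end{pmatrix}^T\left(\begin{pmatrix}X_1(0)&0\\ 0&0\end{pmatrix}-X(\tau)\right)\begin{pmatrix}V_J&0\\ 0&I\end{pmatrix}\prec 0\qquad\text{and}\qquad Y_1(0)-Y_1(\tau)\succ 0$$ for all $\tau\in[T_{\min},T_{\max}]$.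
   Context: $\mathbb{S}^n$ is the set of symmetric real $n\times n$ matrices; $\succ 0$ and $\prec 0$ denote positive and negative definiteness of symmetric matrices; a dot over a matrix-valued map denotes its derivative; "$\bullet$" denotes unspecified blocks. $f(t^-)$ denotes the limit from the left. A basis matrix of a subspace is a matrix whose columns form a basis of it (an empty matrix, with no columns, if the subspace is $\{0\}$). Impulse instants are sequences $0=t_0<t_1<t_2<\dots$ with $t_k-t_{k-1}\in[T_{\min},T_{\max}]$ for all $k\in\mathbb{N}$. The clock is $\theta(t):=t-t_k$ for $t\in[t_k,t_{k+1})$, $k\in\mathbb{N}_0$. The impulsive system in the claim represents the sampled-data system $\dot x=Ax+Bu$, $y_J(k)=C_Jx(t_k^-)$ with zero-order-hold input $u(t)=u(t_k)$ on $[t_k,t_{k+1})$. It is of the general form $$\begin{pmatrix}\dot\xi(t)\\ y(t)\end{pmatrix}=\begin{pmatrix}\hat A&\hat B\\ \hat C&0\end{pmatrix}\begin{pmatrix}\xi(t)\\ \hat u(t)\end{pmatrix},\qquad \begin{pmatrix}\xi(t_k)\\ y_J(k)\end{pmatrix}=\begin{pmatrix}\hat A_J&\hat B_J\\ \hat C_J&0\end{pmatrix}\begin{pmatrix}\xi(t_k^-)\\ u_J(k)\end{pmatrix}$$ with $\xi=\begin{pmatrix}x\\ u\end{pmatrix}$, $\hat B=0$, $\hat C=0$, $\hat A_J=\begin{pmatrix}I&0\\ 0&0\end{pmatrix}$, $\hat B_J=\begin{pmatrix}0\\ I\end{pmatrix}$, $\hat C_J=\begin{pmatrix}C_J&0\end{pmatrix}$.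 Clock-dependent dynamic output-feedback controller: a system with some state dimension $n_c$ of the form $$\begin{pmatrix}\dot x_c(t)\\ \hat u(t)\end{pmatrix}=\begin{pmatrix}A^c(\theta(t))&B^c(\theta(t))\\ C^c(\theta(t))&D^c(\theta(t))\end{pmatrix}\begin{pmatrix}x_c(t)\\ y(t)\end{pmatrix},\qquad \begin{pmatrix}x_c(t_k)\\ u_J(k)\end{pmatrix}=\begin{pmatrix}A_J^c(\theta(t_k^-))&B_J^c(\theta(t_k^-))\\ C_J^c(\theta(t_k^-))&D_J^c(\theta(t_k^-))\end{pmatrix}\begin{pmatrix}x_c(t_k^-)\\ y_J(k)\end{pmatrix}$$ for $t\ge 0$, $k\in\mathbb{N}$, with continuous matrix-valued maps $A^c,B^c,C^c,D^c$ on $[0,T_{\max}]$ and $A^c_J,B^c_J,C^c_J,D^c_J$ on $[T_{\min},T_{\max}]$. Closed-loop system: with $x_{cl}=\begin{pmatrix}\xi\\ x_c\end{pmatrix}$ it is $\dot x_{cl}(t)=\mathcal{A}(\theta(t))x_{cl}(t)$, $x_{cl}(t_k)=\mathcal{A}_J(\theta(t_k^-))x_{cl}(t_k^-)$, where $$\mathcal{A}=\begin{pmatrix}\hat A+\hat BD^c\hat C&\hat BC^c\\ B^c\hat C&A^c\end{pmatrix}=\begin{pmatrix}\hat A&0\\ 0&A^c\end{pmatrix},\qquad \mathcal{A}_J=\begin{pmatrix}\hat A_J+\hat B_JD_J^c\hat C_J&\hat B_JC_J^c\\ B_J^c\hat C_J&A_J^c\end{pmatrix}.$$ Clock-dependent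 stability LMIs: they are feasible for the closed-loop system if there exists a continuously differentiable map $\mathcal{X}:[0,T_{\max}]\to\mathbb{S}^{n+p+n_c}$ with $\mathcal{X}(\tau)\succ 0$ and $\dot{\mathcal{X}}(\tau)+\mathcal{A}(\tau)^T\mathcal{X}(\tau)+\mathcal{X}(\tau)\mathcal{A}(\tau)\prec 0$ for all $\tau\in[0,T_{\max}]$, and $\mathcal{A}_J(\tau)^T\mathcal{X}(0)\mathcal{A}_J(\tau)-\mathcal{X}(\tau)\prec 0$ for all $\tau\in[T_{\min},T_{\max}]$. *)

theory Defs
  imports "HOL-Analysis.Derivative" "Jordan_Normal_Form.Matrix_Kernel"
begin

text \<open>Matrices are those of \<^theory>\<open>Jordan_Normal_Form.Matrix\<close>, whose dimensions are ordinary
  natural numbers: the controller order can then be quantified existentially, and blocks with no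
  rows or no columns are allowed.\<close>

definition pos_def :: "real mat \<Rightarrow> bool" where
  "pos_def M \<longleftrightarrow> transpose_mat M = M \<and>
     (\<forall>v \<in> carrier_vec (dim_row M). v \<noteq> 0\<^sub>v (dim_row M) \<longrightarrow> scalar_prod v (M *\<^sub>v v) > 0)"

definition neg_def :: "real mat \<Rightarrow> bool" where
  "neg_def M \<longleftrightarrow> transpose_mat M = M \<and>
     (\<forall>v \<in> carrier_vec (dim_row M). v \<noteq> 0\<^sub>v (dim_row M) \<longrightarrow> scalar_prod v (M *\<^sub>v v) < 0)"

text \<open>The predicate \<open>kernel.basis\<close> is about the set of columns, so that repeated columns have to be
  excluded separately.\<close>

definition kernel_basis_matrix :: "real mat \<Rightarrow> real mat \<Rightarrow> bool" where
  "kernel_basis_matrix C V \<longleftrightarrow>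
     dim_row V = dim_col C \<and> distinct (cols V) \<and> kernel.basis (dim_col C) C (set (cols V))"

definition upper_left_block :: "nat \<Rightarrow> real mat \<Rightarrow> real mat" where
  "upper_left_block n M = Matrix.mat n n (\<lambda>(i, j). M $$ (i, j))"


subsection \<open>Matrix-valued maps of a real variable\<close>

text \<open>The type of matrices of arbitrary dimension carries no topology; continuity and
  differentiability are entrywise. Only the values on \<open>S\<close> matter, and derivatives are taken within
  \<open>S\<close>, i.e. one-sided at the end points of an interval.\<close>

definition continuous_mat_on :: "real set \<Rightarrow> nat \<Rightarrow> nat \<Rightarrow> (real \<Rightarrow> real mat) \<Rightarrow> bool" where
  "continuous_mat_on S r c M \<longleftrightarrow>
     (\<forall>\<tau> \<in> S. M \<tau> \<in> carrier_mat r c) \<and>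
     (\<forall>i < r. \<forall>j < c. continuous_on S (\<lambda>\<tau>. M \<tau> $$ (i, j)))"

definition mat_deriv :: "real set \<Rightarrow> (real \<Rightarrow> real mat) \<Rightarrow> real \<Rightarrow> real mat" where
  "mat_deriv S M \<tau> = Matrix.mat (dim_row (M \<tau>)) (dim_col (M \<tau>))
     (\<lambda>(i, j). vector_derivative (\<lambda>s. M s $$ (i, j)) (at \<tau> within S))"

definition C1_symmetric_on :: "real set \<Rightarrow> nat \<Rightarrow> (real \<Rightarrow> real mat) \<Rightarrow> bool" where
  "C1_symmetric_on S N M \<longleftrightarrow>
     (\<forall>\<tau> \<in> S. M \<tau> \<in> carrier_mat N N \<and> transpose_mat (M \<tau>) = M \<tau>) \<and>
     (\<forall>i < N. \<forall>j < N. \<forall>\<tau> \<in> S. (\<lambda>s. M s $$ (i, j)) differentiable (at \<tau> within S)) \<and>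
     continuous_mat_on S N N (mat_deriv S M)"


subsection \<open>Impulsive systems, clock-dependent controllers and their interconnection\<close>

record impulsive_system =
  flow_A :: "real mat"
  flow_B :: "real mat"
  flow_C :: "real mat"
  jump_A :: "real mat"
  jump_B :: "real mat"
  jump_C :: "real mat"

text \<open>The sampled-data system as an impulsive system with state \<open>(x, u)\<close> of dimension \<open>n + p\<close>. The
  flow input has dimension \<open>m\<close> and the flow output dimension \<open>q\<close>; both enter through zero matrices.\<close>

definition sampled_data_system ::
  "nat \<Rightarrow> nat \<Rightarrow> nat \<Rightarrow> nat \<Rightarrow> nat \<Rightarrow> real mat \<Rightarrow> real mat \<Rightarrow> real mat \<Rightarrow> impulsive_system" where
  "sampled_data_system n p m q qJ A B CJ =
     \<lparr> flow_A = four_block_mat A B (0\<^sub>m p n) (0\<^sub>m p p),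
       flow_B = 0\<^sub>m (n + p) m,
       flow_C = 0\<^sub>m q (n + p),
       jump_A = four_block_mat (1\<^sub>m n) (0\<^sub>m n p) (0\<^sub>m p n) (0\<^sub>m p p),
       jump_B = 0\<^sub>m n p @\<^sub>r 1\<^sub>m p,
       jump_C = four_block_mat CJ (0\<^sub>m qJ p) (0\<^sub>m 0 n) (0\<^sub>m 0 p) \<rparr>"

text \<open>The controller matrices as functions of the clock value.\<close>

record clock_controller =
  ctrl_A :: "real \<Rightarrow> real mat"
  ctrl_B :: "real \<Rightarrow> real mat"
  ctrl_C :: "real \<Rightarrow> real mat"
  ctrl_D :: "real \<Rightarrow> real mat"
  ctrl_AJ :: "real \<Rightarrow> real mat"
  ctrl_BJ :: "real \<Rightarrow> real mat"
  ctrl_CJ :: "real \<Rightarrow> real mat"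
  ctrl_DJ :: "real \<Rightarrow> real mat"

text \<open>A controller of order \<open>nc\<close> for a system with \<open>m\<close> flow inputs, \<open>q\<close> flow outputs, \<open>mJ\<close> jump
  inputs and \<open>qJ\<close> jump outputs. The jump maps are evaluated at the clock values just before an
  impulse, which lie between \<open>Tmin\<close> and \<open>Tmax\<close>.\<close>

definition is_clock_controller ::
  "real \<Rightarrow> real \<Rightarrow> nat \<Rightarrow> nat \<Rightarrow> nat \<Rightarrow> nat \<Rightarrow> nat \<Rightarrow> clock_controller \<Rightarrow> bool" where
  "is_clock_controller Tmin Tmax m q mJ qJ nc K \<longleftrightarrow>
     continuous_mat_on {0..Tmax} nc nc (ctrl_A K) \<and>
     continuous_mat_on {0..Tmax} nc q (ctrl_B K) \<and>
     continuous_mat_on {0..Tmax} m nc (ctrl_C K) \<and>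
     continuous_mat_on {0..Tmax} m q (ctrl_D K) \<and>
     continuous_mat_on {Tmin..Tmax} nc nc (ctrl_AJ K) \<and>
     continuous_mat_on {Tmin..Tmax} nc qJ (ctrl_BJ K) \<and>
     continuous_mat_on {Tmin..Tmax} mJ nc (ctrl_CJ K) \<and>
     continuous_mat_on {Tmin..Tmax} mJ qJ (ctrl_DJ K)"

definition closed_loop_flow :: "impulsive_system \<Rightarrow> clock_controller \<Rightarrow> real \<Rightarrow> real mat" where
  "closed_loop_flow G K \<tau> = four_block_mat
     (flow_A G + flow_B G * ctrl_D K \<tau> * flow_C G) (flow_B G * ctrl_C K \<tau>)
     (ctrl_B K \<tau> * flow_C G) (ctrl_A K \<tau>)"

definition closed_loop_jump :: "impulsive_system \<Rightarrow> clock_controller \<Rightarrow> real \<Rightarrow> real mat" where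
  "closed_loop_jump G K \<tau> = four_block_mat
     (jump_A G + jump_B G * ctrl_DJ K \<tau> * jump_C G) (jump_B G * ctrl_CJ K \<tau>)
     (ctrl_BJ K \<tau> * jump_C G) (ctrl_AJ K \<tau>)"

definition stability_LMIs_feasible ::
  "real \<Rightarrow> real \<Rightarrow> nat \<Rightarrow> (real \<Rightarrow> real mat) \<Rightarrow> (real \<Rightarrow> real mat) \<Rightarrow> bool" where
  "stability_LMIs_feasible Tmin Tmax N \<A> \<A>\<^sub>J \<longleftrightarrow>
     (\<exists>\<X>. C1_symmetric_on {0..Tmax} N \<X> \<and>
        (\<forall>\<tau> \<in> {0..Tmax}. pos_def (\<X> \<tau>) \<and>
           neg_def (mat_deriv {0..Tmax} \<X> \<tau> + transpose_mat (\<A> \<tau>) * \<X> \<tau> + \<X> \<tau> * \<A> \<tau>)) \<and>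
        (\<forall>\<tau> \<in> {Tmin..Tmax}. neg_def (transpose_mat (\<A>\<^sub>J \<tau>) * \<X> 0 * \<A>\<^sub>J \<tau> - \<X> \<tau>)))"

end

theory Submission
  imports Defs "Jordan_Normal_Form.DL_Rank"
begin

text \<open>A closed-loop storage matrix \<open>\<X>\<close> yields \<open>X\<close> as its upper left block and \<open>Y\<close> as that of
  \<open>\<X>\<^sup>-\<^sup>1\<close>; the coupling inequality is only non-strict there, and becomes strict after adding a small
  multiple of the identity to \<open>Y\<close>, which the other inequalities tolerate. Conversely, put
  \<open>P = Y\<^sup>-\<^sup>1\<close> and \<open>S = X - P \<succ> 0\<close> and use a controller of the order of the plant whose state \<open>c\<close>
  estimates the plant state \<open>a\<close>, with storage function \<open>P a a + S (a - c) (a - c)\<close>. The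
  flow of \<open>c\<close> is chosen such that the flow inequality splits into the ones for \<open>P\<close> and \<open>X\<close>. At an impulse,
  \<open>a\<close> is first re-estimated from \<open>c\<close> and the measurement by weighted least squares, the weight
  of the measurement coming from a Finsler lemma uniform in the clock; the control is then reset
  to the value minimising the form of \<open>P 0\<close> for the estimated \<open>x\<close>. Completing squares makes the decrease
  of the storage function a sum of the two reduced jump inequalities.\<close>

unbundle no vec_syntax and no inner_syntax

subsection \<open>Bilinear forms\<close>

text \<open>The reduced inequalities are the closed-loop ones tested where the controller has no
  influence. During flow the plant is neither actuated nor measured, so \<open>(v, 0)\<close>
  evolves under \<open>Ahat\<close> alone, and likewise under the transposed loop. At an impulse,
  \<open>(x, u, 0)\<close> with \<open>CJ x = 0\<close> is sent to \<open>(x, 0, 0)\<close>; dually,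
  every vector \<open>(x, 0, 0)\<close> is fixed by the transposed jump matrix because no jump
  changes \<open>x\<close>. This is where the kernel of \<open>CJ\<close> and the block
  \<open>Y_1\<close> come from. For the converse, solving the inequalities separately at each clock
  value would leave continuity of the controller open. Hence every controller matrix is an explicit
  expression in the given maps and inverses of positive definite maps, and the one constant that
  must serve all clock values, the weight of the measurement, comes from compactness. The
  inequalities are handled as bilinear forms, where each matrix identity becomes linear arithmetic
  over finitely many real numbers.\<close>

definition bform :: "real mat \<Rightarrow> real vec \<Rightarrow> real vec \<Rightarrow> real" where
  "bform M v w = v \<bullet> (M *\<^sub>v w)"

lemma bform_sum:
  assumes "dim_vec v = dim_row M" "dim_vec w = dim_col M"
  shows "bform M v w = (\<Sum>i<dim_row M. \<Sum>j<dim_col M. v $ i * M $$ (i, j) * w $ j)"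
  using assms
  by (auto simp: bform_def scalar_prod_def atLeast0LessThan sum_distrib_left mult.assoc
      intro!: sum.cong)

lemma scalar_prod_commute:
  "dim_vec v = dim_vec w \<Longrightarrow> v \<bullet> w = w \<bullet> (v :: real vec)"
  by (simp add: scalar_prod_def mult.commute)

lemma scalar_prod_self_pos:
  fixes v :: "real vec"
  assumes "v \<in> carrier_vec n" "v \<noteq> 0\<^sub>v n"
  shows "v \<bullet> v > 0"
proof -
  have "\<exists>i<n. v $ i \<noteq> 0"
    using assms by (metis carrier_vecD eq_vecI index_zero_vec)
  then obtain i where i: "i < n" "v $ i \<noteq> 0" by blast
  have "0 < (v $ i) * (v $ i)" using i by (simp add: zero_less_mult_iff) linarith
  also have "\<dots> \<le> v \<bullet> v"
    using i assms(1) unfolding scalar_prod_def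
    by (intro member_le_sum) auto
  finally show ?thesis .
qed

lemma scalar_prod_self_nonneg: "(v :: real vec) \<bullet> v \<ge> 0"
  by (auto simp: scalar_prod_def intro!: sum_nonneg)

context
  fixes M :: "real mat" and v w u :: "real vec"
begin

lemma bform_add_left:
  "dim_vec v = dim_row M \<Longrightarrow> dim_vec u = dim_row M \<Longrightarrow> bform M (v + u) w = bform M v w + bform M u w"
  by (simp add: bform_def scalar_prod_def algebra_simps sum.distrib)

lemma bform_diff_left:
  "dim_vec v = dim_row M \<Longrightarrow> dim_vec u = dim_row M \<Longrightarrow> bform M (v - u) w = bform M v w - bform M u w"
  by (simp add: bform_def scalar_prod_def algebra_simps sum_subtractf)

lemma bform_add_right:
  "dim_vec v = dim_row M \<Longrightarrow> dim_vec w = dim_col M \<Longrightarrow> dim_vec u = dim_col M \<Longrightarrow>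
    bform M v (w + u) = bform M v w + bform M v u"
  by (simp add: bform_sum algebra_simps sum.distrib)

lemma bform_diff_right:
  "dim_vec v = dim_row M \<Longrightarrow> dim_vec w = dim_col M \<Longrightarrow> dim_vec u = dim_col M \<Longrightarrow>
    bform M v (w - u) = bform M v w - bform M v u"
  by (simp add: bform_sum algebra_simps sum_subtractf)

lemma bform_zero_left: "bform M (0\<^sub>v (dim_row M)) w = 0"
  by (simp add: bform_def scalar_prod_def)

lemma bform_commute:
  assumes "transpose_mat M = M" "dim_vec v = dim_row M" "dim_vec w = dim_row M"
  shows "bform M v w = bform M w v"
proof -
  have d: "dim_col M = dim_row M" using assms(1) by (metis index_transpose_mat(2))
  have e: "M $$ (i, j) = M $$ (j, i)" if "i < dim_row M" "j < dim_row M" for i j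
    using that d assms(1) by (metis index_transpose_mat(1))
  have "bform M v w = (\<Sum>j<dim_row M. \<Sum>i<dim_row M. v $ i * M $$ (i, j) * w $ j)"
    using assms d by (subst sum.swap) (simp add: bform_sum)
  also have "\<dots> = bform M w v"
    using assms d e by (simp add: bform_sum mult_ac)
  finally show ?thesis .
qed

end

lemma bform_add_mat:
  "dim_row M' = dim_row M \<Longrightarrow> dim_col M' = dim_col M \<Longrightarrow> dim_vec v = dim_row M \<Longrightarrow>
    dim_vec w = dim_col M \<Longrightarrow> bform (M + M') v w = bform M v w + bform M' v w"
  by (simp add: bform_sum algebra_simps sum.distrib)

lemma bform_minus_mat:
  "dim_row M' = dim_row M \<Longrightarrow> dim_col M' = dim_col M \<Longrightarrow> dim_vec v = dim_row M \<Longrightarrow>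
    dim_vec w = dim_col M \<Longrightarrow> bform (M - M') v w = bform M v w - bform M' v w"
  by (simp add: bform_sum algebra_simps sum_subtractf)

lemma bform_uminus_mat:
  "dim_vec v = dim_row M \<Longrightarrow> dim_vec w = dim_col M \<Longrightarrow> bform (- M) v w = - bform M v w"
  by (simp add: bform_sum sum_negf)

lemma bform_smult_mat:
  "dim_vec v = dim_row M \<Longrightarrow> dim_vec w = dim_col M \<Longrightarrow> bform (c \<cdot>\<^sub>m M) v w = c * bform M v w"
  by (simp add: bform_sum sum_distrib_left mult_ac)

lemma bform_smult_vec:
  "dim_vec v = dim_row M \<Longrightarrow> dim_vec w = dim_col M \<Longrightarrow> bform M (c \<cdot>\<^sub>v v) (d \<cdot>\<^sub>v w) = c * d * bform M v w"
  by (simp add: bform_sum sum_distrib_left mult_ac)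

lemma bform_uminus_right:
  "dim_vec v = dim_row M \<Longrightarrow> dim_vec w = dim_col M \<Longrightarrow> bform M v (- w) = - bform M v w"
  by (simp add: bform_sum sum_negf)

lemma bform_zero_mat:
  "dim_vec v = r \<Longrightarrow> dim_vec w = c \<Longrightarrow> bform (0\<^sub>m r c) v w = 0"
  by (simp add: bform_sum)

lemma bform_one_mat: "dim_vec w = n \<Longrightarrow> bform (1\<^sub>m n) v w = v \<bullet> (w :: real vec)"
  unfolding bform_def by (metis carrier_vec_dim_vec one_mult_mat_vec)

lemma bform_mult_right:
  assumes "dim_row A = dim_col M" "dim_vec w = dim_col A"
  shows "bform (M * A) v w = bform M v (A *\<^sub>v w)"
proof -
  have "(M * A) *\<^sub>v w = M *\<^sub>v (A *\<^sub>v w)"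
    using assms by (intro assoc_mult_mat_vec[of _ "dim_row M" "dim_col M" _ "dim_col A"]) (auto intro: carrier_vecI)
  then show ?thesis by (simp add: bform_def)
qed

lemma bform_transpose:
  assumes "dim_vec v = dim_col M" "dim_vec w = dim_row M"
  shows "bform (transpose_mat M) v w = bform M w v"
proof -
  have "bform (transpose_mat M) v w = (\<Sum>i<dim_col M. \<Sum>j<dim_row M. v $ i * M $$ (j, i) * w $ j)"
    using assms by (simp add: bform_sum)
  also have "\<dots> = bform M w v"
    using assms by (subst sum.swap) (simp add: bform_sum mult_ac)
  finally show ?thesis .
qed

lemma scalar_prod_mult_mat_vec:
  "dim_vec v = dim_row M \<Longrightarrow> dim_vec w = dim_col M \<Longrightarrow> v \<bullet> (M *\<^sub>v w) = (transpose_mat M *\<^sub>v v) \<bullet> (w :: real vec)"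
  using bform_transpose[of w M v]
  by (simp add: bform_def scalar_prod_commute[of w])

lemma bform_mult_left:
  assumes "dim_row A = dim_row M" "dim_vec v = dim_col A" "dim_vec w = dim_col M"
  shows "bform (transpose_mat A * M) v w = bform M (A *\<^sub>v v) w"
proof -
  have "(transpose_mat A * M) *\<^sub>v w = transpose_mat A *\<^sub>v (M *\<^sub>v w)"
    using assms by (intro assoc_mult_mat_vec[of _ "dim_col A" "dim_row M" _ "dim_col M"]) (auto intro: carrier_vecI)
  then show ?thesis
    using assms scalar_prod_mult_mat_vec[of v "transpose_mat A" "M *\<^sub>v w"]
    by (simp add: bform_def)
qed

lemma bform_four_block:
  assumes "A \<in> carrier_mat r1 c1" "B \<in> carrier_mat r1 c2" "C \<in> carrier_mat r2 c1" "D \<in> carrier_mat r2 c2"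
    "dim_vec a = r1" "dim_vec b = r2" "dim_vec c = c1" "dim_vec d = c2"
  shows "bform (four_block_mat A B C D) (a @\<^sub>v b) (c @\<^sub>v d) =
    bform A a c + bform B a d + bform C b c + bform D b d"
proof -
  have v: "a \<in> carrier_vec r1" "b \<in> carrier_vec r2" "c \<in> carrier_vec c1" "d \<in> carrier_vec c2"
    using assms by auto
  have "four_block_mat A B C D *\<^sub>v (c @\<^sub>v d) = (A *\<^sub>v c + B *\<^sub>v d) @\<^sub>v (C *\<^sub>v c + D *\<^sub>v d)"
    by (rule four_block_mat_mult_vec) (use assms v in auto)
  moreover have "(a @\<^sub>v b) \<bullet> ((A *\<^sub>v c + B *\<^sub>v d) @\<^sub>v (C *\<^sub>v c + D *\<^sub>v d)) =
      a \<bullet> (A *\<^sub>v c + B *\<^sub>v d) + b \<bullet> (C *\<^sub>v c + D *\<^sub>v d)"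
    by (rule scalar_prod_append[of _ r1 _ r2]) (use assms v in auto)
  moreover have "a \<bullet> (A *\<^sub>v c + B *\<^sub>v d) = a \<bullet> (A *\<^sub>v c) + a \<bullet> (B *\<^sub>v d)"
    by (rule scalar_prod_add_distrib[of _ r1]) (use assms v in auto)
  moreover have "b \<bullet> (C *\<^sub>v c + D *\<^sub>v d) = b \<bullet> (C *\<^sub>v c) + b \<bullet> (D *\<^sub>v d)"
    by (rule scalar_prod_add_distrib[of _ r2]) (use assms v in auto)
  ultimately show ?thesis by (simp add: bform_def)
qed

lemma bform_add_quadratic:
  assumes "transpose_mat M = M" "M \<in> carrier_mat n n" "v \<in> carrier_vec n" "w \<in> carrier_vec n"
  shows "bform M (v + w) (v + w) = bform M v v + 2 * bform M v w + bform M w w"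
  using assms bform_commute[OF assms(1), of w v]
  by (simp add: bform_add_left bform_add_right)

lemma bform_diff_quadratic:
  assumes "transpose_mat M = M" "M \<in> carrier_mat n n" "v \<in> carrier_vec n" "w \<in> carrier_vec n"
  shows "bform M (v - w) (v - w) = bform M v v - 2 * bform M v w + bform M w w"
  using assms bform_commute[OF assms(1), of w v]
  by (simp add: bform_diff_left bform_diff_right)

text \<open>Unit vectors recover the entries. The rule lets symmetry of congruences and Lyapunov
  expressions be checked on forms instead of by rearranging matrix products.\<close>

lemma mat_eqI_bform:
  assumes "M \<in> carrier_mat r c" "M' \<in> carrier_mat r c"
    and "\<And>v w. v \<in> carrier_vec r \<Longrightarrow> w \<in> carrier_vec c \<Longrightarrow> bform M v w = bform M' v w"
  shows "M = M'"
proof (rule eq_matI)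
  fix i j assume ij: "i < dim_row M'" "j < dim_col M'"
  have "M $$ (i, j) = bform M (unit_vec r i) (unit_vec c j)"
    using assms(1,2) ij by (simp add: bform_def)
  also have "\<dots> = bform M' (unit_vec r i) (unit_vec c j)" by (rule assms(3)) auto
  also have "\<dots> = M' $$ (i, j)" using assms(1,2) ij by (simp add: bform_def)
  finally show "M $$ (i, j) = M' $$ (i, j)" .
qed (use assms in auto)

lemma symmetric_bformI:
  assumes "M \<in> carrier_mat n n"
    and "\<And>v w. v \<in> carrier_vec n \<Longrightarrow> w \<in> carrier_vec n \<Longrightarrow> bform M v w = bform M w v"
  shows "transpose_mat M = M"
  by (rule mat_eqI_bform[of _ n n]) (use assms in \<open>auto simp: bform_transpose\<close>)

subsection \<open>Definite matrices and their inverses\<close>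

lemma pos_defI:
  assumes "M \<in> carrier_mat n n" "transpose_mat M = M"
    and "\<And>v. v \<in> carrier_vec n \<Longrightarrow> v \<noteq> 0\<^sub>v n \<Longrightarrow> bform M v v > 0"
  shows "pos_def M"
  using assms by (auto simp: pos_def_def bform_def)

lemma pos_def_bform:
  "pos_def M \<Longrightarrow> M \<in> carrier_mat n n \<Longrightarrow> v \<in> carrier_vec n \<Longrightarrow> v \<noteq> 0\<^sub>v n \<Longrightarrow> bform M v v > 0"
  by (auto simp: pos_def_def bform_def)

lemma pos_def_bform_nonneg:
  assumes "pos_def M" "M \<in> carrier_mat n n" "v \<in> carrier_vec n" shows "bform M v v \<ge> 0"
proof (cases "v = 0\<^sub>v n")
  case True
  then show ?thesis using assms bform_zero_left[of M v] by auto
next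
  case False
  then show ?thesis using pos_def_bform[OF assms] by simp
qed

lemma pos_def_symmetric: "pos_def M \<Longrightarrow> transpose_mat M = M"
  by (simp add: pos_def_def)

lemma neg_defI:
  assumes "M \<in> carrier_mat n n" "transpose_mat M = M"
    and "\<And>v. v \<in> carrier_vec n \<Longrightarrow> v \<noteq> 0\<^sub>v n \<Longrightarrow> bform M v v < 0"
  shows "neg_def M"
  using assms by (auto simp: neg_def_def bform_def)

lemma neg_def_bform:
  "neg_def M \<Longrightarrow> M \<in> carrier_mat n n \<Longrightarrow> v \<in> carrier_vec n \<Longrightarrow> v \<noteq> 0\<^sub>v n \<Longrightarrow> bform M v v < 0"
  by (auto simp: neg_def_def bform_def)

lemma pos_def_iff:
  "M \<in> carrier_mat n n \<Longrightarrow> transpose_mat M = M \<Longrightarrow>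
    pos_def M \<longleftrightarrow> (\<forall>v\<in>carrier_vec n. v \<noteq> 0\<^sub>v n \<longrightarrow> bform M v v > 0)"
  by (auto simp: pos_def_def bform_def)

lemma neg_def_iff:
  "M \<in> carrier_mat n n \<Longrightarrow> transpose_mat M = M \<Longrightarrow>
    neg_def M \<longleftrightarrow> (\<forall>v\<in>carrier_vec n. v \<noteq> 0\<^sub>v n \<longrightarrow> bform M v v < 0)"
  by (auto simp: neg_def_def bform_def)

text \<open>The adjugate formula makes the entries rational functions of the entries of
  \<open>M\<close>, so that continuity in the clock value follows from continuity of
  determinants.\<close>

definition inv_mat :: "real mat \<Rightarrow> real mat" where
  "inv_mat M = inverse (det M) \<cdot>\<^sub>m adj_mat M"

lemma pos_def_det_nonzero:
  assumes "pos_def M" "M \<in> carrier_mat n n" shows "det M \<noteq> 0"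
proof
  assume "det M = 0"
  then obtain v where "v \<in> carrier_vec n" "v \<noteq> 0\<^sub>v n" "M *\<^sub>v v = 0\<^sub>v n"
    using det_0_iff_vec_prod_zero_field[OF assms(2)] by auto
  then show False using pos_def_bform[OF assms, of v] by (simp add: bform_def)
qed

context
  fixes M :: "real mat" and n :: nat
  assumes pd: "pos_def M" and M: "M \<in> carrier_mat n n"
begin

lemma inv_mat_carrier: "inv_mat M \<in> carrier_mat n n"
  using adj_mat[OF M] by (simp add: inv_mat_def)

lemma inv_mat_left: "inv_mat M * M = 1\<^sub>m n"
proof -
  have "inv_mat M * M = inverse (det M) \<cdot>\<^sub>m (det M \<cdot>\<^sub>m 1\<^sub>m n)"
    using adj_mat[OF M] mult_smult_assoc_mat[OF adj_mat(1)[OF M] M] by (simp add: inv_mat_def)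
  also have "\<dots> = 1\<^sub>m n"
    using pos_def_det_nonzero[OF pd M] by (intro eq_matI) auto
  finally show ?thesis .
qed

lemma inv_mat_right: "M * inv_mat M = 1\<^sub>m n"
proof -
  have "M * inv_mat M = inverse (det M) \<cdot>\<^sub>m (det M \<cdot>\<^sub>m 1\<^sub>m n)"
    using adj_mat[OF M] mult_smult_distrib[OF M adj_mat(1)[OF M]] by (simp add: inv_mat_def)
  also have "\<dots> = 1\<^sub>m n"
    using pos_def_det_nonzero[OF pd M] by (intro eq_matI) auto
  finally show ?thesis .
qed

lemma inv_mat_cancel:
  assumes "v \<in> carrier_vec n"
  shows "M *\<^sub>v (inv_mat M *\<^sub>v v) = v" "inv_mat M *\<^sub>v (M *\<^sub>v v) = v"
proof -
  show "M *\<^sub>v (inv_mat M *\<^sub>v v) = v"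
    using assoc_mult_mat_vec[OF M inv_mat_carrier assms] inv_mat_right assms by simp
  show "inv_mat M *\<^sub>v (M *\<^sub>v v) = v"
    using assoc_mult_mat_vec[OF inv_mat_carrier M assms] inv_mat_left assms by simp
qed

text \<open>The change of variables that turns statements about an inverse into statements about the
  matrix itself; by symmetry of \<open>M\<close>, one of the two factors \<open>inv_mat M\<close>
  cancels against \<open>M\<close>.\<close>

lemma bform_inv_mat:
  assumes "v \<in> carrier_vec n" "w \<in> carrier_vec n"
  shows "bform (inv_mat M) v w = bform M (inv_mat M *\<^sub>v v) (inv_mat M *\<^sub>v w)"
proof -
  have "bform M (inv_mat M *\<^sub>v v) (inv_mat M *\<^sub>v w) = bform M (inv_mat M *\<^sub>v w) (inv_mat M *\<^sub>v v)"
    by (rule bform_commute) (use pd M inv_mat_carrier in \<open>auto simp: pos_def_symmetric\<close>)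
  then show ?thesis
    using assms inv_mat_carrier inv_mat_cancel
    by (simp add: bform_def scalar_prod_commute[of v])
qed

lemma inv_mat_symmetric: "transpose_mat (inv_mat M) = inv_mat M"
proof (rule symmetric_bformI[OF inv_mat_carrier])
  fix v w :: "real vec" assume "v \<in> carrier_vec n" "w \<in> carrier_vec n"
  then show "bform (inv_mat M) v w = bform (inv_mat M) w v"
    using pd M inv_mat_carrier
    by (subst (1 2) bform_inv_mat)
      (auto intro!: bform_commute simp: pos_def_symmetric)
qed

lemma inv_mat_pos_def: "pos_def (inv_mat M)"
proof (rule pos_defI[OF inv_mat_carrier inv_mat_symmetric])
  fix v :: "real vec" assume v: "v \<in> carrier_vec n" "v \<noteq> 0\<^sub>v n"
  have "M *\<^sub>v 0\<^sub>v n = 0\<^sub>v n" using M by auto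
  then have "inv_mat M *\<^sub>v v \<noteq> 0\<^sub>v n"
    using inv_mat_cancel(1)[OF v(1)] v(2) by metis
  then show "bform (inv_mat M) v v > 0"
    using pos_def_bform[OF pd M] v inv_mat_carrier by (subst bform_inv_mat) auto
qed

end

subsection \<open>Continuous and differentiable matrix-valued maps\<close>

lemma continuous_mat_onD:
  assumes "continuous_mat_on S r c M"
  shows "\<tau> \<in> S \<Longrightarrow> M \<tau> \<in> carrier_mat r c"
    and "i < r \<Longrightarrow> j < c \<Longrightarrow> continuous_on S (\<lambda>\<tau>. M \<tau> $$ (i, j))"
    and "\<tau> \<in> S \<Longrightarrow> dim_row (M \<tau>) = r" "\<tau> \<in> S \<Longrightarrow> dim_col (M \<tau>) = c"
  using assms by (auto simp: continuous_mat_on_def)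

lemma continuous_mat_on_subset:
  "continuous_mat_on S r c M \<Longrightarrow> T \<subseteq> S \<Longrightarrow> continuous_mat_on T r c M"
  unfolding continuous_mat_on_def by (meson continuous_on_subset subsetD)

lemma continuous_mat_onI:
  assumes "\<And>\<tau>. \<tau> \<in> S \<Longrightarrow> M \<tau> \<in> carrier_mat r c"
    and "\<And>i j. i < r \<Longrightarrow> j < c \<Longrightarrow> continuous_on S (f i j)"
    and "\<And>i j \<tau>. i < r \<Longrightarrow> j < c \<Longrightarrow> \<tau> \<in> S \<Longrightarrow> M \<tau> $$ (i, j) = f i j \<tau>"
  shows "continuous_mat_on S r c M"
  unfolding continuous_mat_on_def
  using assms by (auto intro: continuous_on_eq[of S "f i j" for i j])

lemma continuous_mat_on_const: "M \<in> carrier_mat r c \<Longrightarrow> continuous_mat_on S r c (\<lambda>_. M)"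
  by (auto simp: continuous_mat_on_def)

lemma continuous_mat_on_transpose:
  assumes "continuous_mat_on S r c M"
  shows "continuous_mat_on S c r (\<lambda>\<tau>. transpose_mat (M \<tau>))"
  by (rule continuous_mat_onI[where f = "\<lambda>i j \<tau>. M \<tau> $$ (j, i)"])
    (use continuous_mat_onD[OF assms] in \<open>auto intro!: carrier_matI\<close>)

lemma continuous_mat_on_add:
  assumes "continuous_mat_on S r c M" "continuous_mat_on S r c M'"
  shows "continuous_mat_on S r c (\<lambda>\<tau>. M \<tau> + M' \<tau>)"
  by (rule continuous_mat_onI[where f = "\<lambda>i j \<tau>. M \<tau> $$ (i, j) + M' \<tau> $$ (i, j)"])
    (use continuous_mat_onD[OF assms(1)] continuous_mat_onD[OF assms(2)]
      in \<open>auto intro!: continuous_intros carrier_matI\<close>)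

lemma continuous_mat_on_minus:
  assumes "continuous_mat_on S r c M" "continuous_mat_on S r c M'"
  shows "continuous_mat_on S r c (\<lambda>\<tau>. M \<tau> - M' \<tau>)"
  by (rule continuous_mat_onI[where f = "\<lambda>i j \<tau>. M \<tau> $$ (i, j) - M' \<tau> $$ (i, j)"])
    (use continuous_mat_onD[OF assms(1)] continuous_mat_onD[OF assms(2)]
      in \<open>auto intro!: continuous_intros carrier_matI\<close>)

lemma continuous_mat_on_uminus:
  assumes "continuous_mat_on S r c M"
  shows "continuous_mat_on S r c (\<lambda>\<tau>. - M \<tau>)"
  by (rule continuous_mat_onI[where f = "\<lambda>i j \<tau>. - M \<tau> $$ (i, j)"])
    (use continuous_mat_onD[OF assms] in \<open>auto intro!: continuous_intros carrier_matI\<close>)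

lemma index_mult_mat_sum:
  fixes A B :: "'a :: semiring_0 mat"
  assumes "A \<in> carrier_mat r m" "B \<in> carrier_mat m c" "i < r" "j < c"
  shows "(A * B) $$ (i, j) = (\<Sum>k<m. A $$ (i, k) * B $$ (k, j))"
  using assms by (auto simp: scalar_prod_def atLeast0LessThan intro!: sum.cong)

lemma continuous_mat_on_mult:
  assumes "continuous_mat_on S r m M" "continuous_mat_on S m c M'"
  shows "continuous_mat_on S r c (\<lambda>\<tau>. M \<tau> * M' \<tau>)"
proof (rule continuous_mat_onI[where f = "\<lambda>i j \<tau>. \<Sum>k<m. M \<tau> $$ (i, k) * M' \<tau> $$ (k, j)"])
  show "M \<tau> * M' \<tau> \<in> carrier_mat r c" if "\<tau> \<in> S" for \<tau>
    using that continuous_mat_onD(1)[OF assms(1)] continuous_mat_onD(1)[OF assms(2)]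
    by (intro mult_carrier_mat) auto
  show "continuous_on S (\<lambda>\<tau>. \<Sum>k<m. M \<tau> $$ (i, k) * M' \<tau> $$ (k, j))" if "i < r" "j < c" for i j
    using that continuous_mat_onD(2)[OF assms(1)] continuous_mat_onD(2)[OF assms(2)]
    by (auto intro!: continuous_intros)
  show "(M \<tau> * M' \<tau>) $$ (i, j) = (\<Sum>k<m. M \<tau> $$ (i, k) * M' \<tau> $$ (k, j))"
    if "i < r" "j < c" "\<tau> \<in> S" for i j \<tau>
    using that continuous_mat_onD(1)[OF assms(1)] continuous_mat_onD(1)[OF assms(2)]
    by (intro index_mult_mat_sum) auto
qed

lemma continuous_mat_on_four_block:
  assumes "continuous_mat_on S r1 c1 A" "continuous_mat_on S r1 c2 B"
    "continuous_mat_on S r2 c1 C" "continuous_mat_on S r2 c2 D"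
  shows "continuous_mat_on S (r1 + r2) (c1 + c2) (\<lambda>\<tau>. four_block_mat (A \<tau>) (B \<tau>) (C \<tau>) (D \<tau>))"
proof (rule continuous_mat_onI[where f = "\<lambda>i j \<tau>. if i < r1
      then if j < c1 then A \<tau> $$ (i, j) else B \<tau> $$ (i, j - c1)
      else if j < c1 then C \<tau> $$ (i - r1, j) else D \<tau> $$ (i - r1, j - c1)"])
  note d = continuous_mat_onD[OF assms(1)] continuous_mat_onD[OF assms(2)]
    continuous_mat_onD[OF assms(3)] continuous_mat_onD[OF assms(4)]
  show "four_block_mat (A \<tau>) (B \<tau>) (C \<tau>) (D \<tau>) \<in> carrier_mat (r1 + r2) (c1 + c2)" if "\<tau> \<in> S" for \<tau>
    by (rule four_block_carrier_mat[OF continuous_mat_onD(1)[OF assms(1) that] continuous_mat_onD(1)[OF assms(4) that]])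
  show "continuous_on S (\<lambda>\<tau>. if i < r1
      then if j < c1 then A \<tau> $$ (i, j) else B \<tau> $$ (i, j - c1)
      else if j < c1 then C \<tau> $$ (i - r1, j) else D \<tau> $$ (i - r1, j - c1))"
    if "i < r1 + r2" "j < c1 + c2" for i j
    using that d by (cases "i < r1"; cases "j < c1") auto
  show "four_block_mat (A \<tau>) (B \<tau>) (C \<tau>) (D \<tau>) $$ (i, j) = (if i < r1
      then if j < c1 then A \<tau> $$ (i, j) else B \<tau> $$ (i, j - c1)
      else if j < c1 then C \<tau> $$ (i - r1, j) else D \<tau> $$ (i - r1, j - c1))"
    if "i < r1 + r2" "j < c1 + c2" "\<tau> \<in> S" for i j \<tau>
    using that d by auto
qed

lemma continuous_on_det:
  assumes "continuous_mat_on S n n M"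
  shows "continuous_on S (\<lambda>\<tau>. det (M \<tau>))"
proof (rule continuous_on_eq)
  show "continuous_on S (\<lambda>\<tau>. \<Sum>p\<in>{p. p permutes {0..<n}}. signof p * (\<Prod>i = 0..<n. M \<tau> $$ (i, p i)))"
  proof (intro continuous_intros)
    fix p i assume "p \<in> {p. p permutes {0..<n}}" "i \<in> {0..<n}"
    then have "i < n" "p i < n" using permutes_in_image[of p "{0..<n}" i] by auto
    then show "continuous_on S (\<lambda>\<tau>. M \<tau> $$ (i, p i))" by (rule continuous_mat_onD(2)[OF assms])
  qed
  show "(\<Sum>p\<in>{p. p permutes {0..<n}}. signof p * (\<Prod>i = 0..<n. M \<tau> $$ (i, p i))) = det (M \<tau>)"
    if "\<tau> \<in> S" for \<tau>
    using continuous_mat_onD(1)[OF assms that] by (auto simp: det_def)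
qed

lemma continuous_mat_on_inv_mat:
  assumes "continuous_mat_on S n n M" "\<And>\<tau>. \<tau> \<in> S \<Longrightarrow> pos_def (M \<tau>)"
  shows "continuous_mat_on S n n (\<lambda>\<tau>. inv_mat (M \<tau>))"
proof (rule continuous_mat_onI[where
      f = "\<lambda>i j \<tau>. inverse (det (M \<tau>)) * ((- 1) ^ (j + i) * det (mat_delete (M \<tau>) j i))"])
  note c = continuous_mat_onD[OF assms(1)]
  show "inv_mat (M \<tau>) \<in> carrier_mat n n" if "\<tau> \<in> S" for \<tau>
    using that c assms(2) by (auto intro: inv_mat_carrier)
  show "inv_mat (M \<tau>) $$ (i, j) = inverse (det (M \<tau>)) * ((- 1) ^ (j + i) * det (mat_delete (M \<tau>) j i))"
    if "i < n" "j < n" "\<tau> \<in> S" for i j \<tau>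
    using that c(1)[OF that(3)] by (auto simp: inv_mat_def adj_mat_def cofactor_def)
  fix i j assume ij: "i < n" "j < n"
  \<comment> \<open>The adjugate is a transposed cofactor matrix, so entry \<open>(i, j)\<close>
    deletes row \<open>j\<close> and column \<open>i\<close>; indices from the deleted one onwards
    shift by one.\<close>
  have "continuous_mat_on S (n - 1) (n - 1) (\<lambda>\<tau>. mat_delete (M \<tau>) j i)"
  proof (rule continuous_mat_onI[where
        f = "\<lambda>i' j' \<tau>. M \<tau> $$ (if i' < j then i' else Suc i', if j' < i then j' else Suc j')"])
    show "mat_delete (M \<tau>) j i \<in> carrier_mat (n - 1) (n - 1)" if "\<tau> \<in> S" for \<tau>
      using c(1)[OF that] by (auto simp: mat_delete_def)
    show "mat_delete (M \<tau>) j i $$ (i', j') =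
        M \<tau> $$ (if i' < j then i' else Suc i', if j' < i then j' else Suc j')"
      if "i' < n - 1" "j' < n - 1" "\<tau> \<in> S" for i' j' \<tau>
      using c(1)[OF that(3)] that by (auto simp: mat_delete_def)
  qed (auto intro!: c(2))
  then have "continuous_on S (\<lambda>\<tau>. det (mat_delete (M \<tau>) j i))" by (rule continuous_on_det)
  then show "continuous_on S (\<lambda>\<tau>. inverse (det (M \<tau>)) * ((- 1) ^ (j + i) * det (mat_delete (M \<tau>) j i)))"
    using pos_def_det_nonzero[OF assms(2) c(1)] continuous_on_det[OF assms(1)]
    by (intro continuous_intros) auto
qed

text \<open>A relational counterpart of \<open>mat_deriv\<close>: it composes by the usual
  derivative rules with an explicit candidate, whereas \<open>mat_deriv\<close> selects a value. On
  a closed interval of positive length the two agree, see \<open>mat_deriv_eq\<close>.\<close>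

definition has_mat_derivative_on ::
  "real set \<Rightarrow> nat \<Rightarrow> nat \<Rightarrow> (real \<Rightarrow> real mat) \<Rightarrow> (real \<Rightarrow> real mat) \<Rightarrow> bool" where
  "has_mat_derivative_on S r c M M' \<longleftrightarrow>
     (\<forall>\<tau> \<in> S. M \<tau> \<in> carrier_mat r c \<and> M' \<tau> \<in> carrier_mat r c) \<and>
     (\<forall>i < r. \<forall>j < c. \<forall>\<tau> \<in> S.
        ((\<lambda>s. M s $$ (i, j)) has_real_derivative M' \<tau> $$ (i, j)) (at \<tau> within S))"

lemma has_mat_derivative_onD:
  assumes "has_mat_derivative_on S r c M M'"
  shows "\<tau> \<in> S \<Longrightarrow> M \<tau> \<in> carrier_mat r c" "\<tau> \<in> S \<Longrightarrow> M' \<tau> \<in> carrier_mat r c"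
    and "i < r \<Longrightarrow> j < c \<Longrightarrow> \<tau> \<in> S \<Longrightarrow>
      ((\<lambda>s. M s $$ (i, j)) has_real_derivative M' \<tau> $$ (i, j)) (at \<tau> within S)"
    and "\<tau> \<in> S \<Longrightarrow> dim_row (M \<tau>) = r" "\<tau> \<in> S \<Longrightarrow> dim_col (M \<tau>) = c"
    "\<tau> \<in> S \<Longrightarrow> dim_row (M' \<tau>) = r" "\<tau> \<in> S \<Longrightarrow> dim_col (M' \<tau>) = c"
  using assms by (auto simp: has_mat_derivative_on_def)

lemma has_mat_derivative_onI:
  assumes "\<And>\<tau>. \<tau> \<in> S \<Longrightarrow> M \<tau> \<in> carrier_mat r c" "\<And>\<tau>. \<tau> \<in> S \<Longrightarrow> M' \<tau> \<in> carrier_mat r c"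
    and "\<And>i j \<tau>. i < r \<Longrightarrow> j < c \<Longrightarrow> \<tau> \<in> S \<Longrightarrow> M \<tau> $$ (i, j) = f i j \<tau>"
    and "\<And>i j \<tau>. i < r \<Longrightarrow> j < c \<Longrightarrow> \<tau> \<in> S \<Longrightarrow>
      (f i j has_real_derivative M' \<tau> $$ (i, j)) (at \<tau> within S)"
  shows "has_mat_derivative_on S r c M M'"
  unfolding has_mat_derivative_on_def
proof (intro conjI allI impI ballI)
  fix i j \<tau> assume "i < r" "j < c" "\<tau> \<in> S"
  then show "((\<lambda>s. M s $$ (i, j)) has_real_derivative M' \<tau> $$ (i, j)) (at \<tau> within S)"
    using assms(4)[of i j \<tau>] assms(3)
    unfolding has_real_derivative_iff_has_vector_derivative
    by (auto intro: has_vector_derivative_transform[of \<tau> S _ "f i j"])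
qed (use assms in auto)

lemma has_mat_derivative_on_continuous:
  "has_mat_derivative_on S r c M M' \<Longrightarrow> continuous_mat_on S r c M"
  by (auto simp: has_mat_derivative_on_def continuous_mat_on_def
      intro!: DERIV_continuous_on)

lemma has_mat_derivative_on_minus:
  assumes "has_mat_derivative_on S r c M M'" "has_mat_derivative_on S r c L L'"
  shows "has_mat_derivative_on S r c (\<lambda>\<tau>. M \<tau> - L \<tau>) (\<lambda>\<tau>. M' \<tau> - L' \<tau>)"
proof (rule has_mat_derivative_onI[where f = "\<lambda>i j \<tau>. M \<tau> $$ (i, j) - L \<tau> $$ (i, j)"])
  fix i j \<tau> assume a: "i < r" "j < c" "\<tau> \<in> S"
  have "(M' \<tau> - L' \<tau>) $$ (i, j) = M' \<tau> $$ (i, j) - L' \<tau> $$ (i, j)"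
    using a has_mat_derivative_onD[OF assms(1)] has_mat_derivative_onD[OF assms(2)] by auto
  then show "((\<lambda>\<tau>. M \<tau> $$ (i, j) - L \<tau> $$ (i, j)) has_real_derivative (M' \<tau> - L' \<tau>) $$ (i, j)) (at \<tau> within S)"
    using DERIV_diff[OF has_mat_derivative_onD(3)[OF assms(1) a] has_mat_derivative_onD(3)[OF assms(2) a]]
    by simp
qed (use has_mat_derivative_onD[OF assms(1)] has_mat_derivative_onD[OF assms(2)] in \<open>auto intro!: carrier_matI\<close>)

lemma has_mat_derivative_on_add_const:
  assumes "has_mat_derivative_on S r c M M'" "L \<in> carrier_mat r c"
  shows "has_mat_derivative_on S r c (\<lambda>\<tau>. M \<tau> + L) M'"
  by (rule has_mat_derivative_onI[where f = "\<lambda>i j \<tau>. M \<tau> $$ (i, j) + L $$ (i, j)"])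
    (use has_mat_derivative_onD[OF assms(1)] assms(2) in \<open>auto intro!: derivative_eq_intros carrier_matI\<close>)

lemma has_mat_derivative_on_four_block:
  assumes "has_mat_derivative_on S r1 c1 A A'" "has_mat_derivative_on S r1 c2 B B'"
    "has_mat_derivative_on S r2 c1 C C'" "has_mat_derivative_on S r2 c2 D D'"
  shows "has_mat_derivative_on S (r1 + r2) (c1 + c2)
    (\<lambda>\<tau>. four_block_mat (A \<tau>) (B \<tau>) (C \<tau>) (D \<tau>))
    (\<lambda>\<tau>. four_block_mat (A' \<tau>) (B' \<tau>) (C' \<tau>) (D' \<tau>))"
proof (rule has_mat_derivative_onI[where f = "\<lambda>i j \<tau>. if i < r1
      then if j < c1 then A \<tau> $$ (i, j) else B \<tau> $$ (i, j - c1)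
      else if j < c1 then C \<tau> $$ (i - r1, j) else D \<tau> $$ (i - r1, j - c1)"])
  note d = has_mat_derivative_onD(1-3)[OF assms(1)] has_mat_derivative_onD(1-3)[OF assms(2)]
    has_mat_derivative_onD(1-3)[OF assms(3)] has_mat_derivative_onD(1-3)[OF assms(4)]
  fix i j \<tau> assume a: "i < r1 + r2" "j < c1 + c2" "\<tau> \<in> S"
  note dd = d(1,2,4,5,7,8,10,11)[OF a(3)]
  show "four_block_mat (A \<tau>) (B \<tau>) (C \<tau>) (D \<tau>) $$ (i, j) = (if i < r1
      then if j < c1 then A \<tau> $$ (i, j) else B \<tau> $$ (i, j - c1)
      else if j < c1 then C \<tau> $$ (i - r1, j) else D \<tau> $$ (i - r1, j - c1))"
    using a dd by auto
  have e: "four_block_mat (A' \<tau>) (B' \<tau>) (C' \<tau>) (D' \<tau>) $$ (i, j) = (if i < r1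
      then if j < c1 then A' \<tau> $$ (i, j) else B' \<tau> $$ (i, j - c1)
      else if j < c1 then C' \<tau> $$ (i - r1, j) else D' \<tau> $$ (i - r1, j - c1))"
    using a dd by auto
  show "((\<lambda>\<tau>. if i < r1
      then if j < c1 then A \<tau> $$ (i, j) else B \<tau> $$ (i, j - c1)
      else if j < c1 then C \<tau> $$ (i - r1, j) else D \<tau> $$ (i - r1, j - c1)) has_real_derivative
      four_block_mat (A' \<tau>) (B' \<tau>) (C' \<tau>) (D' \<tau>) $$ (i, j)) (at \<tau> within S)"
    unfolding e using a d(3)[of i j \<tau>] d(6)[of i "j - c1" \<tau>] d(9)[of "i - r1" j \<tau>]
      d(12)[of "i - r1" "j - c1" \<tau>] by auto
qed (use has_mat_derivative_onD[OF assms(1)] has_mat_derivative_onD[OF assms(4)] in auto)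

lemma has_mat_derivative_on_upper_left_block:
  assumes "has_mat_derivative_on S n n M M'" "m \<le> n"
  shows "has_mat_derivative_on S m m (\<lambda>\<tau>. upper_left_block m (M \<tau>)) (\<lambda>\<tau>. upper_left_block m (M' \<tau>))"
  by (rule has_mat_derivative_onI[where f = "\<lambda>i j \<tau>. M \<tau> $$ (i, j)"])
    (use has_mat_derivative_onD[OF assms(1)] assms(2) in \<open>auto simp: upper_left_block_def\<close>)

text \<open>The resolvent identity. Divided by the increment of the clock it is the difference
  quotient of the inverse, so no determinant has to be differentiated.\<close>

lemma inv_mat_minus_inv_mat:
  assumes "pos_def L" "L \<in> carrier_mat n n" "pos_def M" "M \<in> carrier_mat n n"
  shows "inv_mat L - inv_mat M = - (inv_mat L * (L - M) * inv_mat M)"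
proof -
  note [simp] = inv_mat_carrier[OF assms(1,2)] inv_mat_carrier[OF assms(3,4)] assms(2,4)
  have "inv_mat L * (L - M) * inv_mat M = (1\<^sub>m n - inv_mat L * M) * inv_mat M"
    using mult_minus_distrib_mat[of "inv_mat L" n n L n M] inv_mat_left[OF assms(1,2)] by simp
  also have "\<dots> = 1\<^sub>m n * inv_mat M - inv_mat L * M * inv_mat M"
    by (rule minus_mult_distrib_mat[of _ n n _ _ n]) (auto intro: mult_carrier_mat[of _ n n])
  also have "\<dots> = inv_mat M - inv_mat L * (M * inv_mat M)"
    using assoc_mult_mat[of "inv_mat L" n n M n "inv_mat M" n]
      left_mult_one_mat[OF inv_mat_carrier[OF assms(3,4)]] by simp
  also have "\<dots> = inv_mat M - inv_mat L"
    using inv_mat_right[OF assms(3,4)] right_mult_one_mat[OF inv_mat_carrier[OF assms(1,2)]] by simp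
  finally show ?thesis
    using carrier_matD[OF inv_mat_carrier[OF assms(1,2)]] carrier_matD[OF inv_mat_carrier[OF assms(3,4)]]
    by (auto intro!: eq_matI)
qed

lemma index_mult3_mat_sum:
  fixes A B C :: "real mat"
  assumes "A \<in> carrier_mat n n" "B \<in> carrier_mat n n" "C \<in> carrier_mat n n" "i < n" "j < n"
  shows "(A * B * C) $$ (i, j) = (\<Sum>l<n. (\<Sum>k<n. A $$ (i, k) * B $$ (k, l)) * C $$ (l, j))"
  using assms index_mult_mat_sum[OF mult_carrier_mat[OF assms(1,2)] assms(3-5)]
  by (simp add: index_mult_mat_sum[of A n n B n i] del: index_mult_mat)

text \<open>By the resolvent identity the difference quotient of the inverse is minus the inverse at
  \<open>s\<close>, times the difference quotient of \<open>M\<close>, times the inverse at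
  \<open>t\<close>. Continuity of the inverse then gives the limit.\<close>

lemma has_mat_derivative_on_inv_mat:
  assumes d: "has_mat_derivative_on S n n M M'" and pd: "\<And>\<tau>. \<tau> \<in> S \<Longrightarrow> pos_def (M \<tau>)"
  shows "has_mat_derivative_on S n n (\<lambda>\<tau>. inv_mat (M \<tau>)) (\<lambda>\<tau>. - (inv_mat (M \<tau>) * M' \<tau> * inv_mat (M \<tau>)))"
  unfolding has_mat_derivative_on_def
proof (intro conjI allI impI ballI)
  note dD = has_mat_derivative_onD[OF d]
  have ic: "inv_mat (M \<tau>) \<in> carrier_mat n n" if "\<tau> \<in> S" for \<tau>
    using inv_mat_carrier[OF pd dD(1)] that by auto
  show "inv_mat (M \<tau>) \<in> carrier_mat n n" if "\<tau> \<in> S" for \<tau> by (rule ic[OF that])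
  show "- (inv_mat (M \<tau>) * M' \<tau> * inv_mat (M \<tau>)) \<in> carrier_mat n n" if "\<tau> \<in> S" for \<tau>
    using ic[OF that] dD(2)[OF that] by auto
  fix i j t assume a: "i < n" "j < n" "t \<in> S"
  define I where "I s = inv_mat (M s)" for s
  have cI: "continuous_mat_on S n n I"
    unfolding I_def
    by (rule continuous_mat_on_inv_mat[OF has_mat_derivative_on_continuous[OF d] pd])
  have quot: "((\<lambda>s. (M s $$ (k, l) - M t $$ (k, l)) / (s - t)) \<longlongrightarrow> M' t $$ (k, l)) (at t within S)"
    if "k < n" "l < n" for k l
    using dD(3)[OF that a(3)] by (simp add: has_field_derivative_iff)
  have lim: "((\<lambda>s. I s $$ (k, l)) \<longlongrightarrow> I t $$ (k, l)) (at t within S)" if "k < n" "l < n" for k l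
    using continuous_mat_onD(2)[OF cI that] a(3) by (simp add: continuous_on_def)
  have "((\<lambda>s. - (\<Sum>l<n. (\<Sum>k<n. I s $$ (i, k) * ((M s $$ (k, l) - M t $$ (k, l)) / (s - t))) * I t $$ (l, j)))
      \<longlongrightarrow> - (\<Sum>l<n. (\<Sum>k<n. I t $$ (i, k) * M' t $$ (k, l)) * I t $$ (l, j))) (at t within S)"
    using a by (intro tendsto_intros quot lim) auto
  also have "- (\<Sum>l<n. (\<Sum>k<n. I t $$ (i, k) * M' t $$ (k, l)) * I t $$ (l, j)) =
      (- (I t * M' t * I t)) $$ (i, j)"
    using a index_mult3_mat_sum[OF ic dD(2) ic, of t t t i j] ic[OF a(3)] by (auto simp: I_def)
  finally have main: "((\<lambda>s. - (\<Sum>l<n. (\<Sum>k<n. I s $$ (i, k) * ((M s $$ (k, l) - M t $$ (k, l)) / (s - t))) * I t $$ (l, j)))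
      \<longlongrightarrow> (- (I t * M' t * I t)) $$ (i, j)) (at t within S)" .
  \<comment> \<open>No case distinction is made at \<open>s = t\<close>: division by zero makes both
    sides zero there.\<close>
  have eq: "- (\<Sum>l<n. (\<Sum>k<n. I s $$ (i, k) * ((M s $$ (k, l) - M t $$ (k, l)) / (s - t))) * I t $$ (l, j)) =
      (I s $$ (i, j) - I t $$ (i, j)) / (s - t)" if "s \<in> S" for s
  proof -
    have "I s $$ (i, j) - I t $$ (i, j) = (I s - I t) $$ (i, j)"
      using a that ic[OF a(3)] by (auto simp: I_def)
    also have "\<dots> = (- (I s * (M s - M t) * I t)) $$ (i, j)"
      unfolding I_def using inv_mat_minus_inv_mat[OF pd dD(1) pd dD(1), of s t] that a by simp
    also have "\<dots> = - (I s * (M s - M t) * I t) $$ (i, j)"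
      using a that ic[OF a(3)] ic[OF that] by (auto simp: I_def)
    also have "(I s * (M s - M t) * I t) $$ (i, j) =
        (\<Sum>l<n. (\<Sum>k<n. I s $$ (i, k) * (M s - M t) $$ (k, l)) * I t $$ (l, j))"
      unfolding I_def using a that ic dD(1) by (intro index_mult3_mat_sum minus_carrier_mat) auto
    also have "\<dots> = (\<Sum>l<n. (\<Sum>k<n. I s $$ (i, k) * (M s $$ (k, l) - M t $$ (k, l))) * I t $$ (l, j))"
      using dD(1)[OF a(3)] dD(1)[OF that] by (auto intro!: sum.cong)
    finally show ?thesis
      by (simp flip: sum_divide_distrib)
  qed
  show "((\<lambda>s. inv_mat (M s) $$ (i, j)) has_real_derivative
      (- (inv_mat (M t) * M' t * inv_mat (M t))) $$ (i, j)) (at t within S)"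
    unfolding has_field_derivative_iff
    by (rule Lim_transform_eventually[OF main[unfolded I_def]])
      (use eq in \<open>auto simp: eventually_at_filter I_def\<close>)
qed

lemma C1_symmetric_onD:
  assumes "C1_symmetric_on S n M"
  shows "\<tau> \<in> S \<Longrightarrow> M \<tau> \<in> carrier_mat n n" "\<tau> \<in> S \<Longrightarrow> transpose_mat (M \<tau>) = M \<tau>"
    and "has_mat_derivative_on S n n M (mat_deriv S M)"
    and "continuous_mat_on S n n (mat_deriv S M)"
proof -
  show "\<tau> \<in> S \<Longrightarrow> M \<tau> \<in> carrier_mat n n" "\<tau> \<in> S \<Longrightarrow> transpose_mat (M \<tau>) = M \<tau>"
    "continuous_mat_on S n n (mat_deriv S M)"
    using assms by (auto simp: C1_symmetric_on_def)
  show "has_mat_derivative_on S n n M (mat_deriv S M)"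
    unfolding has_mat_derivative_on_def
  proof (intro conjI allI impI ballI)
    fix i j \<tau> assume a: "i < n" "j < n" "\<tau> \<in> S"
    have "(\<lambda>s. M s $$ (i, j)) differentiable (at \<tau> within S)" "M \<tau> \<in> carrier_mat n n"
      using a assms by (auto simp: C1_symmetric_on_def)
    then show "((\<lambda>s. M s $$ (i, j)) has_real_derivative mat_deriv S M \<tau> $$ (i, j)) (at \<tau> within S)"
      using a by (auto simp: mat_deriv_def vector_derivative_works
          has_real_derivative_iff_has_vector_derivative)
  qed (use assms in \<open>auto simp: C1_symmetric_on_def mat_deriv_def\<close>)
qed

text \<open>An interval of positive length has no isolated points, so the one-sided derivatives at
  its end points are unique too and the value selected by \<open>mat_deriv\<close> is the given
  one.\<close>

lemma mat_deriv_eq: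
  assumes "0 < T" "has_mat_derivative_on {0..T} r c M M'" "\<tau> \<in> {0..T}"
  shows "mat_deriv {0..T} M \<tau> = M' \<tau>"
proof (rule eq_matI)
  note d = has_mat_derivative_onD[OF assms(2)]
  fix i j assume ij: "i < dim_row (M' \<tau>)" "j < dim_col (M' \<tau>)"
  then have "((\<lambda>s. M s $$ (i, j)) has_vector_derivative M' \<tau> $$ (i, j)) (at \<tau> within {0..T})"
    using d(2)[OF assms(3)] d(3)[of i j \<tau>] assms(3) by (auto simp: has_real_derivative_iff_has_vector_derivative)
  then have "vector_derivative (\<lambda>s. M s $$ (i, j)) (at \<tau> within {0..T}) = M' \<tau> $$ (i, j)"
    by (rule vector_derivative_within_closed_interval[OF assms(1,3)])
  then show "mat_deriv {0..T} M \<tau> $$ (i, j) = M' \<tau> $$ (i, j)"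
    using ij d(1,2)[OF assms(3)] by (auto simp: mat_deriv_def)
qed (use has_mat_derivative_onD(1,2)[OF assms(2,3)] in \<open>auto simp: mat_deriv_def\<close>)

lemma C1_symmetric_onI:
  assumes "0 < T" "has_mat_derivative_on {0..T} n n M M'" "continuous_mat_on {0..T} n n M'"
    and "\<And>\<tau>. \<tau> \<in> {0..T} \<Longrightarrow> transpose_mat (M \<tau>) = M \<tau>"
  shows "C1_symmetric_on {0..T} n M"
  unfolding C1_symmetric_on_def
proof (intro conjI allI impI ballI)
  note d = has_mat_derivative_onD[OF assms(2)]
  show "(\<lambda>s. M s $$ (i, j)) differentiable (at \<tau> within {0..T})" if "i < n" "j < n" "\<tau> \<in> {0..T}" for i j \<tau>
    using d(3)[OF that] by (auto simp: has_real_derivative_iff_has_vector_derivative intro: differentiableI_vector)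
  show "continuous_mat_on {0..T} n n (mat_deriv {0..T} M)"
    using continuous_mat_onD[OF assms(3)] mat_deriv_eq[OF assms(1,2)]
    by (intro continuous_mat_onI[where f = "\<lambda>i j \<tau>. M' \<tau> $$ (i, j)"]) auto
qed (use assms has_mat_derivative_onD[OF assms(2)] in \<open>auto intro!: carrier_matI\<close>)

lemma mat_deriv_symmetric:
  assumes "C1_symmetric_on S n M" "\<tau> \<in> S"
  shows "transpose_mat (mat_deriv S M \<tau>) = mat_deriv S M \<tau>"
proof (rule eq_matI)
  note M = C1_symmetric_onD(1,2)[OF assms(1)]
  have e: "M s $$ (i, j) = M s $$ (j, i)" if "i < n" "j < n" "s \<in> S" for i j s
    using M[OF that(3)] that(1,2) by (metis carrier_matD index_transpose_mat(1))
  fix i j assume "i < dim_row (mat_deriv S M \<tau>)" "j < dim_col (mat_deriv S M \<tau>)"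
  then have ij: "i < n" "j < n" using M(1)[OF assms(2)] by (auto simp: mat_deriv_def)
  have "vector_derivative (\<lambda>s. M s $$ (j, i)) (at \<tau> within S) = vector_derivative (\<lambda>s. M s $$ (i, j)) (at \<tau> within S)"
    using assms(2) e[OF ij]
    by (intro vector_derivative_cong_eq) (auto simp: eventually_nhds intro: exI[of _ UNIV])
  then show "transpose_mat (mat_deriv S M \<tau>) $$ (i, j) = mat_deriv S M \<tau> $$ (i, j)"
    using ij M(1)[OF assms(2)] by (auto simp: mat_deriv_def)
qed (use C1_symmetric_onD(1)[OF assms] in \<open>auto simp: mat_deriv_def\<close>)

subsection \<open>A uniform Finsler lemma\<close>

text \<open>Bolzano-Weierstrass in coordinates; each induction step refines the subsequence so that
  one more coordinate converges.\<close>

lemma bounded_coordinates_convergent_subseq: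
  fixes f :: "nat \<Rightarrow> nat \<Rightarrow> real"
  assumes "\<And>k i. i < n \<Longrightarrow> \<bar>f k i\<bar> \<le> b"
  shows "\<exists>r l. strict_mono (r :: nat \<Rightarrow> nat) \<and> (\<forall>i<n. (\<lambda>k. f (r k) i) \<longlonglongrightarrow> l i)"
  using assms
proof (induction n)
  case 0
  show ?case by (intro exI[of _ id]) (auto simp: strict_mono_def)
next
  case (Suc n)
  then obtain r l where r: "strict_mono (r :: nat \<Rightarrow> nat)" "\<And>i. i < n \<Longrightarrow> (\<lambda>k. f (r k) i) \<longlonglongrightarrow> l i"
    by force
  have "compact {-b..b}" by simp
  moreover have "\<forall>k. f (r k) n \<in> {-b..b}"
    using Suc.prems[of n] by (auto simp: abs_le_iff minus_le_iff)
  ultimately obtain x s where s: "strict_mono (s :: nat \<Rightarrow> nat)" "((\<lambda>k. f (r k) n) \<circ> s) \<longlonglongrightarrow> x"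
    by (metis compact_imp_seq_compact seq_compactE)
  have "strict_mono (r \<circ> s)" using r(1) s(1) by (rule strict_mono_o)
  moreover have "(\<lambda>k. f ((r \<circ> s) k) i) \<longlonglongrightarrow> (l(n := x)) i" if "i < Suc n" for i
  proof (cases "i = n")
    case False
    then show ?thesis
      using that LIMSEQ_subseq_LIMSEQ[OF r(2)[of i] s(1)] by (simp add: o_def)
  qed (use s(2) in \<open>simp add: o_def\<close>)
  ultimately show ?case by blast
qed

text \<open>If no weight works, then in particular no \<open>Suc k\<close> does. The normalised
  violating vectors and their clock values accumulate by compactness. At the limit the form of
  \<open>D\<close> is zero, since it is bounded by a convergent sequence divided by
  \<open>Suc k\<close>, and the form of \<open>Q\<close> is not positive, which contradicts the
  assumption on null vectors of \<open>D\<close>.\<close>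

lemma uniform_finsler:
  fixes S :: "real set"
  assumes S: "compact S" and Q: "continuous_mat_on S n n Q" and D: "continuous_mat_on S n n D"
    and D0: "\<And>\<tau> v. \<tau> \<in> S \<Longrightarrow> v \<in> carrier_vec n \<Longrightarrow> bform (D \<tau>) v v \<ge> 0"
    and QD: "\<And>\<tau> v. \<tau> \<in> S \<Longrightarrow> v \<in> carrier_vec n \<Longrightarrow> v \<noteq> 0\<^sub>v n \<Longrightarrow> bform (D \<tau>) v v = 0 \<Longrightarrow> bform (Q \<tau>) v v > 0"
  shows "\<exists>\<mu>>0. \<forall>\<tau>\<in>S. \<forall>v\<in>carrier_vec n. v \<noteq> 0\<^sub>v n \<longrightarrow> bform (Q \<tau>) v v + \<mu> * bform (D \<tau>) v v > 0"
proof (rule ccontr)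
  assume no: "\<not> ?thesis"
  \<comment> \<open>Scaling a violating vector to unit length multiplies both forms by the same
    positive factor.\<close>
  have "\<exists>t u. t \<in> S \<and> u \<in> carrier_vec n \<and> u \<bullet> u = 1 \<and>
      bform (Q t) u u + real (Suc k) * bform (D t) u u \<le> 0" for k
  proof -
    obtain t v where v: "t \<in> S" "v \<in> carrier_vec n" "v \<noteq> 0\<^sub>v n"
        "bform (Q t) v v + real (Suc k) * bform (D t) v v \<le> 0"
      using no by (metis not_less of_nat_0_less_iff zero_less_Suc)
    define c where "c = 1 / sqrt (v \<bullet> v)"
    have p: "v \<bullet> v > 0" using scalar_prod_self_pos[OF v(2,3)] .
    have cc: "c * c * (v \<bullet> v) = 1" using p by (simp add: c_def)
    have e: "bform A (c \<cdot>\<^sub>v v) (c \<cdot>\<^sub>v v) = c * c * bform A v v" if "A \<in> carrier_mat n n" for A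
      using that v(2) by (intro bform_smult_vec) auto
    have "(c \<cdot>\<^sub>v v) \<bullet> (c \<cdot>\<^sub>v v) = 1"
      using e[of "1\<^sub>m n"] v(2) cc by (simp add: bform_one_mat)
    moreover have "bform (Q t) (c \<cdot>\<^sub>v v) (c \<cdot>\<^sub>v v) + real (Suc k) * bform (D t) (c \<cdot>\<^sub>v v) (c \<cdot>\<^sub>v v) =
        c * c * (bform (Q t) v v + real (Suc k) * bform (D t) v v)"
      using e[OF continuous_mat_onD(1)[OF Q v(1)]] e[OF continuous_mat_onD(1)[OF D v(1)]]
      by (simp add: algebra_simps)
    moreover have "\<dots> \<le> 0" using v(4) by (intro mult_nonneg_nonpos) auto
    ultimately show ?thesis using v(1,2) by (intro exI[of _ t] exI[of _ "c \<cdot>\<^sub>v v"]) auto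
  qed
  then obtain t u where tu: "\<And>k. t k \<in> S" "\<And>k. u k \<in> carrier_vec n" "\<And>k. u k \<bullet> u k = 1"
      "\<And>k. bform (Q (t k)) (u k) (u k) + real (Suc k) * bform (D (t k)) (u k) (u k) \<le> 0"
    by metis
  obtain t0 r where r: "t0 \<in> S" "strict_mono (r :: nat \<Rightarrow> nat)" "(t \<circ> r) \<longlonglongrightarrow> t0"
    using compact_imp_seq_compact[OF S] tu(1) by (metis seq_compactE)
  have "\<bar>u (r k) $ i\<bar> \<le> 1" if "i < n" for k i
  proof -
    have "u (r k) $ i * u (r k) $ i \<le> u (r k) \<bullet> u (r k)"
      using that tu(2)[of "r k"] unfolding scalar_prod_def by (intro member_le_sum) auto
    then show ?thesis using tu(3)[of "r k"] using abs_square_le_1[of "u (r k) $ i"]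
      by (simp add: power2_eq_square)
  qed
  from bounded_coordinates_convergent_subseq[of n "\<lambda>k i. u (r k) $ i", OF this]
  obtain s l where s: "strict_mono (s :: nat \<Rightarrow> nat)" and l: "\<And>i. i < n \<Longrightarrow> (\<lambda>k. u (r (s k)) $ i) \<longlonglongrightarrow> l i"
    by auto
  define h where "h = r \<circ> s"
  define v where "v = vec n l"
  have h: "strict_mono h" unfolding h_def using r(2) s by (rule strict_mono_o)
  have th: "(\<lambda>k. t (h k)) \<longlonglongrightarrow> t0"
    using LIMSEQ_subseq_LIMSEQ[OF r(3) s] by (simp add: h_def o_def)
  have uh: "(\<lambda>k. u (h k) $ i) \<longlonglongrightarrow> v $ i" if "i < n" for i
    using l[OF that] that by (simp add: h_def v_def)
  have lim: "(\<lambda>k. bform (A (t (h k))) (u (h k)) (u (h k))) \<longlonglongrightarrow> bform (A t0) v v"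
    if A: "continuous_mat_on S n n A" for A
  proof -
    note cA = continuous_mat_onD[OF A]
    have en: "(\<lambda>k. A (t (h k)) $$ (i, j)) \<longlonglongrightarrow> A t0 $$ (i, j)" if "i < n" "j < n" for i j
      using continuous_on_tendsto_compose[OF cA(2)[OF that] th r(1)] tu(1) by auto
    have "(\<lambda>k. \<Sum>i<n. \<Sum>j<n. u (h k) $ i * A (t (h k)) $$ (i, j) * u (h k) $ j)
        \<longlonglongrightarrow> (\<Sum>i<n. \<Sum>j<n. v $ i * A t0 $$ (i, j) * v $ j)"
      by (intro tendsto_intros en uh) auto
    moreover have "bform (A (t (h k))) (u (h k)) (u (h k)) =
        (\<Sum>i<n. \<Sum>j<n. u (h k) $ i * A (t (h k)) $$ (i, j) * u (h k) $ j)" for k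
      using cA(1)[OF tu(1)[of "h k"]] tu(2)[of "h k"] by (subst bform_sum) auto
    moreover have "bform (A t0) v v = (\<Sum>i<n. \<Sum>j<n. v $ i * A t0 $$ (i, j) * v $ j)"
      using cA(1)[OF r(1)] by (subst bform_sum) (auto simp: v_def)
    ultimately show ?thesis by simp
  qed
  \<comment> \<open>The limit statement applied to the constant identity matrix: unit length
    survives the limit, hence \<open>v\<close> is nonzero.\<close>
  have "(\<lambda>k. bform (1\<^sub>m n) (u (h k)) (u (h k))) \<longlonglongrightarrow> bform (1\<^sub>m n) v v"
    by (rule lim[OF continuous_mat_on_const]) simp
  moreover have "bform (1\<^sub>m n) (u (h k)) (u (h k)) = 1" for k
    using tu(2,3)[of "h k"] by (simp add: bform_one_mat)
  ultimately have "bform (1\<^sub>m n) v v = 1" by (simp add: LIMSEQ_const_iff)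
  then have v0: "v \<noteq> 0\<^sub>v n" "v \<in> carrier_vec n" by (auto simp: v_def bform_one_mat)
  define q d where "q k = bform (Q (t (h k))) (u (h k)) (u (h k))"
    and "d k = bform (D (t (h k))) (u (h k)) (u (h k))" for k
  have ql: "q \<longlonglongrightarrow> bform (Q t0) v v" and dl: "d \<longlonglongrightarrow> bform (D t0) v v"
    using lim[OF Q] lim[OF D] by (simp_all add: q_def[abs_def] d_def[abs_def])
  have d0: "d k \<ge> 0" for k unfolding d_def by (rule D0[OF tu(1,2)])
  have qd: "q k + real (Suc (h k)) * d k \<le> 0" for k unfolding q_def d_def by (rule tu(4))
  have "q k \<le> 0" for k using qd[of k] d0[of k] by (smt (verit) mult_nonneg_nonneg of_nat_0_le_iff)
  then have "bform (Q t0) v v \<le> 0" using LIMSEQ_le_const2[OF ql] by auto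
  moreover have "bform (D t0) v v \<le> 0"
  proof -
    \<comment> \<open>The sequence \<open>q\<close> converges and \<open>Suc (h k)\<close> tends to
      infinity, so the upper bound on \<open>d\<close> tends to zero.\<close>
    have "(\<lambda>k. - q k * inverse (real (Suc (h k)))) \<longlonglongrightarrow> - bform (Q t0) v v * 0"
      using LIMSEQ_subseq_LIMSEQ[OF LIMSEQ_inverse_real_of_nat h]
      by (intro tendsto_intros ql) (simp add: o_def)
    moreover have "d k \<le> - q k * inverse (real (Suc (h k)))" for k
      using qd[of k] by (simp add: field_simps)
    ultimately show ?thesis using LIMSEQ_le[OF dl] by auto
  qed
  ultimately show False using QD[OF r(1) v0(2,1)] D0[OF r(1) v0(2)] by simp
qed

subsection \<open>Kernel bases and block vectors\<close>

text \<open>Together these facts make multiplication by \<open>V\<close> a bijection from coordinate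
  vectors onto the kernel, which is all that the jump inequality uses. Independence and span inside
  the kernel are transferred to the ambient space by \<open>lindep_same\<close> and
  \<open>span_same\<close>.\<close>

lemma kernel_basis_matrixD:
  assumes C: "C \<in> carrier_mat q n" and kb: "kernel_basis_matrix C V"
  shows "V \<in> carrier_mat n (dim_col V)"
    and "z \<in> carrier_vec (dim_col V) \<Longrightarrow> C *\<^sub>v (V *\<^sub>v z) = 0\<^sub>v q"
    and "z \<in> carrier_vec (dim_col V) \<Longrightarrow> V *\<^sub>v z = 0\<^sub>v n \<Longrightarrow> z = 0\<^sub>v (dim_col V)"
    and "x \<in> carrier_vec n \<Longrightarrow> C *\<^sub>v x = 0\<^sub>v q \<Longrightarrow> \<exists>z\<in>carrier_vec (dim_col V). x = V *\<^sub>v z"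
proof -
  interpret kernel q n C by unfold_locales (rule C)
  show V: "V \<in> carrier_mat n (dim_col V)"
    using kb C by (auto simp: kernel_basis_matrix_def)
  have basis: "basis (set (cols V))" and dist: "distinct (cols V)"
    using kb C by (auto simp: kernel_basis_matrix_def)
  have sub: "set (cols V) \<subseteq> mat_kernel C"
    using basis by (simp add: Ker.basis_def)
  have colsc: "set (cols V) \<subseteq> carrier_vec n"
    using cols_dim[of V] V by auto
  show "C *\<^sub>v (V *\<^sub>v z) = 0\<^sub>v q" if z: "z \<in> carrier_vec (dim_col V)" for z
  proof -
    have "C * V = 0\<^sub>m q (dim_col V)"
    proof (rule eq_matI)
      fix i j assume ij: "i < dim_row (0\<^sub>m q (dim_col V))" "j < dim_col (0\<^sub>m q (dim_col V))"
      then have "col V j \<in> mat_kernel C" using sub by (auto simp: cols_def)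
      then have "C *\<^sub>v col V j = 0\<^sub>v q" using mat_kernelD[OF C] by blast
      then have "(C *\<^sub>v col V j) $ i = 0" using ij by simp
      moreover have "i < dim_row C" using ij C by simp
      ultimately have "row C i \<bullet> col V j = 0" by (simp only: index_mult_mat_vec)
      then show "(C * V) $$ (i, j) = 0\<^sub>m q (dim_col V) $$ (i, j)"
        using ij \<open>i < dim_row C\<close> by (simp only: index_mult_mat index_zero_mat)
    qed (use C in simp_all)
    moreover have "0\<^sub>m q (dim_col V) *\<^sub>v z = 0\<^sub>v q" using z by (intro eq_vecI) auto
    ultimately show ?thesis using assoc_mult_mat_vec[OF C V z] by simp
  qed
  have indpt: "\<not> NC.lin_dep (set (cols V))"
    using basis lindep_same[OF sub] by (simp add: Ker.basis_def)
  show "z = 0\<^sub>v (dim_col V)" if "z \<in> carrier_vec (dim_col V)" "V *\<^sub>v z = 0\<^sub>v n" for z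
    using NC.lin_depI[OF V that(1) _ that(2) dist] indpt by blast
  show "\<exists>z\<in>carrier_vec (dim_col V). x = V *\<^sub>v z" if x: "x \<in> carrier_vec n" "C *\<^sub>v x = 0\<^sub>v q" for x
  proof -
    have "x \<in> NC.span (set (cols V))"
      using basis mat_kernelI[OF C x] span_same[OF sub] by (simp add: Ker.basis_def)
    then have "x \<in> NC.span_list (cols V)" by (simp add: NC.span_list_as_span[OF colsc])
    then obtain c where "x = NC.lincomb_list c (cols V)" by (auto simp: NC.span_list_def)
    moreover have "\<forall>w\<in>set (cols V). dim_vec w = n" using colsc carrier_vecD by blast
    ultimately have "x = mat_of_cols n (cols V) *\<^sub>v vec (length (cols V)) c"
      by (simp only: NC.lincomb_list_as_mat_mult)
    moreover have "mat_of_cols n (cols V) = V" using V mat_of_cols_cols[of V] by simp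
    moreover have "vec (length (cols V)) c \<in> carrier_vec (dim_col V)" by simp
    ultimately show ?thesis by metis
  qed
qed

lemma mult_mat_zero_vec:
  fixes M :: "real mat"
  assumes "M \<in> carrier_mat r c" shows "M *\<^sub>v 0\<^sub>v c = 0\<^sub>v r"
  using assms by (intro eq_vecI) auto

lemma zero_mat_mult_vec: "v \<in> carrier_vec c \<Longrightarrow> 0\<^sub>m r c *\<^sub>v v = (0\<^sub>v r :: real vec)"
  by (intro eq_vecI) auto

lemma uminus_mult_mat_vec:
  fixes M :: "real mat"
  assumes "dim_vec v = dim_col M" shows "(- M) *\<^sub>v v = - (M *\<^sub>v v)"
  using assms by (intro eq_vecI) (auto simp: scalar_prod_def sum_negf)

lemma append_vec_empty:
  fixes v :: "real vec"
  assumes "dim_vec w = 0" shows "v @\<^sub>v w = v"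
  using assms by (intro eq_vecI) auto

lemma vec_diff_zero_iff:
  fixes a c :: "real vec"
  assumes "a \<in> carrier_vec n" "c \<in> carrier_vec n"
  shows "a - c = 0\<^sub>v n \<longleftrightarrow> a = c"
proof
  assume z: "a - c = 0\<^sub>v n"
  show "a = c"
  proof (rule eq_vecI)
    fix i assume i: "i < dim_vec c"
    then have "(a - c) $ i = 0" using z assms by simp
    then show "a $ i = c $ i" using i assms by simp
  qed (use assms in auto)
qed (use assms in auto)

lemma append_vecE:
  assumes "v \<in> carrier_vec (n + m)"
  obtains a b where "a \<in> carrier_vec n" "b \<in> carrier_vec m" "v = a @\<^sub>v b"
  using vec_first_last_append[OF assms] by (metis vec_first_carrier vec_last_carrier)

lemma append_vec_eq_zero_iff:
  fixes a b :: "real vec"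
  assumes "a \<in> carrier_vec n" "b \<in> carrier_vec m"
  shows "a @\<^sub>v b = 0\<^sub>v (n + m) \<longleftrightarrow> a = 0\<^sub>v n \<and> b = 0\<^sub>v m"
proof -
  have "0\<^sub>v n @\<^sub>v 0\<^sub>v m = (0\<^sub>v (n + m) :: real vec)" by (intro eq_vecI) auto
  then show ?thesis using append_vec_eq[OF assms(1) zero_carrier_vec, of b "0\<^sub>v m"] by simp
qed

lemma append_vec_diff:
  assumes "a \<in> carrier_vec n" "a' \<in> carrier_vec n" "b \<in> carrier_vec m" "b' \<in> carrier_vec m"
  shows "(a @\<^sub>v b) - (a' @\<^sub>v b') = (a - a') @\<^sub>v (b - b')"
  using assms by (intro eq_vecI) auto

lemma append_zero_nonzero:
  "v \<in> carrier_vec n \<Longrightarrow> v \<noteq> 0\<^sub>v n \<Longrightarrow> v @\<^sub>v 0\<^sub>v m \<noteq> (0\<^sub>v (n + m) :: real vec)"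
  by (simp add: append_vec_eq_zero_iff[of v n "0\<^sub>v m" m])

lemma upper_left_block_carrier: "upper_left_block n M \<in> carrier_mat n n"
  by (simp add: upper_left_block_def)

lemma bform_upper_left_block:
  assumes M: "M \<in> carrier_mat (n + m) (n + m)" and "v \<in> carrier_vec n" "w \<in> carrier_vec n"
  shows "bform (upper_left_block n M) v w = bform M (v @\<^sub>v 0\<^sub>v m) (w @\<^sub>v 0\<^sub>v m)"
proof -
  have "bform M (v @\<^sub>v 0\<^sub>v m) (w @\<^sub>v 0\<^sub>v m) =
      (\<Sum>i<n + m. \<Sum>j<n + m. (v @\<^sub>v 0\<^sub>v m) $ i * M $$ (i, j) * (w @\<^sub>v 0\<^sub>v m) $ j)"
    using assms by (subst bform_sum) auto
  also have "\<dots> = (\<Sum>i<n. \<Sum>j<n + m. (v @\<^sub>v 0\<^sub>v m) $ i * M $$ (i, j) * (w @\<^sub>v 0\<^sub>v m) $ j)"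
    using assms by (intro sum.mono_neutral_right) auto
  also have "\<dots> = (\<Sum>i<n. \<Sum>j<n. (v @\<^sub>v 0\<^sub>v m) $ i * M $$ (i, j) * (w @\<^sub>v 0\<^sub>v m) $ j)"
    using assms by (intro sum.cong refl sum.mono_neutral_right) auto
  also have "\<dots> = bform (upper_left_block n M) v w"
    using assms by (subst bform_sum) (auto simp: upper_left_block_def)
  finally show ?thesis ..
qed

lemma upper_left_block_symmetric:
  "M \<in> carrier_mat k k \<Longrightarrow> n \<le> k \<Longrightarrow> transpose_mat M = M \<Longrightarrow>
    transpose_mat (upper_left_block n M) = upper_left_block n M"
  unfolding upper_left_block_def
  by (intro eq_matI) (auto, metis carrier_matD index_transpose_mat(1) less_le_trans)

lemma upper_left_block_pos_def:
  assumes "M \<in> carrier_mat (n + m) (n + m)" "pos_def M"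
  shows "pos_def (upper_left_block n M)"
proof (rule pos_defI[OF upper_left_block_carrier])
  show "transpose_mat (upper_left_block n M) = upper_left_block n M"
    by (rule upper_left_block_symmetric[OF assms(1)]) (use assms(2) pos_def_symmetric in auto)
  fix v :: "real vec" assume v: "v \<in> carrier_vec n" "v \<noteq> 0\<^sub>v n"
  then have "v @\<^sub>v 0\<^sub>v m \<noteq> 0\<^sub>v (n + m)" by (simp add: append_vec_eq_zero_iff[of v n "0\<^sub>v m" m])
  then show "bform (upper_left_block n M) v v > 0"
    using pos_def_bform[OF assms(2,1), of "v @\<^sub>v 0\<^sub>v m"] v bform_upper_left_block[OF assms(1) v(1) v(1)]
    by simp
qed

definition proj_first :: "nat \<Rightarrow> nat \<Rightarrow> real mat" where
  "proj_first n m = mat n (n + m) (\<lambda>(i, j). if j = i then 1 else 0)"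

definition proj_last :: "nat \<Rightarrow> nat \<Rightarrow> real mat" where
  "proj_last n m = mat m (n + m) (\<lambda>(i, j). if j = n + i then 1 else 0)"

lemma proj_carrier [simp]:
  "proj_first n m \<in> carrier_mat n (n + m)" "proj_last n m \<in> carrier_mat m (n + m)"
  by (simp_all add: proj_first_def proj_last_def)

lemma proj_dim [simp]:
  "dim_row (proj_first n m) = n" "dim_col (proj_first n m) = n + m"
  "dim_row (proj_last n m) = m" "dim_col (proj_last n m) = n + m"
  by (simp_all add: proj_first_def proj_last_def)

lemma proj_append:
  assumes "a \<in> carrier_vec n" "b \<in> carrier_vec m"
  shows "proj_first n m *\<^sub>v (a @\<^sub>v b) = a" "proj_last n m *\<^sub>v (a @\<^sub>v b) = b"
proof -
  show "proj_first n m *\<^sub>v (a @\<^sub>v b) = a"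
    using assms
    by (intro eq_vecI) (auto simp: proj_first_def scalar_prod_def if_distrib[of "\<lambda>z. z * _"] cong: if_cong)
  show "proj_last n m *\<^sub>v (a @\<^sub>v b) = b"
    using assms
    by (intro eq_vecI) (auto simp: proj_last_def scalar_prod_def if_distrib[of "\<lambda>z. z * _"] cong: if_cong)
qed

lemma proj_first_transpose:
  assumes "a \<in> carrier_vec n"
  shows "transpose_mat (proj_first n m) *\<^sub>v a = a @\<^sub>v 0\<^sub>v m"
  using assms
  by (intro eq_vecI) (auto simp: proj_first_def scalar_prod_def if_distrib[of "\<lambda>z. z * _"] cong: if_cong)

text \<open>The block is a compression by \<open>proj_first n m\<close> and its transpose. Applied
  to \<open>Y 0\<close>, this shows that the reset state of the controller has the estimated
  \<open>x\<close> as its first component.\<close>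

lemma upper_left_block_eq_proj:
  assumes "M \<in> carrier_mat (n + m) (n + m)" "v \<in> carrier_vec n"
  shows "upper_left_block n M *\<^sub>v v = proj_first n m *\<^sub>v (M *\<^sub>v (v @\<^sub>v 0\<^sub>v m))"
proof -
  have "upper_left_block n M = proj_first n m * (M * transpose_mat (proj_first n m))"
  proof (rule mat_eqI_bform[OF upper_left_block_carrier])
    fix u w :: "real vec" assume uw: "u \<in> carrier_vec n" "w \<in> carrier_vec n"
    have "bform (proj_first n m * (M * transpose_mat (proj_first n m))) u w =
        bform M (u @\<^sub>v 0\<^sub>v m) (w @\<^sub>v 0\<^sub>v m)"
      using uw assms(1) bform_mult_left[of "transpose_mat (proj_first n m)" "M * transpose_mat (proj_first n m)" u w]
      by (simp add: proj_first_transpose bform_mult_right)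
    then show "bform (upper_left_block n M) u w = bform (proj_first n m * (M * transpose_mat (proj_first n m))) u w"
      using bform_upper_left_block[OF assms(1) uw] by simp
  qed (use assms(1) in \<open>auto intro!: carrier_matI\<close>)
  then show ?thesis
    using assms
    by (simp add: proj_first_transpose
        assoc_mult_mat_vec[of "proj_first n m" n "n + m" "M * transpose_mat (proj_first n m)" n]
        assoc_mult_mat_vec[of M "n + m" "n + m" "transpose_mat (proj_first n m)" n])
qed

subsection \<open>The matrix expressions of the inequalities as quadratic forms\<close>

lemma bform_congruence:
  assumes "M \<in> carrier_mat k k" "P \<in> carrier_mat k n" "v \<in> carrier_vec n" "w \<in> carrier_vec n"
  shows "bform (transpose_mat P * M * P) v w = bform M (P *\<^sub>v v) (P *\<^sub>v w)"
proof -
  have "bform (transpose_mat P * M * P) v w = bform (transpose_mat P * M) v (P *\<^sub>v w)"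
    using assms by (intro bform_mult_right) auto
  also have "\<dots> = bform M (P *\<^sub>v v) (P *\<^sub>v w)"
    using assms by (intro bform_mult_left) auto
  finally show ?thesis .
qed

lemma congruence_symmetric:
  fixes M P :: "real mat"
  assumes "M \<in> carrier_mat k k" "transpose_mat M = M" "P \<in> carrier_mat k n"
  shows "transpose_mat (transpose_mat P * M * P) = transpose_mat P * M * P"
proof (rule symmetric_bformI)
  show "transpose_mat P * M * P \<in> carrier_mat n n" using assms by (auto intro!: carrier_matI)
  fix v w :: "real vec" assume "v \<in> carrier_vec n" "w \<in> carrier_vec n"
  then show "bform (transpose_mat P * M * P) v w = bform (transpose_mat P * M * P) w v"
    using assms bform_commute[OF assms(2), of "P *\<^sub>v v" "P *\<^sub>v w"]
      bform_congruence[OF assms(1,3), of v w] bform_congruence[OF assms(1,3), of w v]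
    by (simp del: assoc_mult_mat)
qed

lemma congruence_carrier:
  "P \<in> carrier_mat k n \<Longrightarrow> transpose_mat P * M * P \<in> carrier_mat n n"
  by (auto intro!: carrier_matI)

lemma four_block_symmetric:
  assumes "A \<in> carrier_mat n n" "transpose_mat A = A" "D \<in> carrier_mat m m" "transpose_mat D = D"
    "B \<in> carrier_mat n m" "C = transpose_mat B"
  shows "transpose_mat (four_block_mat A B C D) = four_block_mat A B C D"
  using assms transpose_four_block_mat[of A n n B m C m D] by simp

context
  fixes A X X' :: "real mat" and N :: nat
  assumes A: "A \<in> carrier_mat N N" and X: "X \<in> carrier_mat N N" "transpose_mat X = X"
    and X': "X' \<in> carrier_mat N N" "transpose_mat X' = X'"
begin

text \<open>Multiplied out, the matrix is \<open>X' + X A + A^T X\<close>, the Lyapunov expression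
  of \<open>A\<close>.\<close>

lemma primal_flow_expression:
  defines "M \<equiv> transpose_mat (1\<^sub>m N @\<^sub>r A) * four_block_mat X' X X (0\<^sub>m N N) * (1\<^sub>m N @\<^sub>r A)"
  shows "M \<in> carrier_mat N N" "transpose_mat M = M"
    and "v \<in> carrier_vec N \<Longrightarrow> bform M v v = bform X' v v + 2 * bform X v (A *\<^sub>v v)"
proof -
  have P: "1\<^sub>m N @\<^sub>r A \<in> carrier_mat (N + N) N" using A by auto
  have B: "four_block_mat X' X X (0\<^sub>m N N) \<in> carrier_mat (N + N) (N + N)"
    using X' by auto
  show "M \<in> carrier_mat N N" unfolding M_def by (rule congruence_carrier[OF P])
  show "transpose_mat M = M"
    unfolding M_def by (rule congruence_symmetric[OF B _ P], rule four_block_symmetric) (use X X' in auto)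
  assume v: "v \<in> carrier_vec N"
  have "bform M v v = bform (four_block_mat X' X X (0\<^sub>m N N)) (v @\<^sub>v (A *\<^sub>v v)) (v @\<^sub>v (A *\<^sub>v v))"
    using mat_mult_append[of "1\<^sub>m N" N N A N v] v A
    unfolding M_def by (simp add: bform_congruence[OF B P])
  also have "\<dots> = bform X' v v + bform X v (A *\<^sub>v v) + bform X (A *\<^sub>v v) v"
    using v A X X' by (subst bform_four_block[of _ N N _ N _ N]) (auto simp: bform_zero_mat)
  also have "bform X (A *\<^sub>v v) v = bform X v (A *\<^sub>v v)"
    using X A v by (intro bform_commute) auto
  finally show "bform M v v = bform X' v v + 2 * bform X v (A *\<^sub>v v)" by simp
qed

text \<open>Multiplied out, the matrix is \<open>X' - A X - X A^T\<close>, the Lyapunov expression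
  of \<open>- transpose_mat A\<close>.\<close>

lemma dual_flow_expression:
  defines "M \<equiv> transpose_mat (- transpose_mat A @\<^sub>r 1\<^sub>m N) * four_block_mat (0\<^sub>m N N) X X X' * (- transpose_mat A @\<^sub>r 1\<^sub>m N)"
  shows "M \<in> carrier_mat N N" "transpose_mat M = M"
    and "v \<in> carrier_vec N \<Longrightarrow> bform M v v = bform X' v v - 2 * bform X v (transpose_mat A *\<^sub>v v)"
proof -
  have P: "- transpose_mat A @\<^sub>r 1\<^sub>m N \<in> carrier_mat (N + N) N" using A by (auto intro!: carrier_append_rows)
  have B: "four_block_mat (0\<^sub>m N N) X X X' \<in> carrier_mat (N + N) (N + N)"
    using X' by auto
  show "M \<in> carrier_mat N N" unfolding M_def by (rule congruence_carrier[OF P])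
  show "transpose_mat M = M"
    unfolding M_def by (rule congruence_symmetric[OF B _ P], rule four_block_symmetric) (use X X' in auto)
  assume v: "v \<in> carrier_vec N"
  define w where "w = (- transpose_mat A) *\<^sub>v v"
  have w: "w \<in> carrier_vec N" using A by (auto simp: w_def intro!: carrier_vecI)
  have wm: "w = - (transpose_mat A *\<^sub>v v)" unfolding w_def using A v by (intro uminus_mult_mat_vec) auto
  have "bform M v v = bform (four_block_mat (0\<^sub>m N N) X X X') (w @\<^sub>v v) (w @\<^sub>v v)"
    using mat_mult_append[of "- transpose_mat A" N N "1\<^sub>m N" N v] v A
    unfolding M_def w_def by (simp add: bform_congruence[OF B P])
  also have "\<dots> = bform X w v + bform X v w + bform X' v v"
    using v w X X' by (subst bform_four_block[of _ N N _ N _ N]) (auto simp: bform_zero_mat)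
  also have "bform X w v = bform X v w"
    using X w v by (intro bform_commute) auto
  also have "bform X v w = - bform X v (transpose_mat A *\<^sub>v v)"
    unfolding wm using A v X by (intro bform_uminus_right) auto
  finally show "bform M v v = bform X' v v - 2 * bform X v (transpose_mat A *\<^sub>v v)" by simp
qed

lemma lyapunov_expression:
  defines "M \<equiv> X' + transpose_mat A * X + X * A"
  shows "M \<in> carrier_mat N N" "transpose_mat M = M"
    and "v \<in> carrier_vec N \<Longrightarrow> bform M v v = bform X' v v + 2 * bform X v (A *\<^sub>v v)"
proof -
  show M: "M \<in> carrier_mat N N" unfolding M_def using A X X' by (auto intro!: carrier_matI)
  have b: "bform M v w = bform X' v w + bform X (A *\<^sub>v v) w + bform X v (A *\<^sub>v w)"
    if "v \<in> carrier_vec N" "w \<in> carrier_vec N" for v w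
    using that A X X' bform_mult_left[of A X v w] bform_mult_right[of A X w v]
    by (simp add: M_def bform_add_mat)
  show "transpose_mat M = M"
  proof (rule symmetric_bformI[OF M])
    fix v w :: "real vec" assume vw: "v \<in> carrier_vec N" "w \<in> carrier_vec N"
    have "bform X' v w = bform X' w v" using vw X' by (intro bform_commute) auto
    moreover have "bform X (A *\<^sub>v v) w = bform X w (A *\<^sub>v v)"
      using vw A X by (intro bform_commute) auto
    moreover have "bform X v (A *\<^sub>v w) = bform X (A *\<^sub>v w) v"
      using vw A X by (intro bform_commute) auto
    ultimately show "bform M v w = bform M w v" unfolding b[OF vw] b[OF vw(2,1)] by linarith
  qed
  assume v: "v \<in> carrier_vec N"
  have "bform X (A *\<^sub>v v) v = bform X v (A *\<^sub>v v)" using v A X by (intro bform_commute) auto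
  then show "bform M v v = bform X' v v + 2 * bform X v (A *\<^sub>v v)" using b[OF v v] by linarith
qed

end

text \<open>With \<open>z = X\<^sup>-\<^sup>1 w\<close>, the dual inequality for \<open>X\<^sup>-\<^sup>1\<close> at \<open>w\<close> is minus the primal one for \<open>X\<close> at \<open>z\<close>.\<close>

lemma dual_flow_form_inv_mat:
  assumes A: "A \<in> carrier_mat N N" and X: "X \<in> carrier_mat N N" "pos_def X"
    and X': "X' \<in> carrier_mat N N" and w: "w \<in> carrier_vec N"
  defines "Z \<equiv> inv_mat X"
  shows "bform (- (Z * X' * Z)) w w - 2 * bform Z w (transpose_mat A *\<^sub>v w) =
    - (bform X' (Z *\<^sub>v w) (Z *\<^sub>v w) + 2 * bform X (Z *\<^sub>v w) (A *\<^sub>v (Z *\<^sub>v w)))"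
proof -
  note Zc = inv_mat_carrier[OF X(2,1), folded Z_def]
  note Zs = inv_mat_symmetric[OF X(2,1), folded Z_def]
  note canc = inv_mat_cancel[OF X(2,1), folded Z_def]
  have "bform (- (Z * X' * Z)) w w = - bform (transpose_mat Z * X' * Z) w w"
    using Zc X' w by (subst bform_uminus_mat) (auto simp: Zs)
  also have "bform (transpose_mat Z * X' * Z) w w = bform X' (Z *\<^sub>v w) (Z *\<^sub>v w)"
    by (rule bform_congruence[OF X' Zc w w])
  finally have 1: "bform (- (Z * X' * Z)) w w = - bform X' (Z *\<^sub>v w) (Z *\<^sub>v w)" .
  have "bform Z w (transpose_mat A *\<^sub>v w) = bform Z (transpose_mat A *\<^sub>v w) w"
    using Zc Zs A w by (intro bform_commute) auto
  also have "\<dots> = w \<bullet> (A *\<^sub>v (Z *\<^sub>v w))"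
    using A Zc w by (simp add: bform_def scalar_prod_mult_mat_vec[of w A])
  also have "\<dots> = bform X (A *\<^sub>v (Z *\<^sub>v w)) (Z *\<^sub>v w)"
    using canc(1)[OF w] w A Zc by (simp add: bform_def scalar_prod_commute[of w])
  also have "\<dots> = bform X (Z *\<^sub>v w) (A *\<^sub>v (Z *\<^sub>v w))"
    using X A Zc w by (intro bform_commute) (auto simp: pos_def_symmetric)
  finally show ?thesis using 1 by simp
qed

text \<open>The form of \<open>inv_mat P\<close> at \<open>h\<close> is the maximum over
  \<open>s\<close> of \<open>2 * (s \<bullet> h) - bform P s s\<close>. Inserting the given
  \<open>s\<close> yields more than twice the form of \<open>inv_mat Q\<close> at \<open>h\<close>
  minus that form once. In the application \<open>s\<close> is the image under a jump of
  \<open>inv_mat Q *\<^sub>v h\<close>, with \<open>h\<close> fixed by the transposed jump.\<close>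

lemma dual_jump_inequality:
  assumes P: "P \<in> carrier_mat N N" "pos_def P" and Q: "Q \<in> carrier_mat N N" "pos_def Q"
    and h: "h \<in> carrier_vec N" and s: "s \<in> carrier_vec N" "s \<bullet> h = (inv_mat Q *\<^sub>v h) \<bullet> h"
    and less: "bform P s s < bform Q (inv_mat Q *\<^sub>v h) (inv_mat Q *\<^sub>v h)"
  shows "bform (inv_mat Q) h h < bform (inv_mat P) h h"
proof -
  define m where "m = inv_mat P *\<^sub>v h"
  have m: "m \<in> carrier_vec N" using inv_mat_carrier[OF P(2,1)] h by (auto simp: m_def)
  have Pm: "P *\<^sub>v m = h" unfolding m_def by (rule inv_mat_cancel(1)[OF P(2,1) h])
  have qh: "(inv_mat Q *\<^sub>v h) \<bullet> h = bform (inv_mat Q) h h"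
    using inv_mat_carrier[OF Q(2,1)] h by (simp add: bform_def scalar_prod_commute[of h])
  \<comment> \<open>The maximum is attained at \<open>m\<close>; expanding this square is the
    comparison of \<open>s\<close> with \<open>m\<close>.\<close>
  have "0 \<le> bform P (s - m) (s - m)"
    using s m by (intro pos_def_bform_nonneg[OF P(2,1)]) auto
  also have "\<dots> = bform P s s - bform P s m - (bform P m s - bform P m m)"
    using s m P by (simp add: bform_diff_left bform_diff_right)
  also have "bform P m s = bform P s m"
    using P s m by (intro bform_commute) (auto simp: pos_def_symmetric)
  also have "bform P s m = bform (inv_mat Q) h h" using s(2) qh Pm by (simp add: bform_def)
  also have "bform P m m = bform (inv_mat P) h h"
    using bform_inv_mat[OF P(2,1) h h] by (simp add: m_def)
  finally show ?thesis
    using less bform_inv_mat[OF Q(2,1) h h] by simp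
qed

subsection \<open>The inequalities in terms of quadratic forms\<close>

lemma coupling_iff:
  assumes "Y \<in> carrier_mat N N" "transpose_mat Y = Y" "X \<in> carrier_mat N N" "transpose_mat X = X"
  shows "pos_def (four_block_mat Y (1\<^sub>m N) (1\<^sub>m N) X) \<longleftrightarrow>
    (\<forall>a\<in>carrier_vec N. \<forall>b\<in>carrier_vec N. a \<noteq> 0\<^sub>v N \<or> b \<noteq> 0\<^sub>v N \<longrightarrow>
      bform Y a a + 2 * (a \<bullet> b) + bform X b b > 0)"
proof -
  have f: "bform (four_block_mat Y (1\<^sub>m N) (1\<^sub>m N) X) (a @\<^sub>v b) (a @\<^sub>v b) =
      bform Y a a + 2 * (a \<bullet> b) + bform X b b" if "a \<in> carrier_vec N" "b \<in> carrier_vec N" for a b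
    using that assms scalar_prod_commute[of b a]
    by (subst bform_four_block[of _ N N _ N _ N]) (auto simp: bform_one_mat)
  have "four_block_mat Y (1\<^sub>m N) (1\<^sub>m N) X \<in> carrier_mat (N + N) (N + N)"
    using assms by auto
  moreover have "transpose_mat (four_block_mat Y (1\<^sub>m N) (1\<^sub>m N) X) = four_block_mat Y (1\<^sub>m N) (1\<^sub>m N) X"
    by (rule four_block_symmetric) (use assms in auto)
  ultimately have "pos_def (four_block_mat Y (1\<^sub>m N) (1\<^sub>m N) X) \<longleftrightarrow>
      (\<forall>a\<in>carrier_vec N. \<forall>b\<in>carrier_vec N. a @\<^sub>v b \<noteq> 0\<^sub>v (N + N) \<longrightarrow>
        bform (four_block_mat Y (1\<^sub>m N) (1\<^sub>m N) X) (a @\<^sub>v b) (a @\<^sub>v b) > 0)"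
    by (simp only: pos_def_iff all_vec_append)
  also have "\<dots> \<longleftrightarrow> (\<forall>a\<in>carrier_vec N. \<forall>b\<in>carrier_vec N. a \<noteq> 0\<^sub>v N \<or> b \<noteq> 0\<^sub>v N \<longrightarrow>
      bform Y a a + 2 * (a \<bullet> b) + bform X b b > 0)"
    by (simp add: f append_vec_eq_zero_iff)
  finally show ?thesis .
qed

text \<open>As \<open>z\<close> ranges over all coordinate vectors, \<open>V *\<^sub>v z\<close>
  ranges over the kernel, bijectively, so that nonzero vectors correspond as well. From here on no
  basis matrix occurs.\<close>

lemma primal_jump_iff:
  assumes C: "C \<in> carrier_mat q n" "kernel_basis_matrix C V"
    and X: "X \<in> carrier_mat (n + p) (n + p)" "transpose_mat X = X"
    and X0: "X0 \<in> carrier_mat n n" "transpose_mat X0 = X0"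
  defines "P \<equiv> four_block_mat V (0\<^sub>m n p) (0\<^sub>m p (dim_col V)) (1\<^sub>m p)"
  shows "neg_def (transpose_mat P * (four_block_mat X0 (0\<^sub>m n p) (0\<^sub>m p n) (0\<^sub>m p p) - X) * P) \<longleftrightarrow>
    (\<forall>x\<in>carrier_vec n. \<forall>u\<in>carrier_vec p. C *\<^sub>v x = 0\<^sub>v q \<longrightarrow> x \<noteq> 0\<^sub>v n \<or> u \<noteq> 0\<^sub>v p \<longrightarrow>
      bform X0 x x < bform X (x @\<^sub>v u) (x @\<^sub>v u))"
proof -
  define k where "k = dim_col V"
  note V = kernel_basis_matrixD[OF C, folded k_def]
  define M where "M = four_block_mat X0 (0\<^sub>m n p) (0\<^sub>m p n) (0\<^sub>m p p) - X"
  have M: "M \<in> carrier_mat (n + p) (n + p)" using X X0 by (auto simp: M_def intro!: carrier_matI)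
  have F: "four_block_mat X0 (0\<^sub>m n p) (0\<^sub>m p n) (0\<^sub>m p p) \<in> carrier_mat (n + p) (n + p)"
    using X0 by auto
  have Mf: "bform M (x @\<^sub>v u) (x @\<^sub>v u) = bform X0 x x - bform X (x @\<^sub>v u) (x @\<^sub>v u)"
    if "x \<in> carrier_vec n" "u \<in> carrier_vec p" for x u
  proof -
    have "bform M (x @\<^sub>v u) (x @\<^sub>v u) =
        bform (four_block_mat X0 (0\<^sub>m n p) (0\<^sub>m p n) (0\<^sub>m p p)) (x @\<^sub>v u) (x @\<^sub>v u) - bform X (x @\<^sub>v u) (x @\<^sub>v u)"
      unfolding M_def using X F that by (intro bform_minus_mat) auto
    also have "bform (four_block_mat X0 (0\<^sub>m n p) (0\<^sub>m p n) (0\<^sub>m p p)) (x @\<^sub>v u) (x @\<^sub>v u) = bform X0 x x"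
      using X0 that by (subst bform_four_block[of _ n n _ p _ p]) (auto simp: bform_zero_mat)
    finally show ?thesis .
  qed
  have Msym: "transpose_mat M = M"
  proof -
    have "transpose_mat (four_block_mat X0 (0\<^sub>m n p) (0\<^sub>m p n) (0\<^sub>m p p)) = four_block_mat X0 (0\<^sub>m n p) (0\<^sub>m p n) (0\<^sub>m p p)"
      by (rule four_block_symmetric) (use X0 in auto)
    then show ?thesis using X F unfolding M_def by (simp add: transpose_minus[OF F])
  qed
  have P: "P \<in> carrier_mat (n + p) (k + p)" using V(1) by (auto simp: P_def)
  have Pv: "P *\<^sub>v (z @\<^sub>v u) = (V *\<^sub>v z) @\<^sub>v u" if "z \<in> carrier_vec k" "u \<in> carrier_vec p" for z u
  proof -
    have "P *\<^sub>v (z @\<^sub>v u) = (V *\<^sub>v z + 0\<^sub>m n p *\<^sub>v u) @\<^sub>v (0\<^sub>m p k *\<^sub>v z + 1\<^sub>m p *\<^sub>v u)"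
      unfolding P_def k_def[symmetric] by (rule four_block_mat_mult_vec) (use V(1) that in auto)
    then show ?thesis using that V(1) by (simp add: zero_mat_mult_vec)
  qed
  have "neg_def (transpose_mat P * M * P) \<longleftrightarrow> (\<forall>v\<in>carrier_vec (k + p). v \<noteq> 0\<^sub>v (k + p) \<longrightarrow>
      bform (transpose_mat P * M * P) v v < 0)"
    by (rule neg_def_iff[OF congruence_carrier[OF P] congruence_symmetric[OF M Msym P]])
  also have "\<dots> \<longleftrightarrow> (\<forall>v\<in>carrier_vec (k + p). v \<noteq> 0\<^sub>v (k + p) \<longrightarrow> bform M (P *\<^sub>v v) (P *\<^sub>v v) < 0)"
    by (simp only: bform_congruence[OF M P] cong: ball_cong)
  also have "\<dots> \<longleftrightarrow> (\<forall>z\<in>carrier_vec k. \<forall>u\<in>carrier_vec p. z @\<^sub>v u \<noteq> 0\<^sub>v (k + p) \<longrightarrow>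
      bform M (P *\<^sub>v (z @\<^sub>v u)) (P *\<^sub>v (z @\<^sub>v u)) < 0)"
    by (rule all_vec_append)
  also have "\<dots> \<longleftrightarrow> (\<forall>z\<in>carrier_vec k. \<forall>u\<in>carrier_vec p. z \<noteq> 0\<^sub>v k \<or> u \<noteq> 0\<^sub>v p \<longrightarrow>
      bform X0 (V *\<^sub>v z) (V *\<^sub>v z) < bform X ((V *\<^sub>v z) @\<^sub>v u) ((V *\<^sub>v z) @\<^sub>v u))"
    using V(1) by (simp add: append_vec_eq_zero_iff Pv Mf)
  also have "\<dots> \<longleftrightarrow> (\<forall>x\<in>carrier_vec n. \<forall>u\<in>carrier_vec p. C *\<^sub>v x = 0\<^sub>v q \<longrightarrow> x \<noteq> 0\<^sub>v n \<or> u \<noteq> 0\<^sub>v p \<longrightarrow>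
      bform X0 x x < bform X (x @\<^sub>v u) (x @\<^sub>v u))" (is "?l \<longleftrightarrow> ?r")
  proof
    assume l: ?l
    show ?r
    proof (intro ballI impI)
      fix x u :: "real vec" assume x: "x \<in> carrier_vec n" "C *\<^sub>v x = 0\<^sub>v q" and u: "u \<in> carrier_vec p"
        and nz: "x \<noteq> 0\<^sub>v n \<or> u \<noteq> 0\<^sub>v p"
      obtain z where z: "z \<in> carrier_vec k" "x = V *\<^sub>v z" using V(4)[OF x] by blast
      have "z \<noteq> 0\<^sub>v k \<or> u \<noteq> 0\<^sub>v p" using nz z mult_mat_zero_vec[OF V(1)] by auto
      then show "bform X0 x x < bform X (x @\<^sub>v u) (x @\<^sub>v u)" using l z u by auto
    qed
  next
    assume r: ?r
    show ?l
    proof (intro ballI impI)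
      fix z u :: "real vec" assume z: "z \<in> carrier_vec k" and u: "u \<in> carrier_vec p" and nz: "z \<noteq> 0\<^sub>v k \<or> u \<noteq> 0\<^sub>v p"
      have "V *\<^sub>v z \<noteq> 0\<^sub>v n \<or> u \<noteq> 0\<^sub>v p" using nz V(3)[OF z] by auto
      moreover have "V *\<^sub>v z \<in> carrier_vec n" using V(1) z by auto
      ultimately show "bform X0 (V *\<^sub>v z) (V *\<^sub>v z) < bform X ((V *\<^sub>v z) @\<^sub>v u) ((V *\<^sub>v z) @\<^sub>v u)"
        using r V(2)[OF z] u by blast
    qed
  qed
  finally show ?thesis by (simp add: M_def)
qed

text \<open>The matrix inequalities of the theorem written as quadratic forms, with the basis matrix
  replaced by quantification over the kernel of \<open>C\<close>. Necessity and sufficiency are both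
  proved for this version.\<close>

definition reduced_forms ::
  "real \<Rightarrow> real \<Rightarrow> nat \<Rightarrow> nat \<Rightarrow> real mat \<Rightarrow> real mat \<Rightarrow> (real \<Rightarrow> real mat) \<Rightarrow> (real \<Rightarrow> real mat) \<Rightarrow> bool" where
  "reduced_forms Tmin Tmax n p A C X Y \<longleftrightarrow>
     (\<forall>\<tau>\<in>{0..Tmax}.
        (\<forall>a\<in>carrier_vec (n + p). \<forall>b\<in>carrier_vec (n + p). a \<noteq> 0\<^sub>v (n + p) \<or> b \<noteq> 0\<^sub>v (n + p) \<longrightarrow>
           bform (Y \<tau>) a a + 2 * (a \<bullet> b) + bform (X \<tau>) b b > 0) \<and>
        (\<forall>v\<in>carrier_vec (n + p). v \<noteq> 0\<^sub>v (n + p) \<longrightarrow>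
           bform (mat_deriv {0..Tmax} X \<tau>) v v + 2 * bform (X \<tau>) v (A *\<^sub>v v) < 0) \<and>
        (\<forall>v\<in>carrier_vec (n + p). v \<noteq> 0\<^sub>v (n + p) \<longrightarrow>
           bform (mat_deriv {0..Tmax} Y \<tau>) v v - 2 * bform (Y \<tau>) v (transpose_mat A *\<^sub>v v) > 0)) \<and>
     (\<forall>\<tau>\<in>{Tmin..Tmax}.
        (\<forall>x\<in>carrier_vec n. \<forall>u\<in>carrier_vec p. C *\<^sub>v x = 0\<^sub>v (dim_row C) \<longrightarrow> x \<noteq> 0\<^sub>v n \<or> u \<noteq> 0\<^sub>v p \<longrightarrow>
           bform (upper_left_block n (X 0)) x x < bform (X \<tau>) (x @\<^sub>v u) (x @\<^sub>v u)) \<and>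
        (\<forall>x\<in>carrier_vec n. x \<noteq> 0\<^sub>v n \<longrightarrow>
           bform (upper_left_block n (Y \<tau>)) x x < bform (upper_left_block n (Y 0)) x x))"

lemma reduced_forms_iff:
  fixes n p :: nat and A C V :: "real mat"
  defines "N \<equiv> n + p"
  assumes T: "0 < Tmin" "Tmin < Tmax" and A: "A \<in> carrier_mat N N"
    and C: "C \<in> carrier_mat q n" "kernel_basis_matrix C V"
    and X: "C1_symmetric_on {0..Tmax} N X" and Y: "C1_symmetric_on {0..Tmax} N Y"
  shows "reduced_forms Tmin Tmax n p A C X Y \<longleftrightarrow>
     (\<forall>\<tau> \<in> {0..Tmax}.
           pos_def (four_block_mat (Y \<tau>) (1\<^sub>m N) (1\<^sub>m N) (X \<tau>)) \<and>
           neg_def (transpose_mat (1\<^sub>m N @\<^sub>r A)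
             * four_block_mat (mat_deriv {0..Tmax} X \<tau>) (X \<tau>) (X \<tau>) (0\<^sub>m N N)
             * (1\<^sub>m N @\<^sub>r A)) \<and>
           pos_def (transpose_mat (- transpose_mat A @\<^sub>r 1\<^sub>m N)
             * four_block_mat (0\<^sub>m N N) (Y \<tau>) (Y \<tau>) (mat_deriv {0..Tmax} Y \<tau>)
             * (- transpose_mat A @\<^sub>r 1\<^sub>m N))) \<and>
        (\<forall>\<tau> \<in> {Tmin..Tmax}.
           neg_def (transpose_mat (four_block_mat V (0\<^sub>m n p) (0\<^sub>m p (dim_col V)) (1\<^sub>m p))
             * (four_block_mat (upper_left_block n (X 0)) (0\<^sub>m n p) (0\<^sub>m p n) (0\<^sub>m p p) - X \<tau>)
             * four_block_mat V (0\<^sub>m n p) (0\<^sub>m p (dim_col V)) (1\<^sub>m p)) \<and>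
           pos_def (upper_left_block n (Y 0) - upper_left_block n (Y \<tau>)))"
proof -
  note Xc = C1_symmetric_onD(1,2)[OF X] and Yc = C1_symmetric_onD(1,2)[OF Y]
  note X'c = has_mat_derivative_onD(2)[OF C1_symmetric_onD(3)[OF X]]
  note Y'c = has_mat_derivative_onD(2)[OF C1_symmetric_onD(3)[OF Y]]
  have f1: "pos_def (four_block_mat (Y \<tau>) (1\<^sub>m N) (1\<^sub>m N) (X \<tau>)) \<longleftrightarrow>
      (\<forall>a\<in>carrier_vec N. \<forall>b\<in>carrier_vec N. a \<noteq> 0\<^sub>v N \<or> b \<noteq> 0\<^sub>v N \<longrightarrow>
        bform (Y \<tau>) a a + 2 * (a \<bullet> b) + bform (X \<tau>) b b > 0)" if "\<tau> \<in> {0..Tmax}" for \<tau>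
    by (rule coupling_iff[OF Yc[OF that] Xc[OF that]])
  have f2: "neg_def (transpose_mat (1\<^sub>m N @\<^sub>r A)
        * four_block_mat (mat_deriv {0..Tmax} X \<tau>) (X \<tau>) (X \<tau>) (0\<^sub>m N N) * (1\<^sub>m N @\<^sub>r A)) \<longleftrightarrow>
      (\<forall>v\<in>carrier_vec N. v \<noteq> 0\<^sub>v N \<longrightarrow>
        bform (mat_deriv {0..Tmax} X \<tau>) v v + 2 * bform (X \<tau>) v (A *\<^sub>v v) < 0)" if "\<tau> \<in> {0..Tmax}" for \<tau>
  proof -
    note e = primal_flow_expression[OF A Xc[OF that] X'c[OF that] mat_deriv_symmetric[OF X that]]
    show ?thesis unfolding neg_def_iff[OF e(1,2)] using e(3) by simp
  qed
  have f3: "pos_def (transpose_mat (- transpose_mat A @\<^sub>r 1\<^sub>m N)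
        * four_block_mat (0\<^sub>m N N) (Y \<tau>) (Y \<tau>) (mat_deriv {0..Tmax} Y \<tau>) * (- transpose_mat A @\<^sub>r 1\<^sub>m N)) \<longleftrightarrow>
      (\<forall>v\<in>carrier_vec N. v \<noteq> 0\<^sub>v N \<longrightarrow>
        bform (mat_deriv {0..Tmax} Y \<tau>) v v - 2 * bform (Y \<tau>) v (transpose_mat A *\<^sub>v v) > 0)"
    if "\<tau> \<in> {0..Tmax}" for \<tau>
  proof -
    note e = dual_flow_expression[OF A Yc[OF that] Y'c[OF that] mat_deriv_symmetric[OF Y that]]
    show ?thesis unfolding pos_def_iff[OF e(1,2)] using e(3) by simp
  qed
  have f4: "neg_def (transpose_mat (four_block_mat V (0\<^sub>m n p) (0\<^sub>m p (dim_col V)) (1\<^sub>m p))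
        * (four_block_mat (upper_left_block n (X 0)) (0\<^sub>m n p) (0\<^sub>m p n) (0\<^sub>m p p) - X \<tau>)
        * four_block_mat V (0\<^sub>m n p) (0\<^sub>m p (dim_col V)) (1\<^sub>m p)) \<longleftrightarrow>
      (\<forall>x\<in>carrier_vec n. \<forall>u\<in>carrier_vec p. C *\<^sub>v x = 0\<^sub>v (dim_row C) \<longrightarrow> x \<noteq> 0\<^sub>v n \<or> u \<noteq> 0\<^sub>v p \<longrightarrow>
        bform (upper_left_block n (X 0)) x x < bform (X \<tau>) (x @\<^sub>v u) (x @\<^sub>v u))"
    if "\<tau> \<in> {Tmin..Tmax}" for \<tau>
  proof -
    have t: "\<tau> \<in> {0..Tmax}" "0 \<in> {0..Tmax}" using that T by auto
    have "dim_row C = q" using C by auto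
    moreover have "transpose_mat (upper_left_block n (X 0)) = upper_left_block n (X 0)"
      by (rule upper_left_block_symmetric[OF Xc(1)[OF t(2)] _ Xc(2)[OF t(2)]]) (simp add: N_def)
    ultimately show ?thesis
      using primal_jump_iff[OF C Xc[OF t(1), unfolded N_def] upper_left_block_carrier] by simp
  qed
  have f5: "pos_def (upper_left_block n (Y 0) - upper_left_block n (Y \<tau>)) \<longleftrightarrow>
      (\<forall>x\<in>carrier_vec n. x \<noteq> 0\<^sub>v n \<longrightarrow>
           bform (upper_left_block n (Y \<tau>)) x x < bform (upper_left_block n (Y 0)) x x)"
    if "\<tau> \<in> {Tmin..Tmax}" for \<tau>
  proof -
    have t: "\<tau> \<in> {0..Tmax}" "0 \<in> {0..Tmax}" using that T by auto
    note c = upper_left_block_carrier[of n]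
    have s: "transpose_mat (upper_left_block n (Y s)) = upper_left_block n (Y s)" if "s \<in> {0..Tmax}" for s
      by (rule upper_left_block_symmetric[OF Yc(1)[OF that] _ Yc(2)[OF that]]) (simp add: N_def)
    have "transpose_mat (upper_left_block n (Y 0) - upper_left_block n (Y \<tau>)) =
        upper_left_block n (Y 0) - upper_left_block n (Y \<tau>)"
      using s[OF t(1)] s[OF t(2)] by (simp add: transpose_minus[OF c c])
    moreover have "bform (upper_left_block n (Y 0) - upper_left_block n (Y \<tau>)) x x =
        bform (upper_left_block n (Y 0)) x x - bform (upper_left_block n (Y \<tau>)) x x"
      if "x \<in> carrier_vec n" for x
      using that carrier_matD[OF c] by (intro bform_minus_mat) auto
    ultimately show ?thesis using c by (subst pos_def_iff[of _ n]) (auto intro!: carrier_matI simp: carrier_matD[OF c])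
  qed
  show ?thesis
    unfolding reduced_forms_def N_def[symmetric]
    by (intro arg_cong2[where f = "(\<and>)"] ball_cong refl) (simp_all only: f1 f2 f3 f4 f5)
qed

subsection \<open>The closed loop of the sampled-data system\<close>

text \<open>The flow channels enter through zero matrices, so between impulses the controller merely
  runs alongside the plant. Its only freedom there is \<open>ctrl_A\<close>.\<close>

lemma closed_loop_flow_sampled_data:
  assumes "A \<in> carrier_mat n n" "B \<in> carrier_mat n p"
    and "is_clock_controller Tmin Tmax m q p qJ nc K" "\<tau> \<in> {0..Tmax}"
  shows "closed_loop_flow (sampled_data_system n p m q qJ A B CJ) K \<tau> =
    four_block_mat (four_block_mat A B (0\<^sub>m p n) (0\<^sub>m p p)) (0\<^sub>m (n + p) nc) (0\<^sub>m nc (n + p)) (ctrl_A K \<tau>)"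
proof -
  have K: "ctrl_B K \<tau> \<in> carrier_mat nc q" "ctrl_C K \<tau> \<in> carrier_mat m nc" "ctrl_D K \<tau> \<in> carrier_mat m q"
    using assms(3,4) by (auto simp: is_clock_controller_def continuous_mat_on_def)
  have "four_block_mat A B (0\<^sub>m p n) (0\<^sub>m p p) \<in> carrier_mat (n + p) (n + p)"
    using assms(1) by auto
  then show ?thesis
    using K by (simp add: closed_loop_flow_def sampled_data_system_def
        right_add_zero_mat[of _ "n + p" "n + p"])
qed

lemma closed_loop_jump_sampled_data_carrier:
  assumes "CJ \<in> carrier_mat qJ n"
    and "is_clock_controller Tmin Tmax m q p qJ nc K" "\<tau> \<in> {Tmin..Tmax}"
  shows "closed_loop_jump (sampled_data_system n p m q qJ A B CJ) K \<tau> \<in> carrier_mat (n + p + nc) (n + p + nc)"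
proof -
  have K: "ctrl_AJ K \<tau> \<in> carrier_mat nc nc" "ctrl_DJ K \<tau> \<in> carrier_mat p qJ"
    using assms(2,3) by (auto simp: is_clock_controller_def continuous_mat_on_def)
  have "(0\<^sub>m n p @\<^sub>r 1\<^sub>m p) \<in> carrier_mat (n + p) p"
    by (intro carrier_append_rows) auto
  moreover have "four_block_mat CJ (0\<^sub>m qJ p) (0\<^sub>m 0 n) (0\<^sub>m 0 p) \<in> carrier_mat (qJ + 0) (n + p)"
    using assms(1) by (intro four_block_carrier_mat) auto
  ultimately have "four_block_mat (1\<^sub>m n) (0\<^sub>m n p) (0\<^sub>m p n) (0\<^sub>m p p) +
      (0\<^sub>m n p @\<^sub>r 1\<^sub>m p) * ctrl_DJ K \<tau> * four_block_mat CJ (0\<^sub>m qJ p) (0\<^sub>m 0 n) (0\<^sub>m 0 p) \<in> carrier_mat (n + p) (n + p)"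
    using K by (intro add_carrier_mat mult_carrier_mat) auto
  then show ?thesis
    unfolding closed_loop_jump_def sampled_data_system_def
    using K by (simp add: four_block_carrier_mat)
qed

text \<open>The form in which both directions use the jump: \<open>x\<close> survives, the old
  \<open>u\<close> is forgotten, and the plant reaches the controller only through
  \<open>CJ *\<^sub>v x\<close>.\<close>

lemma closed_loop_jump_sampled_data:
  assumes C: "CJ \<in> carrier_mat qJ n"
    and ctrl: "is_clock_controller Tmin Tmax m q p qJ nc K" "\<tau> \<in> {Tmin..Tmax}"
    and x: "x \<in> carrier_vec n" and u: "u \<in> carrier_vec p" and c: "c \<in> carrier_vec nc"
  shows "closed_loop_jump (sampled_data_system n p m q qJ A B CJ) K \<tau> *\<^sub>v ((x @\<^sub>v u) @\<^sub>v c) =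
    (x @\<^sub>v (ctrl_DJ K \<tau> *\<^sub>v (CJ *\<^sub>v x) + ctrl_CJ K \<tau> *\<^sub>v c)) @\<^sub>v
    (ctrl_BJ K \<tau> *\<^sub>v (CJ *\<^sub>v x) + ctrl_AJ K \<tau> *\<^sub>v c)"
proof -
  define jA where "jA = four_block_mat (1\<^sub>m n) (0\<^sub>m n p) (0\<^sub>m p n) (0\<^sub>m p p :: real mat)"
  define jB where "jB = (0\<^sub>m n p @\<^sub>r 1\<^sub>m p :: real mat)"
  define jC where "jC = four_block_mat CJ (0\<^sub>m qJ p) (0\<^sub>m 0 n) (0\<^sub>m 0 p)"
  define KA KB KC KD where K_defs: "KA = ctrl_AJ K \<tau>" "KB = ctrl_BJ K \<tau>" "KC = ctrl_CJ K \<tau>" "KD = ctrl_DJ K \<tau>"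
  have K: "KA \<in> carrier_mat nc nc" "KB \<in> carrier_mat nc qJ" "KC \<in> carrier_mat p nc" "KD \<in> carrier_mat p qJ"
    using ctrl by (auto simp: K_defs is_clock_controller_def continuous_mat_on_def)
  have jA: "jA \<in> carrier_mat (n + p) (n + p)"
    unfolding jA_def by (intro four_block_carrier_mat) auto
  have jB: "jB \<in> carrier_mat (n + p) p"
    unfolding jB_def by (intro carrier_append_rows) auto
  have jC: "jC \<in> carrier_mat qJ (n + p)"
    unfolding jC_def using four_block_carrier_mat[OF C, of "0\<^sub>m 0 p" 0 p] by simp
  have jBv: "jB *\<^sub>v r = 0\<^sub>v n @\<^sub>v r" if "r \<in> carrier_vec p" for r
    unfolding jB_def using that by (subst mat_mult_append[of _ n p _ p]) (auto simp: zero_mat_mult_vec)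
  have jAv: "jA *\<^sub>v (x @\<^sub>v u) = x @\<^sub>v 0\<^sub>v p"
    unfolding jA_def using x u
    by (subst four_block_mat_mult_vec[of _ n n _ p _ p]) (auto simp: zero_mat_mult_vec)
  have Cx: "CJ *\<^sub>v x \<in> carrier_vec qJ" using C x by auto
  have jCv: "jC *\<^sub>v (x @\<^sub>v u) = CJ *\<^sub>v x"
  proof -
    have "jC *\<^sub>v (x @\<^sub>v u) = (CJ *\<^sub>v x + 0\<^sub>m qJ p *\<^sub>v u) @\<^sub>v (0\<^sub>m 0 n *\<^sub>v x + 0\<^sub>m 0 p *\<^sub>v u)"
      unfolding jC_def by (rule four_block_mat_mult_vec) (use C x u in auto)
    then show ?thesis using Cx u by (simp add: append_vec_empty zero_mat_mult_vec)
  qed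
  have a: "x @\<^sub>v u \<in> carrier_vec (n + p)" using x u by auto
  have "closed_loop_jump (sampled_data_system n p m q qJ A B CJ) K \<tau> =
      four_block_mat (jA + jB * KD * jC) (jB * KC) (KB * jC) KA"
    by (simp add: closed_loop_jump_def sampled_data_system_def jA_def jB_def jC_def K_defs)
  also have "\<dots> *\<^sub>v ((x @\<^sub>v u) @\<^sub>v c) =
      ((jA + jB * KD * jC) *\<^sub>v (x @\<^sub>v u) + (jB * KC) *\<^sub>v c) @\<^sub>v ((KB * jC) *\<^sub>v (x @\<^sub>v u) + KA *\<^sub>v c)"
    by (rule four_block_mat_mult_vec[of _ "n + p" "n + p" _ nc _ nc]) (use jA jB jC K a c in auto)
  also have "(jA + jB * KD * jC) *\<^sub>v (x @\<^sub>v u) = jA *\<^sub>v (x @\<^sub>v u) + (jB * KD * jC) *\<^sub>v (x @\<^sub>v u)"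
    by (rule add_mult_distrib_mat_vec[OF jA _ a]) (use jB jC K in auto)
  also have "(jB * KD * jC) *\<^sub>v (x @\<^sub>v u) = (jB * KD) *\<^sub>v (jC *\<^sub>v (x @\<^sub>v u))"
    by (rule assoc_mult_mat_vec[OF mult_carrier_mat[OF jB K(4)] jC a])
  also have "\<dots> = jB *\<^sub>v (KD *\<^sub>v (CJ *\<^sub>v x))"
    unfolding jCv by (rule assoc_mult_mat_vec[OF jB K(4) Cx])
  also have "\<dots> = 0\<^sub>v n @\<^sub>v (KD *\<^sub>v (CJ *\<^sub>v x))" using K(4) Cx by (intro jBv) auto
  also have "(jB * KC) *\<^sub>v c = jB *\<^sub>v (KC *\<^sub>v c)" by (rule assoc_mult_mat_vec[OF jB K(3) c])
  also have "\<dots> = 0\<^sub>v n @\<^sub>v (KC *\<^sub>v c)" using K(3) c by (intro jBv) auto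
  also have "(KB * jC) *\<^sub>v (x @\<^sub>v u) = KB *\<^sub>v (CJ *\<^sub>v x)"
    using assoc_mult_mat_vec[OF K(2) jC a] jCv by simp
  also have "jA *\<^sub>v (x @\<^sub>v u) = x @\<^sub>v 0\<^sub>v p" by (rule jAv)
  also have "(x @\<^sub>v 0\<^sub>v p) + (0\<^sub>v n @\<^sub>v (KD *\<^sub>v (CJ *\<^sub>v x))) + (0\<^sub>v n @\<^sub>v (KC *\<^sub>v c)) =
      x @\<^sub>v (KD *\<^sub>v (CJ *\<^sub>v x) + KC *\<^sub>v c)"
    using x K by (intro eq_vecI) auto
  finally show ?thesis by (simp add: K_defs)
qed

subsection \<open>Necessity\<close>

text \<open>Vectors with zero controller part are invariant under the loop and under its transpose.
  The first makes the block of the storage matrix satisfy the primal flow inequality, the second the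
  block of its inverse the dual one.\<close>

lemma block_diag_append_zero:
  fixes A D :: "real mat"
  assumes "A \<in> carrier_mat N N" "D \<in> carrier_mat k k" "w \<in> carrier_vec N"
  defines "F \<equiv> four_block_mat A (0\<^sub>m N k) (0\<^sub>m k N) D"
  shows "F *\<^sub>v (w @\<^sub>v 0\<^sub>v k) = (A *\<^sub>v w) @\<^sub>v 0\<^sub>v k"
    and "transpose_mat F *\<^sub>v (w @\<^sub>v 0\<^sub>v k) = (transpose_mat A *\<^sub>v w) @\<^sub>v 0\<^sub>v k"
proof -
  show "F *\<^sub>v (w @\<^sub>v 0\<^sub>v k) = (A *\<^sub>v w) @\<^sub>v 0\<^sub>v k"
    unfolding F_def using assms
    by (subst four_block_mat_mult_vec[of _ N N _ k _ k]) (auto simp: zero_mat_mult_vec mult_mat_zero_vec)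
  have Ft: "transpose_mat F = four_block_mat (transpose_mat A) (0\<^sub>m N k) (0\<^sub>m k N) (transpose_mat D)"
    unfolding F_def using assms by (subst transpose_four_block_mat[of _ N N _ k _ k]) auto
  show "transpose_mat F *\<^sub>v (w @\<^sub>v 0\<^sub>v k) = (transpose_mat A *\<^sub>v w) @\<^sub>v 0\<^sub>v k"
    unfolding Ft using assms(1-3) mult_mat_zero_vec[of "transpose_mat D" k k]
    by (subst four_block_mat_mult_vec[of _ N N _ k _ k]) (auto simp: zero_mat_mult_vec)
qed

text \<open>The closed-loop inequalities are evaluated at \<open>(v, 0)\<close> and
  \<open>(x, u, 0)\<close> for the primal conditions, and at the images of \<open>(v, 0)\<close> and
  \<open>(x, 0, 0)\<close> under the inverse storage matrix for the dual ones.\<close>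

lemma reduced_forms_necessary:
  fixes n p :: nat and A B CJ :: "real mat"
  defines "N \<equiv> n + p" and "Ahat \<equiv> four_block_mat A B (0\<^sub>m p n) (0\<^sub>m p p)"
    and "G \<equiv> \<lambda>m q qJ. sampled_data_system n p m q qJ A B CJ"
  assumes T: "0 < Tmin" "Tmin < Tmax"
    and A: "A \<in> carrier_mat n n" and B: "B \<in> carrier_mat n p" and C: "CJ \<in> carrier_mat qJ n"
    and ctrl: "is_clock_controller Tmin Tmax m q p qJ nc K"
    and feas: "stability_LMIs_feasible Tmin Tmax (N + nc) (closed_loop_flow (G m q qJ) K) (closed_loop_jump (G m q qJ) K)"
  shows "\<exists>X Y. C1_symmetric_on {0..Tmax} N X \<and> C1_symmetric_on {0..Tmax} N Y \<and>
    reduced_forms Tmin Tmax n p Ahat CJ X Y"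
proof -
  define S where "S = {0..Tmax}"
  define k where "k = N + nc"
  have T': "0 < Tmax" using T by simp
  have zS: "0 \<in> S" and sub: "\<tau> \<in> {Tmin..Tmax} \<Longrightarrow> \<tau> \<in> S" for \<tau> using T by (auto simp: S_def)
  have Ah: "Ahat \<in> carrier_mat N N" unfolding Ahat_def N_def using A by auto
  obtain XX where XX: "C1_symmetric_on S k XX"
    and pd: "\<And>\<tau>. \<tau> \<in> S \<Longrightarrow> pos_def (XX \<tau>)"
    and flow: "\<And>\<tau>. \<tau> \<in> S \<Longrightarrow> neg_def (mat_deriv S XX \<tau> + transpose_mat (closed_loop_flow (G m q qJ) K \<tau>) * XX \<tau>
        + XX \<tau> * closed_loop_flow (G m q qJ) K \<tau>)"
    and jump: "\<And>\<tau>. \<tau> \<in> {Tmin..Tmax} \<Longrightarrow> neg_def (transpose_mat (closed_loop_jump (G m q qJ) K \<tau>) * XX 0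
        * closed_loop_jump (G m q qJ) K \<tau> - XX \<tau>)"
    using feas unfolding stability_LMIs_feasible_def S_def k_def by blast
  define XX' where "XX' = mat_deriv S XX"
  note XXc = C1_symmetric_onD(1,2)[OF XX]
  note XXd = C1_symmetric_onD(3)[OF XX, folded XX'_def]
  note XX'cont = C1_symmetric_onD(4)[OF XX, folded XX'_def]
  note XX'c = has_mat_derivative_onD(2)[OF XXd]
  note XX's = mat_deriv_symmetric[OF XX, folded XX'_def]

  \<comment> \<open>The inverse storage matrix and the two upper left blocks\<close>
  define ZZ where "ZZ \<tau> = inv_mat (XX \<tau>)" for \<tau>
  define ZZ' where "ZZ' \<tau> = - (inv_mat (XX \<tau>) * XX' \<tau> * inv_mat (XX \<tau>))" for \<tau>
  have ZZd: "has_mat_derivative_on S k k ZZ ZZ'"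
    unfolding ZZ_def[abs_def] ZZ'_def[abs_def] by (rule has_mat_derivative_on_inv_mat[OF XXd pd])
  note ZZcont = has_mat_derivative_on_continuous[OF ZZd]
  have ZZ'cont: "continuous_mat_on S k k ZZ'"
    unfolding ZZ'_def[abs_def] using ZZcont[unfolded ZZ_def[abs_def]] XX'cont
    by (intro continuous_mat_on_uminus continuous_mat_on_mult)
  note ZZc = has_mat_derivative_onD(1,2)[OF ZZd]
  have ZZs: "transpose_mat (ZZ \<tau>) = ZZ \<tau>" if "\<tau> \<in> S" for \<tau>
    unfolding ZZ_def by (rule inv_mat_symmetric[OF pd[OF that] XXc(1)[OF that]])
  define X where "X \<tau> = upper_left_block N (XX \<tau>)" for \<tau>
  define X' where "X' \<tau> = upper_left_block N (XX' \<tau>)" for \<tau>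
  define Y0 where "Y0 \<tau> = upper_left_block N (ZZ \<tau>)" for \<tau>
  define Y' where "Y' \<tau> = upper_left_block N (ZZ' \<tau>)" for \<tau>
  have Nk: "N \<le> k" by (simp add: k_def)
  have ul_cont: "continuous_mat_on S N N (\<lambda>\<tau>. upper_left_block N (M \<tau>))" if "continuous_mat_on S k k M" for M
    by (rule continuous_mat_onI[where f = "\<lambda>i j \<tau>. M \<tau> $$ (i, j)"])
      (use continuous_mat_onD(2)[OF that] Nk in \<open>auto simp: upper_left_block_def\<close>)
  have Xd: "has_mat_derivative_on S N N X X'"
    unfolding X_def[abs_def] X'_def[abs_def] by (rule has_mat_derivative_on_upper_left_block[OF XXd Nk])
  have X'cont: "continuous_mat_on S N N X'" unfolding X'_def[abs_def] by (rule ul_cont[OF XX'cont])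
  have Xs: "transpose_mat (X \<tau>) = X \<tau>" if "\<tau> \<in> S" for \<tau>
    unfolding X_def by (rule upper_left_block_symmetric[OF XXc(1)[OF that] Nk XXc(2)[OF that]])
  have XC1: "C1_symmetric_on S N X"
    unfolding S_def by (rule C1_symmetric_onI[OF T' Xd[unfolded S_def] X'cont[unfolded S_def]]) (use Xs S_def in simp)
  have Xderiv: "mat_deriv S X \<tau> = X' \<tau>" if "\<tau> \<in> S" for \<tau>
    using mat_deriv_eq[OF T' Xd[unfolded S_def]] that by (simp add: S_def)
  have Y0d: "has_mat_derivative_on S N N Y0 Y'"
    unfolding Y0_def[abs_def] Y'_def[abs_def] by (rule has_mat_derivative_on_upper_left_block[OF ZZd Nk])
  have Y'cont: "continuous_mat_on S N N Y'" unfolding Y'_def[abs_def] by (rule ul_cont[OF ZZ'cont])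
  have Y0s: "transpose_mat (Y0 \<tau>) = Y0 \<tau>" if "\<tau> \<in> S" for \<tau>
    unfolding Y0_def by (rule upper_left_block_symmetric[OF ZZc(1)[OF that] Nk ZZs[OF that]])
  note Y0c = has_mat_derivative_onD(1,2)[OF Y0d]
  have ul: "bform (upper_left_block N M) v w = bform M (v @\<^sub>v 0\<^sub>v nc) (w @\<^sub>v 0\<^sub>v nc)"
    if "M \<in> carrier_mat k k" "v \<in> carrier_vec N" "w \<in> carrier_vec N" for M v w
    using bform_upper_left_block[of M N nc] that by (simp add: k_def)
  have Lf: "bform (XX' \<tau>) z z + 2 * bform (XX \<tau>) z (closed_loop_flow (G m q qJ) K \<tau> *\<^sub>v z) < 0"
    if "\<tau> \<in> S" "z \<in> carrier_vec k" "z \<noteq> 0\<^sub>v k" for \<tau> z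
  proof -
    have F: "closed_loop_flow (G m q qJ) K \<tau> \<in> carrier_mat k k"
      using closed_loop_flow_sampled_data[OF A B ctrl] that(1) ctrl A
      by (auto simp: k_def N_def S_def G_def is_clock_controller_def continuous_mat_on_def)
    note e = lyapunov_expression[OF F XXc(1,2)[OF that(1)] XX'c[OF that(1)] XX's[OF that(1)]]
    show ?thesis
      using neg_def_bform[OF flow[OF that(1)] e(1)[unfolded XX'_def] that(2,3)] e(3)[OF that(2)]
      by (simp add: XX'_def)
  qed
  have loop: "closed_loop_flow (G m q qJ) K \<tau> *\<^sub>v (w @\<^sub>v 0\<^sub>v nc) = (Ahat *\<^sub>v w) @\<^sub>v 0\<^sub>v nc"
    "transpose_mat (closed_loop_flow (G m q qJ) K \<tau>) *\<^sub>v (w @\<^sub>v 0\<^sub>v nc) = (transpose_mat Ahat *\<^sub>v w) @\<^sub>v 0\<^sub>v nc"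
    "closed_loop_flow (G m q qJ) K \<tau> \<in> carrier_mat k k"
    if "\<tau> \<in> S" "w \<in> carrier_vec N" for \<tau> w
  proof -
    have cA: "ctrl_A K \<tau> \<in> carrier_mat nc nc"
      using ctrl that(1) by (auto simp: S_def is_clock_controller_def continuous_mat_on_def)
    have F: "closed_loop_flow (G m q qJ) K \<tau> = four_block_mat Ahat (0\<^sub>m N nc) (0\<^sub>m nc N) (ctrl_A K \<tau>)"
      using closed_loop_flow_sampled_data[OF A B ctrl] that(1) by (simp add: S_def G_def N_def Ahat_def)
    show "closed_loop_flow (G m q qJ) K \<tau> *\<^sub>v (w @\<^sub>v 0\<^sub>v nc) = (Ahat *\<^sub>v w) @\<^sub>v 0\<^sub>v nc"
      "transpose_mat (closed_loop_flow (G m q qJ) K \<tau>) *\<^sub>v (w @\<^sub>v 0\<^sub>v nc) = (transpose_mat Ahat *\<^sub>v w) @\<^sub>v 0\<^sub>v nc"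
      unfolding F by (rule block_diag_append_zero[OF Ah cA that(2)])+
    show "closed_loop_flow (G m q qJ) K \<tau> \<in> carrier_mat k k"
      unfolding F k_def using Ah cA by auto
  qed

  \<comment> \<open>Flow inequalities of the blocks\<close>
  have primal: "bform (X' \<tau>) v v + 2 * bform (X \<tau>) v (Ahat *\<^sub>v v) < 0"
    if t: "\<tau> \<in> S" and v: "v \<in> carrier_vec N" "v \<noteq> 0\<^sub>v N" for \<tau> v
  proof -
    have "bform (X' \<tau>) v v = bform (XX' \<tau>) (v @\<^sub>v 0\<^sub>v nc) (v @\<^sub>v 0\<^sub>v nc)"
      unfolding X'_def by (rule ul[OF XX'c[OF t] v(1) v(1)])
    moreover have "bform (X \<tau>) v (Ahat *\<^sub>v v) = bform (XX \<tau>) (v @\<^sub>v 0\<^sub>v nc) ((Ahat *\<^sub>v v) @\<^sub>v 0\<^sub>v nc)"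
      unfolding X_def using Ah v by (intro ul[OF XXc(1)[OF t]]) auto
    ultimately show ?thesis
      using Lf[OF t, of "v @\<^sub>v 0\<^sub>v nc"] append_zero_nonzero[OF v, of nc] v(1) loop(1)[OF t v(1)]
      by (simp add: k_def)
  qed
  have dual: "bform (Y' \<tau>) v v - 2 * bform (Y0 \<tau>) v (transpose_mat Ahat *\<^sub>v v) > 0"
    if t: "\<tau> \<in> S" and v: "v \<in> carrier_vec N" "v \<noteq> 0\<^sub>v N" for \<tau> v
  proof -
    define w where "w = v @\<^sub>v 0\<^sub>v nc"
    define z where "z = ZZ \<tau> *\<^sub>v w"
    have w: "w \<in> carrier_vec k" "w \<noteq> 0\<^sub>v k"
      using v append_zero_nonzero[OF v, of nc] by (auto simp: w_def k_def)
    have z: "z \<in> carrier_vec k" using ZZc(1)[OF t] w by (auto simp: z_def)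
    have "XX \<tau> *\<^sub>v z = w"
      unfolding z_def ZZ_def by (rule inv_mat_cancel(1)[OF pd[OF t] XXc(1)[OF t] w(1)])
    then have z0: "z \<noteq> 0\<^sub>v k" using w(2) mult_mat_zero_vec[OF XXc(1)[OF t]] by auto
    have "bform (Y' \<tau>) v v = bform (ZZ' \<tau>) w w"
      unfolding Y'_def w_def by (rule ul[OF ZZc(2)[OF t] v(1) v(1)])
    \<comment> \<open>The transposed loop maps \<open>w\<close> to a vector whose controller part is
      zero again, so the form of \<open>ZZ\<close> only sees its upper left block.\<close>
    moreover have "bform (Y0 \<tau>) v (transpose_mat Ahat *\<^sub>v v) =
        bform (ZZ \<tau>) w (transpose_mat (closed_loop_flow (G m q qJ) K \<tau>) *\<^sub>v w)"
      unfolding Y0_def w_def loop(2)[OF t v(1)] using Ah v by (intro ul[OF ZZc(1)[OF t]]) auto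
    ultimately have "bform (Y' \<tau>) v v - 2 * bform (Y0 \<tau>) v (transpose_mat Ahat *\<^sub>v v) =
        - (bform (XX' \<tau>) z z + 2 * bform (XX \<tau>) z (closed_loop_flow (G m q qJ) K \<tau> *\<^sub>v z))"
      using dual_flow_form_inv_mat[OF loop(3)[OF t v(1)] XXc(1)[OF t] pd[OF t] XX'c[OF t] w(1)]
      by (simp add: ZZ'_def ZZ_def z_def)
    then show ?thesis using Lf[OF t z z0] by simp
  qed

  \<comment> \<open>Perturbation of \<open>Y0\<close> by a multiple of the identity\<close>
  define At where "At = transpose_mat Ahat"
  have At: "At \<in> carrier_mat N N" "- At \<in> carrier_mat N N" using Ah by (auto simp: At_def)
  \<comment> \<open>Adding \<open>\<epsilon>\<close> times the identity to \<open>Y0\<close> leaves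
    its derivative unchanged and changes the dual flow form by
    \<open>\<epsilon> * bform Q v v\<close>.\<close>
  define Q where "Q = - (At + transpose_mat At)"
  have Q: "Q \<in> carrier_mat N N" using At by (auto simp: Q_def intro!: carrier_matI)
  have Qf: "bform Q v v = - 2 * (v \<bullet> (At *\<^sub>v v))" if "v \<in> carrier_vec N" for v
  proof -
    have "bform Q v v = - (bform At v v + bform (transpose_mat At) v v)"
      unfolding Q_def using that At by (subst bform_uminus_mat) (auto simp: bform_add_mat)
    also have "bform (transpose_mat At) v v = bform At v v"
      using that At by (intro bform_transpose) auto
    finally show ?thesis by (simp add: bform_def)
  qed
  \<comment> \<open>The dual flow form of \<open>Y0\<close> as the form of one matrix that is
    continuous in the clock value, obtained as the Lyapunov expression of
    \<open>- At\<close>.\<close>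
  define D where "D \<tau> = Y' \<tau> + transpose_mat (- At) * Y0 \<tau> + Y0 \<tau> * (- At)" for \<tau>
  have Df: "bform (D \<tau>) v v = bform (Y' \<tau>) v v - 2 * bform (Y0 \<tau>) v (At *\<^sub>v v)"
    if "\<tau> \<in> S" "v \<in> carrier_vec N" for \<tau> v
  proof -
    have Y's: "transpose_mat (Y' \<tau>) = Y' \<tau>"
    proof -
      have "mat_deriv S Y0 \<tau> = Y' \<tau>" using mat_deriv_eq[OF T' Y0d[unfolded S_def]] that(1) by (simp add: S_def)
      moreover have "C1_symmetric_on S N Y0"
        unfolding S_def by (rule C1_symmetric_onI[OF T' Y0d[unfolded S_def] Y'cont[unfolded S_def]]) (use Y0s S_def in simp)
      ultimately show ?thesis using mat_deriv_symmetric that(1) by metis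
    qed
    have "bform (Y0 \<tau>) v ((- At) *\<^sub>v v) = - bform (Y0 \<tau>) v (At *\<^sub>v v)"
      using that At Y0c(1)[OF that(1)] by (subst uminus_mult_mat_vec, simp, intro bform_uminus_right) auto
    then show ?thesis
      using lyapunov_expression(3)[OF At(2) Y0c(1)[OF that(1)] Y0s[OF that(1)] Y0c(2)[OF that(1)] Y's that(2)]
      by (simp add: D_def)
  qed
  have Dpos: "bform (D \<tau>) v v > 0" if "\<tau> \<in> S" "v \<in> carrier_vec N" "v \<noteq> 0\<^sub>v N" for \<tau> v
    using Df dual that by (simp add: At_def)
  have Dcont: "continuous_mat_on S N N D"
    unfolding D_def[abs_def] using At has_mat_derivative_on_continuous[OF Y0d] Y'cont
    by (intro continuous_mat_on_add continuous_mat_on_mult continuous_mat_on_transpose continuous_mat_on_const) auto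
  \<comment> \<open>Since \<open>D\<close> is positive definite, the Finsler lemma here only says
    that a multiple of \<open>D\<close> dominates \<open>- Q\<close> uniformly in the clock
    value.\<close>
  have "\<exists>\<mu>>0. \<forall>\<tau>\<in>S. \<forall>v\<in>carrier_vec N. v \<noteq> 0\<^sub>v N \<longrightarrow> bform Q v v + \<mu> * bform (D \<tau>) v v > 0"
  proof (rule uniform_finsler[OF _ continuous_mat_on_const[OF Q] Dcont])
    show "compact S" by (simp add: S_def)
    show "bform (D \<tau>) v v \<ge> 0" if "\<tau> \<in> S" "v \<in> carrier_vec N" for \<tau> v
    proof (cases "v = 0\<^sub>v N")
      case True
      then show ?thesis
        using bform_zero_left[of "D \<tau>" v] continuous_mat_onD(3)[OF Dcont that(1)] by simp
    next
      case False
      then show ?thesis using Dpos[OF that] by simp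
    qed
    show "bform Q v v > 0" if "\<tau> \<in> S" "v \<in> carrier_vec N" "v \<noteq> 0\<^sub>v N" "bform (D \<tau>) v v = 0" for \<tau> v
      using Dpos[OF that(1-3)] that(4) by simp
  qed
  then obtain \<mu> where \<mu>: "\<mu> > 0"
    "\<And>\<tau> v. \<tau> \<in> S \<Longrightarrow> v \<in> carrier_vec N \<Longrightarrow> v \<noteq> 0\<^sub>v N \<Longrightarrow> bform Q v v + \<mu> * bform (D \<tau>) v v > 0"
    by blast
  \<comment> \<open>Multiplying \<open>Q + \<mu> D\<close> by \<open>1 / \<mu>\<close> gives
    \<open>\<epsilon> Q + D\<close>, the dual flow form of the perturbed \<open>Y\<close>.\<close>
  define \<epsilon> where "\<epsilon> = 1 / \<mu>"
  have \<epsilon>: "\<epsilon> > 0" using \<mu>(1) by (simp add: \<epsilon>_def)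
  define Y where "Y \<tau> = Y0 \<tau> + \<epsilon> \<cdot>\<^sub>m 1\<^sub>m N" for \<tau>
  have Yd: "has_mat_derivative_on S N N Y Y'"
    unfolding Y_def[abs_def] by (rule has_mat_derivative_on_add_const[OF Y0d]) auto
  have Ys: "transpose_mat (Y \<tau>) = Y \<tau>" if "\<tau> \<in> S" for \<tau>
  proof -
    have "transpose_mat (\<epsilon> \<cdot>\<^sub>m 1\<^sub>m N) = \<epsilon> \<cdot>\<^sub>m 1\<^sub>m N" by (intro eq_matI) auto
    then show ?thesis unfolding Y_def
      using transpose_add[OF Y0c(1)[OF that], of "\<epsilon> \<cdot>\<^sub>m 1\<^sub>m N"] Y0s[OF that] by simp
  qed
  have YC1: "C1_symmetric_on S N Y"
    unfolding S_def by (rule C1_symmetric_onI[OF T' Yd[unfolded S_def] Y'cont[unfolded S_def]]) (use Ys S_def in simp)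
  have Yderiv: "mat_deriv S Y \<tau> = Y' \<tau>" if "\<tau> \<in> S" for \<tau>
    using mat_deriv_eq[OF T' Yd[unfolded S_def]] that by (simp add: S_def)
  have Yf: "bform (Y \<tau>) v w = bform (Y0 \<tau>) v w + \<epsilon> * (v \<bullet> w)"
    if "\<tau> \<in> S" "v \<in> carrier_vec N" "w \<in> carrier_vec N" for \<tau> v w
    unfolding Y_def using that Y0c(1)[OF that(1)]
    by (subst bform_add_mat) (auto simp: bform_smult_mat bform_one_mat)
  have coupling: "bform (Y \<tau>) a a + 2 * (a \<bullet> b) + bform (X \<tau>) b b > 0"
    if t: "\<tau> \<in> S" and a: "a \<in> carrier_vec N" and b: "b \<in> carrier_vec N" and nz: "a \<noteq> 0\<^sub>v N \<or> b \<noteq> 0\<^sub>v N" for \<tau> a b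
  proof -
    define v w where "v = a @\<^sub>v 0\<^sub>v nc" and "w = b @\<^sub>v 0\<^sub>v nc"
    have vw: "v \<in> carrier_vec k" "w \<in> carrier_vec k" using a b by (auto simp: v_def w_def k_def)
    define z where "z = ZZ \<tau> *\<^sub>v v"
    have z: "z \<in> carrier_vec k" using ZZc(1)[OF t] vw by (auto simp: z_def)
    have Xz: "XX \<tau> *\<^sub>v z = v"
      unfolding z_def ZZ_def by (rule inv_mat_cancel(1)[OF pd[OF t] XXc(1)[OF t] vw(1)])
    have "bform (Y0 \<tau>) a a = bform (ZZ \<tau>) v v"
      unfolding Y0_def v_def by (rule ul[OF ZZc(1)[OF t] a a])
    also have "\<dots> = bform (XX \<tau>) z z"
      unfolding ZZ_def z_def by (rule bform_inv_mat[OF pd[OF t] XXc(1)[OF t] vw(1) vw(1)])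
    finally have 1: "bform (Y0 \<tau>) a a = bform (XX \<tau>) z z" .
    have "v \<bullet> w = a \<bullet> b + 0\<^sub>v nc \<bullet> 0\<^sub>v nc"
      unfolding v_def w_def by (rule scalar_prod_append[of _ N _ nc]) (use a b in auto)
    moreover have "bform (XX \<tau>) w z = w \<bullet> v" using Xz by (simp add: bform_def)
    moreover have "w \<bullet> v = v \<bullet> w" using vw by (intro scalar_prod_commute) auto
    ultimately have 2: "bform (XX \<tau>) w z = a \<bullet> b" by simp
    have 3: "bform (XX \<tau>) z w = bform (XX \<tau>) w z"
      using z vw XXc[OF t] by (intro bform_commute) auto
    have 4: "bform (X \<tau>) b b = bform (XX \<tau>) w w"
      unfolding X_def w_def by (rule ul[OF XXc(1)[OF t] b b])
    \<comment> \<open>The coupling form of \<open>Y0\<close> and \<open>X\<close> is this single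
      square, which vanishes when \<open>w\<close> is \<open>- z\<close>. The perturbation makes it
      strict for \<open>a\<close> nonzero; for \<open>a\<close> zero, only the definite form of
      \<open>X\<close> at \<open>b\<close> remains.\<close>
    have "0 \<le> bform (XX \<tau>) (z + w) (z + w)"
      using z vw by (intro pos_def_bform_nonneg[OF pd[OF t] XXc(1)[OF t]]) auto
    also have "\<dots> = bform (XX \<tau>) z z + bform (XX \<tau>) z w + (bform (XX \<tau>) w z + bform (XX \<tau>) w w)"
      using z vw XXc(1)[OF t] by (simp add: bform_add_left bform_add_right)
    finally have ge: "0 \<le> bform (Y0 \<tau>) a a + 2 * (a \<bullet> b) + bform (X \<tau>) b b"
      using 1 2 3 4 by linarith
    show ?thesis
    proof (cases "a = 0\<^sub>v N")
      case False
      then have "\<epsilon> * (a \<bullet> a) > 0" using scalar_prod_self_pos[OF a] \<epsilon> by simp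
      then show ?thesis using ge Yf[OF t a a] by linarith
    next
      case True
      then have "b \<noteq> 0\<^sub>v N" using nz by simp
      then have "w \<noteq> 0\<^sub>v k" unfolding w_def k_def using append_zero_nonzero b by blast
      then have "bform (X \<tau>) b b > 0" using pos_def_bform[OF pd[OF t] XXc(1)[OF t] vw(2)] 4 by simp
      moreover have "bform (Y0 \<tau>) a a = 0" using bform_zero_left[of "Y0 \<tau>" a] True Y0c(1)[OF t] by simp
      moreover have "a \<bullet> b = 0" "a \<bullet> a = 0" using True b by auto
      ultimately show ?thesis using Yf[OF t a a] by simp
    qed
  qed
  have dual': "bform (Y' \<tau>) v v - 2 * bform (Y \<tau>) v (transpose_mat Ahat *\<^sub>v v) > 0"
    if t: "\<tau> \<in> S" and v: "v \<in> carrier_vec N" "v \<noteq> 0\<^sub>v N" for \<tau> v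
  proof -
    have "bform (Y \<tau>) v (At *\<^sub>v v) = bform (Y0 \<tau>) v (At *\<^sub>v v) + \<epsilon> * (v \<bullet> (At *\<^sub>v v))"
      using At v by (intro Yf[OF t]) auto
    moreover have "\<epsilon> * (bform Q v v + \<mu> * bform (D \<tau>) v v) = \<epsilon> * bform Q v v + bform (D \<tau>) v v"
      using \<mu>(1) by (simp add: \<epsilon>_def distrib_left)
    moreover have "\<epsilon> * bform Q v v = - 2 * (\<epsilon> * (v \<bullet> (At *\<^sub>v v)))"
      using Qf[OF v(1)] by simp
    ultimately have "bform (Y' \<tau>) v v - 2 * bform (Y \<tau>) v (At *\<^sub>v v) = \<epsilon> * (bform Q v v + \<mu> * bform (D \<tau>) v v)"
      using Df[OF t v(1)] by linarith
    also have "\<dots> > 0" using \<mu>(2)[OF t v] \<epsilon> by simp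
    finally show ?thesis by (simp add: At_def)
  qed

  \<comment> \<open>Jump inequalities of the blocks\<close>
  have J: "bform (XX 0) (closed_loop_jump (G m q qJ) K \<tau> *\<^sub>v w) (closed_loop_jump (G m q qJ) K \<tau> *\<^sub>v w) < bform (XX \<tau>) w w"
    if t: "\<tau> \<in> {Tmin..Tmax}" and w: "w \<in> carrier_vec k" "w \<noteq> 0\<^sub>v k" for \<tau> w
  proof -
    define F where "F = closed_loop_jump (G m q qJ) K \<tau>"
    have F: "F \<in> carrier_mat k k"
      using closed_loop_jump_sampled_data_carrier[OF C ctrl t] by (simp add: F_def G_def k_def N_def)
    note c = congruence_carrier[OF F, of "XX 0"]
    have "bform (transpose_mat F * XX 0 * F - XX \<tau>) w w < 0"
      using XXc(1)[OF sub[OF t]] by (intro neg_def_bform[OF jump[OF t, folded F_def] _ w] minus_carrier_mat)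
    also have "bform (transpose_mat F * XX 0 * F - XX \<tau>) w w = bform (transpose_mat F * XX 0 * F) w w - bform (XX \<tau>) w w"
      using carrier_matD[OF c] carrier_matD[OF XXc(1)[OF sub[OF t]]] w by (intro bform_minus_mat) (simp_all only: carrier_vecD)
    finally show ?thesis using bform_congruence[OF XXc(1)[OF zS] F w(1) w(1)] by (simp only: F_def diff_less_0_iff_less)
  qed
  have primal_jump: "bform (upper_left_block n (X 0)) x x < bform (X \<tau>) (x @\<^sub>v u) (x @\<^sub>v u)"
    if t: "\<tau> \<in> {Tmin..Tmax}" and x: "x \<in> carrier_vec n" "CJ *\<^sub>v x = 0\<^sub>v qJ" and u: "u \<in> carrier_vec p"
      and nz: "x \<noteq> 0\<^sub>v n \<or> u \<noteq> 0\<^sub>v p" for \<tau> x u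
  proof -
    define a where "a = x @\<^sub>v u"
    have a: "a \<in> carrier_vec N" "a \<noteq> 0\<^sub>v N"
      using x u nz by (auto simp: a_def N_def append_vec_eq_zero_iff)
    have K: "ctrl_AJ K \<tau> \<in> carrier_mat nc nc" "ctrl_BJ K \<tau> \<in> carrier_mat nc qJ"
      "ctrl_CJ K \<tau> \<in> carrier_mat p nc" "ctrl_DJ K \<tau> \<in> carrier_mat p qJ"
      using ctrl t by (auto simp: is_clock_controller_def continuous_mat_on_def)
    \<comment> \<open>Zero measurement and zero controller state leave the controller nothing to act
      on, so the control and the controller state are both reset to zero.\<close>
    have "closed_loop_jump (G m q qJ) K \<tau> *\<^sub>v (a @\<^sub>v 0\<^sub>v nc) = (x @\<^sub>v 0\<^sub>v p) @\<^sub>v 0\<^sub>v nc"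
      unfolding G_def a_def using closed_loop_jump_sampled_data[OF C ctrl t x(1) u, of "0\<^sub>v nc"] K
      by (simp add: x(2) mult_mat_zero_vec)
    then have "bform (XX 0) ((x @\<^sub>v 0\<^sub>v p) @\<^sub>v 0\<^sub>v nc) ((x @\<^sub>v 0\<^sub>v p) @\<^sub>v 0\<^sub>v nc) < bform (XX \<tau>) (a @\<^sub>v 0\<^sub>v nc) (a @\<^sub>v 0\<^sub>v nc)"
      using J[OF t, of "a @\<^sub>v 0\<^sub>v nc"] a append_zero_nonzero[OF a, of nc] by (simp add: k_def)
    also have "bform (XX \<tau>) (a @\<^sub>v 0\<^sub>v nc) (a @\<^sub>v 0\<^sub>v nc) = bform (X \<tau>) a a"
      unfolding X_def using ul[OF XXc(1)[OF sub[OF t]] a(1) a(1)] by simp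
    also have "bform (XX 0) ((x @\<^sub>v 0\<^sub>v p) @\<^sub>v 0\<^sub>v nc) ((x @\<^sub>v 0\<^sub>v p) @\<^sub>v 0\<^sub>v nc) = bform (X 0) (x @\<^sub>v 0\<^sub>v p) (x @\<^sub>v 0\<^sub>v p)"
      unfolding X_def using x by (subst ul[OF XXc(1)[OF zS]]) (auto simp: N_def)
    also have "\<dots> = bform (upper_left_block n (X 0)) x x"
      using bform_upper_left_block[of "X 0" n p x x] x upper_left_block_carrier[of N] by (simp add: X_def N_def)
    finally show ?thesis by (simp add: a_def)
  qed
  have dual_jump: "bform (upper_left_block n (Y \<tau>)) x x < bform (upper_left_block n (Y 0)) x x"
    if t: "\<tau> \<in> {Tmin..Tmax}" and x: "x \<in> carrier_vec n" "x \<noteq> 0\<^sub>v n" for \<tau> x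
  proof -
    define h where "h = (x @\<^sub>v 0\<^sub>v p) @\<^sub>v 0\<^sub>v nc"
    have xp: "x @\<^sub>v 0\<^sub>v p \<in> carrier_vec N" "x @\<^sub>v 0\<^sub>v p \<noteq> 0\<^sub>v N"
      using x append_zero_nonzero[OF x, of p] by (auto simp: N_def)
    have h: "h \<in> carrier_vec k" "h \<noteq> 0\<^sub>v k"
      using xp append_zero_nonzero[OF xp, of nc] by (auto simp: h_def k_def)
    note t' = sub[OF t]
    define z where "z = ZZ \<tau> *\<^sub>v h"
    have z: "z \<in> carrier_vec k" using ZZc(1)[OF t'] h by (auto simp: z_def)
    have "XX \<tau> *\<^sub>v z = h"
      unfolding z_def ZZ_def by (rule inv_mat_cancel(1)[OF pd[OF t'] XXc(1)[OF t'] h(1)])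
    then have z0: "z \<noteq> 0\<^sub>v k" using h(2) mult_mat_zero_vec[OF XXc(1)[OF t']] by auto
    obtain za zc where zac: "za \<in> carrier_vec N" "zc \<in> carrier_vec nc" "z = za @\<^sub>v zc"
      using append_vecE[of z N nc] z by (auto simp: k_def)
    obtain zx zu where zxu: "zx \<in> carrier_vec n" "zu \<in> carrier_vec p" "za = zx @\<^sub>v zu"
      using append_vecE[of za n p] zac by (auto simp: N_def)
    define s where "s = closed_loop_jump (G m q qJ) K \<tau> *\<^sub>v z"
    \<comment> \<open>The product with \<open>h\<close> only sees the first component, which the
      jump preserves. Hence \<open>z\<close> and its image \<open>s\<close> have the same product
      with \<open>h\<close>, whatever the controller does.\<close>
    have hp: "((zx @\<^sub>v u) @\<^sub>v c) \<bullet> h = zx \<bullet> x" if "u \<in> carrier_vec p" "c \<in> carrier_vec nc" for u c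
    proof -
      have "((zx @\<^sub>v u) @\<^sub>v c) \<bullet> h = (zx @\<^sub>v u) \<bullet> (x @\<^sub>v 0\<^sub>v p) + c \<bullet> 0\<^sub>v nc"
        unfolding h_def by (rule scalar_prod_append[of _ "n + p" _ nc]) (use zxu x that in auto)
      also have "(zx @\<^sub>v u) \<bullet> (x @\<^sub>v 0\<^sub>v p) = zx \<bullet> x + u \<bullet> 0\<^sub>v p"
        by (rule scalar_prod_append[of _ n _ p]) (use zxu x that in auto)
      finally show ?thesis using that by simp
    qed
    have K: "ctrl_AJ K \<tau> \<in> carrier_mat nc nc" "ctrl_BJ K \<tau> \<in> carrier_mat nc qJ"
      "ctrl_CJ K \<tau> \<in> carrier_mat p nc" "ctrl_DJ K \<tau> \<in> carrier_mat p qJ"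
      using ctrl t by (auto simp: is_clock_controller_def continuous_mat_on_def)
    have s: "s = (zx @\<^sub>v (ctrl_DJ K \<tau> *\<^sub>v (CJ *\<^sub>v zx) + ctrl_CJ K \<tau> *\<^sub>v zc)) @\<^sub>v
        (ctrl_BJ K \<tau> *\<^sub>v (CJ *\<^sub>v zx) + ctrl_AJ K \<tau> *\<^sub>v zc)"
      unfolding s_def zac(3) zxu(3) G_def by (rule closed_loop_jump_sampled_data[OF C ctrl t zxu(1,2) zac(2)])
    have sc: "s \<in> carrier_vec k"
      unfolding s k_def N_def using K C zxu zac by (intro append_carrier_vec add_carrier_vec mult_mat_vec_carrier) auto
    have "s \<bullet> h = zx \<bullet> x"
      unfolding s by (rule hp) (use K C zxu zac in \<open>auto intro!: add_carrier_vec mult_mat_vec_carrier\<close>)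
    moreover have "z \<bullet> h = zx \<bullet> x"
      unfolding zac(3) zxu(3) by (rule hp[OF zxu(2) zac(2)])
    ultimately have "bform (ZZ \<tau>) h h < bform (ZZ 0) h h"
      using dual_jump_inequality[OF XXc(1)[OF zS] pd[OF zS] XXc(1)[OF t'] pd[OF t'] h(1) sc]
        J[OF t z z0] by (simp add: ZZ_def z_def s_def)
    \<comment> \<open>The perturbation contributes the same amount at every clock value, so it
      cancels in the comparison of \<open>\<tau>\<close> with \<open>0\<close>.\<close>
    moreover have "bform (upper_left_block n (Y \<sigma>)) x x = bform (ZZ \<sigma>) h h + \<epsilon> * ((x @\<^sub>v 0\<^sub>v p) \<bullet> (x @\<^sub>v 0\<^sub>v p))"
      if "\<sigma> \<in> S" for \<sigma>
    proof -
      have "bform (upper_left_block n (Y \<sigma>)) x x = bform (Y \<sigma>) (x @\<^sub>v 0\<^sub>v p) (x @\<^sub>v 0\<^sub>v p)"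
        using C1_symmetric_onD(1)[OF YC1 that] x by (intro bform_upper_left_block) (auto simp: N_def)
      also have "\<dots> = bform (Y0 \<sigma>) (x @\<^sub>v 0\<^sub>v p) (x @\<^sub>v 0\<^sub>v p) + \<epsilon> * ((x @\<^sub>v 0\<^sub>v p) \<bullet> (x @\<^sub>v 0\<^sub>v p))"
        by (rule Yf[OF that xp(1) xp(1)])
      also have "bform (Y0 \<sigma>) (x @\<^sub>v 0\<^sub>v p) (x @\<^sub>v 0\<^sub>v p) = bform (ZZ \<sigma>) h h"
        unfolding Y0_def h_def by (rule ul[OF ZZc(1)[OF that] xp(1) xp(1)])
      finally show ?thesis .
    qed
    ultimately show ?thesis using t' zS by simp
  qed
  have "reduced_forms Tmin Tmax n p Ahat CJ X Y"
    unfolding reduced_forms_def S_def[symmetric] N_def[symmetric]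
    using coupling primal dual' primal_jump dual_jump C by (auto simp: Xderiv Yderiv)
  then show ?thesis using XC1 YC1 unfolding S_def by blast
qed

subsection \<open>Sufficiency\<close>

text \<open>In the coordinates \<open>a\<close> (plant) and \<open>e = a - c\<close> (estimation error), this storage function
  is \<open>P + S\<close> with \<open>S = X - P\<close>; its inverse has upper left block \<open>P\<^sup>-\<^sup>1\<close>.\<close>

definition storage :: "real mat \<Rightarrow> real mat \<Rightarrow> real mat" where
  "storage X P = four_block_mat X (P - X) (P - X) (X - P)"

lemma storage_carrier:
  "X \<in> carrier_mat N N \<Longrightarrow> P \<in> carrier_mat N N \<Longrightarrow> storage X P \<in> carrier_mat (N + N) (N + N)"
  unfolding storage_def by (intro four_block_carrier_mat) auto

lemma storage_symmetric:
  assumes "X \<in> carrier_mat N N" "P \<in> carrier_mat N N" "transpose_mat X = X" "transpose_mat P = P"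
  shows "transpose_mat (storage X P) = storage X P"
  unfolding storage_def
  by (rule four_block_symmetric)
    (use assms transpose_minus[OF assms(1,2)] transpose_minus[OF assms(2,1)] in auto)

lemma bform_storage:
  assumes "X \<in> carrier_mat N N" "P \<in> carrier_mat N N"
    and "a \<in> carrier_vec N" "c \<in> carrier_vec N" "a' \<in> carrier_vec N" "c' \<in> carrier_vec N"
  shows "bform (storage X P) (a @\<^sub>v c) (a' @\<^sub>v c') = bform P a a' + bform (X - P) (a - c) (a' - c')"
proof -
  have "bform (storage X P) (a @\<^sub>v c) (a' @\<^sub>v c') =
      bform X a a' + bform (P - X) a c' + bform (P - X) c a' + bform (X - P) c c'"
    unfolding storage_def using assms by (subst bform_four_block[of _ N N _ N _ N]) auto
  then show ?thesis
    using assms by (simp add: bform_minus_mat bform_diff_left bform_diff_right)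
qed

text \<open>With this \<open>Ac\<close> the flow inequality decouples into the one for \<open>P\<close> at the controller state \<open>c\<close>
  and the one for \<open>X\<close> at the error \<open>e\<close>.\<close>

lemma storage_flow_form:
  assumes A: "A \<in> carrier_mat N N" and X: "X \<in> carrier_mat N N" "transpose_mat X = X"
    and X': "X' \<in> carrier_mat N N"
    and P: "P \<in> carrier_mat N N" "transpose_mat P = P" and P': "P' \<in> carrier_mat N N" "transpose_mat P' = P'"
    and pd: "pos_def (X - P)"
    and a: "a \<in> carrier_vec N" and c: "c \<in> carrier_vec N"
  defines "L \<equiv> P' + transpose_mat A * P + P * A"
  defines "Ac \<equiv> A + inv_mat (X - P) * L"
  defines "e \<equiv> a - c"
  shows "bform (storage X' P') (a @\<^sub>v c) (a @\<^sub>v c) + 2 * bform (storage X P) (a @\<^sub>v c) ((A *\<^sub>v a) @\<^sub>v (Ac *\<^sub>v c)) =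
    bform L c c + (bform X' e e + 2 * bform X e (A *\<^sub>v e))"
proof -
  define S where "S = X - P"
  have S: "S \<in> carrier_mat N N" using X P by (auto simp: S_def)
  have Ss: "transpose_mat S = S" unfolding S_def by (simp add: transpose_minus[OF X(1) P(1)] X P)
  note L = lyapunov_expression[OF A P P', folded L_def]
  have e: "e \<in> carrier_vec N" using a c by (auto simp: e_def)
  have ae: "a = c + e" using a c by (intro eq_vecI) (auto simp: e_def)
  have I: "inv_mat S \<in> carrier_mat N N" using inv_mat_carrier[OF pd[folded S_def] S] .
  have Lc: "L *\<^sub>v c \<in> carrier_vec N" using L(1) c by auto
  have Acc: "Ac *\<^sub>v c = A *\<^sub>v c + inv_mat S *\<^sub>v (L *\<^sub>v c)"
    unfolding Ac_def S_def[symmetric]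
    using add_mult_distrib_mat_vec[OF A mult_carrier_mat[OF I L(1)] c] assoc_mult_mat_vec[OF I L(1) c] by simp
  have ILc: "inv_mat S *\<^sub>v (L *\<^sub>v c) \<in> carrier_vec N" using I Lc by auto
  have Aa: "A *\<^sub>v a = A *\<^sub>v c + A *\<^sub>v e" unfolding ae by (rule mult_add_distrib_mat_vec[OF A c e])
  have diff: "A *\<^sub>v a - Ac *\<^sub>v c = A *\<^sub>v e - inv_mat S *\<^sub>v (L *\<^sub>v c)"
    unfolding Aa Acc using A I L(1) c e by (intro eq_vecI) auto
  have Ac: "Ac \<in> carrier_mat N N" unfolding Ac_def S_def[symmetric] using A I L(1) by (intro add_carrier_mat mult_carrier_mat)
  have "bform S e (A *\<^sub>v e - inv_mat S *\<^sub>v (L *\<^sub>v c)) = bform S e (A *\<^sub>v e) - bform S e (inv_mat S *\<^sub>v (L *\<^sub>v c))"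
    \<comment> \<open>The correction in \<open>Ac\<close> contributes
      \<open>- 2 * bform L e c\<close> to the flow form. This removes the cross term of
      \<open>bform L a a\<close> for \<open>a = c + e\<close>, while the remaining
      \<open>bform L e e\<close> completes the form of \<open>X - P\<close> at \<open>e\<close> to
      that of \<open>X\<close>.\<close>
    using S A e carrier_matD[OF I] by (intro bform_diff_right) auto
  also have "bform S e (inv_mat S *\<^sub>v (L *\<^sub>v c)) = bform L e c"
    using inv_mat_cancel(1)[OF pd[folded S_def] S Lc] by (simp add: bform_def)
  finally have 1: "bform S e (A *\<^sub>v a - Ac *\<^sub>v c) = bform S e (A *\<^sub>v e) - bform L e c" unfolding diff .
  have 2: "bform (storage X P) (a @\<^sub>v c) ((A *\<^sub>v a) @\<^sub>v (Ac *\<^sub>v c)) =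
      bform P a (A *\<^sub>v a) + bform S e (A *\<^sub>v a - Ac *\<^sub>v c)"
    unfolding S_def e_def using A Ac a c by (intro bform_storage[OF X(1) P(1)]) auto
  have 3: "bform (storage X' P') (a @\<^sub>v c) (a @\<^sub>v c) = bform P' a a + bform (X' - P') e e"
    unfolding e_def by (rule bform_storage[OF X' P'(1) a c a c])
  have 4: "bform (X' - P') e e = bform X' e e - bform P' e e"
    using X' P' e by (intro bform_minus_mat) auto
  have 5: "bform S e (A *\<^sub>v e) = bform X e (A *\<^sub>v e) - bform P e (A *\<^sub>v e)"
    unfolding S_def using X P A e by (intro bform_minus_mat) auto
  have 6: "bform L a a = bform L c c + 2 * bform L c e + bform L e e"
    unfolding ae by (rule bform_add_quadratic[OF L(2,1) c e])
  have 7: "bform L c e = bform L e c"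
    using L(1) c e by (intro bform_commute[OF L(2)]) auto
  show ?thesis using 1 2 3 4 5 6 7 L(3)[OF a] L(3)[OF e] by linarith
qed

text \<open>Completion of the square in the observer step: \<open>g\<close> minimises
  \<open>W z z + S (z - c) (z - c) + D (a - z) (a - z)\<close> over \<open>z\<close>.\<close>

lemma observer_square_completion:
  assumes W: "W \<in> carrier_mat N N" "transpose_mat W = W" and S: "S \<in> carrier_mat N N" "transpose_mat S = S"
    and D: "D \<in> carrier_mat N N" "transpose_mat D = D"
    and a: "a \<in> carrier_vec N" and c: "c \<in> carrier_vec N" and g: "g \<in> carrier_vec N"
    and eq: "(W + S + D) *\<^sub>v g = S *\<^sub>v c + D *\<^sub>v a"
  shows "bform W a a + bform S (a - c) (a - c) =
    bform (W + S + D) (a - g) (a - g) + (bform W g g + bform S (g - c) (g - c) + bform D (a - g) (a - g))"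
proof -
  define d where "d = a - g"
  have d: "d \<in> carrier_vec N" using a g by (auto simp: d_def)
  have ad: "a = d + g" using a g by (intro eq_vecI) (auto simp: d_def)
  have s: "transpose_mat (W + S + D) = W + S + D"
    using W S D by (simp add: transpose_add[of _ N N])
  have "bform (W + S + D) d g = d \<bullet> (S *\<^sub>v c + D *\<^sub>v a)" by (simp add: bform_def eq)
  also have "\<dots> = bform S d c + bform D d a"
    using S D a c d by (simp add: bform_def scalar_prod_add_distrib[of _ N])
  finally have e: "bform (W + S + D) d g = bform S d c + bform D d a" .
  have e1: "bform (W + S + D) v w = bform W v w + bform S v w + bform D v w"
    if "v \<in> carrier_vec N" "w \<in> carrier_vec N" for v w
    using that W S D by (simp add: bform_add_mat)
  have e2: "bform D d a = bform D d d + bform D d g"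
    unfolding ad using D d g by (intro bform_add_right) auto
  have e3: "bform W a a = bform W d d + 2 * bform W d g + bform W g g"
    unfolding ad by (rule bform_add_quadratic[OF W(2,1) d g])
  have ac: "a - c = d + (g - c)" using a g c by (intro eq_vecI) (auto simp: d_def)
  have gc: "g - c \<in> carrier_vec N" using g c by auto
  have e4: "bform S (a - c) (a - c) = bform S d d + 2 * bform S d (g - c) + bform S (g - c) (g - c)"
    unfolding ac by (rule bform_add_quadratic[OF S(2,1) d gc])
  have e5: "bform S d (g - c) = bform S d g - bform S d c"
    using S d g c by (intro bform_diff_right) auto
  show ?thesis
    unfolding d_def[symmetric]
    using e e1[OF d g] e1[OF d d] e2 e3 e4 e5 by linarith
qed

text \<open>The reset state \<open>P\<^sup>-\<^sup>1 (r, 0)\<close> minimises the form of \<open>P\<close> among all states with the given first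
  component, since \<open>P\<close> maps it to \<open>(r, 0)\<close>.\<close>

lemma reset_form:
  assumes P: "P \<in> carrier_mat (n + p) (n + p)" "transpose_mat P = P"
    and X: "X \<in> carrier_mat (n + p) (n + p)"
    and \<Gamma>: "\<Gamma> \<in> carrier_mat (n + p) n"
    and R: "R \<in> carrier_mat n n"
    and PG: "\<And>x. x \<in> carrier_vec n \<Longrightarrow> P *\<^sub>v (\<Gamma> *\<^sub>v x) = (R *\<^sub>v x) @\<^sub>v 0\<^sub>v p"
    and pG: "\<And>x. x \<in> carrier_vec n \<Longrightarrow> proj_first n p *\<^sub>v (\<Gamma> *\<^sub>v x) = x"
    and x: "x \<in> carrier_vec n" and h: "h \<in> carrier_vec n"
  defines "a \<equiv> x @\<^sub>v (proj_last n p *\<^sub>v (\<Gamma> *\<^sub>v h))"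
  shows "bform P a a + bform (X - P) (a - \<Gamma> *\<^sub>v h) (a - \<Gamma> *\<^sub>v h) =
    bform R x x + (bform (upper_left_block n X) (x - h) (x - h) - bform R (x - h) (x - h))"
proof -
  have Gv: "\<Gamma> *\<^sub>v v \<in> carrier_vec (n + p)" if "v \<in> carrier_vec n" for v using \<Gamma> that by auto
  have split: "\<Gamma> *\<^sub>v v = v @\<^sub>v (proj_last n p *\<^sub>v (\<Gamma> *\<^sub>v v))" if v: "v \<in> carrier_vec n" for v
  proof -
    obtain y z where yz: "y \<in> carrier_vec n" "z \<in> carrier_vec p" "\<Gamma> *\<^sub>v v = y @\<^sub>v z"
      using append_vecE[OF Gv[OF v]] by blast
    then show ?thesis using proj_append[OF yz(1,2)] pG[OF v] by simp
  qed
  have lastv: "proj_last n p *\<^sub>v (\<Gamma> *\<^sub>v v) \<in> carrier_vec p" if "v \<in> carrier_vec n" for v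
    using Gv[OF that] by (auto intro: mult_mat_vec_carrier[OF proj_carrier(2)])
  define d where "d = x - h"
  have d: "d \<in> carrier_vec n" using x h by (auto simp: d_def)
  define d0 where "d0 = d @\<^sub>v 0\<^sub>v p"
  have d0: "d0 \<in> carrier_vec (n + p)" using d by (auto simp: d0_def)
  have a: "a \<in> carrier_vec (n + p)" using x lastv[OF h] by (auto simp: a_def)
  \<comment> \<open>The plant control is reset to the control component of the new controller state,
    so only the error \<open>x - h\<close> in the first component survives.\<close>
  have aG: "a - \<Gamma> *\<^sub>v h = d0"
    unfolding a_def d0_def d_def using split[OF h] append_vec_diff[OF x h lastv[OF h] lastv[OF h]] lastv[OF h]
    by simp
  have ah: "a = \<Gamma> *\<^sub>v h + d0"
    unfolding aG[symmetric] using a Gv[OF h] \<Gamma> by (intro eq_vecI) auto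
  \<comment> \<open>\<open>P\<close> sends reset states to vectors with vanishing second component,
    so the form against them only depends on the first component of \<open>v\<close>.\<close>
  have PGf: "bform P v (\<Gamma> *\<^sub>v w) = (proj_first n p *\<^sub>v v) \<bullet> (R *\<^sub>v w)"
    if v: "v \<in> carrier_vec (n + p)" and w: "w \<in> carrier_vec n" for v w
  proof -
    obtain y z where yz: "y \<in> carrier_vec n" "z \<in> carrier_vec p" "v = y @\<^sub>v z"
      using append_vecE[OF v] by blast
    have "bform P v (\<Gamma> *\<^sub>v w) = (y @\<^sub>v z) \<bullet> ((R *\<^sub>v w) @\<^sub>v 0\<^sub>v p)" using PG[OF w] yz by (simp add: bform_def)
    also have "\<dots> = y \<bullet> (R *\<^sub>v w) + z \<bullet> 0\<^sub>v p"
      by (rule scalar_prod_append[of _ n _ p]) (use yz R w in auto)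
    finally show ?thesis using yz proj_append[OF yz(1,2)] by simp
  qed
  have "bform P a a = bform P (\<Gamma> *\<^sub>v h) (\<Gamma> *\<^sub>v h) + 2 * bform P (\<Gamma> *\<^sub>v h) d0 + bform P d0 d0"
    unfolding ah by (rule bform_add_quadratic[OF P(2,1) Gv[OF h] d0])
  moreover have "bform P (\<Gamma> *\<^sub>v h) d0 = bform P d0 (\<Gamma> *\<^sub>v h)"
    using P Gv[OF h] d0 \<Gamma> by (intro bform_commute) auto
  moreover have "bform P d0 (\<Gamma> *\<^sub>v h) = bform R d h"
    using PGf[OF d0 h] proj_append(1)[OF d, of "0\<^sub>v p" p] by (simp add: d0_def bform_def)
  moreover have "bform P (\<Gamma> *\<^sub>v h) (\<Gamma> *\<^sub>v h) = bform R h h"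
    using PGf[OF Gv[OF h] h] pG[OF h] by (simp add: bform_def)
  moreover have "bform (X - P) d0 d0 = bform X d0 d0 - bform P d0 d0"
    using X P d0 by (intro bform_minus_mat) auto
  moreover have "bform X d0 d0 = bform (upper_left_block n X) d d"
    unfolding d0_def by (rule bform_upper_left_block[OF X d d, symmetric])
  moreover have "bform R x x = bform R h h + bform R h d + (bform R d h + bform R d d)"
  proof -
    have "x = h + d" using x h by (intro eq_vecI) (auto simp: d_def)
    then show ?thesis using R h d by (simp add: bform_add_left bform_add_right)
  qed
  moreover have "bform R h d = bform R d h"
  proof -
    have "bform R h d = bform P (\<Gamma> *\<^sub>v h) (\<Gamma> *\<^sub>v d)"
      using PGf[OF Gv[OF h] d] pG[OF h] by (simp add: bform_def)
    also have "\<dots> = bform P (\<Gamma> *\<^sub>v d) (\<Gamma> *\<^sub>v h)"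
      using P Gv h d \<Gamma> by (intro bform_commute) auto
    also have "\<dots> = bform R d h"
      using PGf[OF Gv[OF d] h] pG[OF d] by (simp add: bform_def)
    finally show ?thesis .
  qed
  ultimately show ?thesis unfolding aG d_def[symmetric] by linarith
qed

text \<open>Completing the square with \<open>w = (R x, 0)\<close>.\<close>

lemma state_feedback_jump:
  assumes P: "P \<in> carrier_mat (n + p) (n + p)" "pos_def P"
    and Y1: "Y1 \<in> carrier_mat n n" "pos_def Y1"
    and less: "\<And>r. r \<in> carrier_vec n \<Longrightarrow> r \<noteq> 0\<^sub>v n \<Longrightarrow>
      bform (inv_mat P) (r @\<^sub>v 0\<^sub>v p) (r @\<^sub>v 0\<^sub>v p) < bform Y1 r r"
    and x: "x \<in> carrier_vec n" and u: "u \<in> carrier_vec p" and nz: "x \<noteq> 0\<^sub>v n \<or> u \<noteq> 0\<^sub>v p"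
  shows "bform (inv_mat Y1) x x < bform P (x @\<^sub>v u) (x @\<^sub>v u)"
proof -
  define r where "r = inv_mat Y1 *\<^sub>v x"
  have r: "r \<in> carrier_vec n" using inv_mat_carrier[OF Y1(2,1)] x by (auto simp: r_def)
  define w where "w = r @\<^sub>v 0\<^sub>v p"
  have w: "w \<in> carrier_vec (n + p)" using r by (auto simp: w_def)
  define a where "a = x @\<^sub>v u"
  have a: "a \<in> carrier_vec (n + p)" "a \<noteq> 0\<^sub>v (n + p)"
    using x u nz by (auto simp: a_def append_vec_eq_zero_iff)
  define y where "y = inv_mat P *\<^sub>v w"
  have y: "y \<in> carrier_vec (n + p)" using inv_mat_carrier[OF P(2,1)] w by (auto simp: y_def)
  have Py: "P *\<^sub>v y = w" unfolding y_def by (rule inv_mat_cancel(1)[OF P(2,1) w])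
  have "a \<bullet> w = x \<bullet> r + u \<bullet> 0\<^sub>v p"
    unfolding a_def w_def by (rule scalar_prod_append[of _ n _ p]) (use x u r in auto)
  then have 1: "bform P a y = bform (inv_mat Y1) x x"
    using u by (simp add: bform_def Py r_def)
  have 2: "bform P y y = bform (inv_mat P) w w"
    unfolding y_def by (rule bform_inv_mat[OF P(2,1) w w, symmetric])
  have 3: "bform Y1 r r = bform (inv_mat Y1) x x"
    unfolding r_def by (rule bform_inv_mat[OF Y1(2,1) x x, symmetric])
  have "bform P (a - y) (a - y) = bform P a a - 2 * bform P a y + bform P y y"
    by (rule bform_diff_quadratic[OF pos_def_symmetric[OF P(2)] P(1) a(1) y])
  moreover have "bform P (a - y) (a - y) \<ge> 0"
    using a y by (intro pos_def_bform_nonneg[OF P(2,1)]) auto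
  ultimately have ge: "bform P a a \<ge> 2 * bform (inv_mat Y1) x x - bform (inv_mat P) w w" using 1 2 by linarith
  \<comment> \<open>For \<open>x\<close> nonzero the bound \<open>less\<close> on
    \<open>bform (inv_mat P) w w\<close> makes the inequality strict. For \<open>x\<close> zero also
    \<open>w\<close> is zero, and definiteness of \<open>P\<close> at \<open>(0, u)\<close> is used
    instead.\<close>
  show ?thesis
  proof (cases "x = 0\<^sub>v n")
    case False
    have "Y1 *\<^sub>v r = x" unfolding r_def by (rule inv_mat_cancel(1)[OF Y1(2,1) x])
    then have "r \<noteq> 0\<^sub>v n" using False mult_mat_zero_vec[OF Y1(1)] by auto
    then show ?thesis using less[OF r] ge 3 by (simp add: w_def a_def)
  next
    case True
    then have "bform (inv_mat Y1) x x = 0"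
      using bform_zero_left[of "inv_mat Y1" x] inv_mat_carrier[OF Y1(2,1)] by simp
    then show ?thesis using pos_def_bform[OF P(2,1) a] by (simp add: a_def)
  qed
qed

text \<open>The controller has the order of the plant because \<open>a - c\<close> must be a full
  estimation error. The Lyapunov decrease at an impulse is a sum of four nonnegative terms that
  vanish together only at the origin.\<close>

lemma reduced_forms_sufficient:
  fixes n p :: nat and A B CJ :: "real mat"
  defines "N \<equiv> n + p" and "Ahat \<equiv> four_block_mat A B (0\<^sub>m p n) (0\<^sub>m p p)"
    and "G \<equiv> \<lambda>m q qJ. sampled_data_system n p m q qJ A B CJ"
  assumes T: "0 < Tmin" "Tmin < Tmax"
    and A: "A \<in> carrier_mat n n" and B: "B \<in> carrier_mat n p" and C: "CJ \<in> carrier_mat qJ n"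
    and XC1: "C1_symmetric_on {0..Tmax} N X" and YC1: "C1_symmetric_on {0..Tmax} N Y"
    and forms: "reduced_forms Tmin Tmax n p Ahat CJ X Y"
  shows "\<exists>K. is_clock_controller Tmin Tmax m q p qJ N K \<and>
    stability_LMIs_feasible Tmin Tmax (N + N) (closed_loop_flow (G m q qJ) K) (closed_loop_jump (G m q qJ) K)"
proof -
  define S where "S = {0..Tmax}"
  define J where "J = {Tmin..Tmax}"
  have T': "0 < Tmax" using T by simp
  have zS: "0 \<in> S" and JS: "J \<subseteq> S" and sub: "\<tau> \<in> J \<Longrightarrow> \<tau> \<in> S" for \<tau> using T by (auto simp: S_def J_def)
  have Ah: "Ahat \<in> carrier_mat N N" unfolding Ahat_def N_def using A by auto
  have dC: "dim_row CJ = qJ" using C by auto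
  have coupling: "bform (Y \<tau>) a a + 2 * (a \<bullet> b) + bform (X \<tau>) b b > 0"
    if "\<tau> \<in> S" "a \<in> carrier_vec N" "b \<in> carrier_vec N" "a \<noteq> 0\<^sub>v N \<or> b \<noteq> 0\<^sub>v N" for \<tau> a b
    using forms that unfolding reduced_forms_def N_def S_def by blast
  have primal: "bform (mat_deriv S X \<tau>) v v + 2 * bform (X \<tau>) v (Ahat *\<^sub>v v) < 0"
    if "\<tau> \<in> S" "v \<in> carrier_vec N" "v \<noteq> 0\<^sub>v N" for \<tau> v
    using forms that unfolding reduced_forms_def N_def S_def by blast
  have dual: "bform (mat_deriv S Y \<tau>) v v - 2 * bform (Y \<tau>) v (transpose_mat Ahat *\<^sub>v v) > 0"
    if "\<tau> \<in> S" "v \<in> carrier_vec N" "v \<noteq> 0\<^sub>v N" for \<tau> v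
    using forms that unfolding reduced_forms_def N_def S_def by blast
  have primal_jump: "bform (upper_left_block n (X 0)) x x < bform (X \<tau>) (x @\<^sub>v u) (x @\<^sub>v u)"
    if "\<tau> \<in> J" "x \<in> carrier_vec n" "u \<in> carrier_vec p" "CJ *\<^sub>v x = 0\<^sub>v qJ" "x \<noteq> 0\<^sub>v n \<or> u \<noteq> 0\<^sub>v p" for \<tau> x u
    using forms that dC unfolding reduced_forms_def J_def by blast
  have dual_jump: "bform (upper_left_block n (Y \<tau>)) x x < bform (upper_left_block n (Y 0)) x x"
    if "\<tau> \<in> J" "x \<in> carrier_vec n" "x \<noteq> 0\<^sub>v n" for \<tau> x
    using forms that unfolding reduced_forms_def J_def by blast
  define X' where "X' = mat_deriv S X"
  define Y' where "Y' = mat_deriv S Y"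
  note XC = XC1[folded S_def] and YC = YC1[folded S_def]
  note Xc = C1_symmetric_onD(1)[OF XC] and Xs = C1_symmetric_onD(2)[OF XC]
  note Xd = C1_symmetric_onD(3)[OF XC, folded X'_def] and X'cont = C1_symmetric_onD(4)[OF XC, folded X'_def]
  note X'c = has_mat_derivative_onD(2)[OF Xd] and X's = mat_deriv_symmetric[OF XC, folded X'_def]
  note Yc = C1_symmetric_onD(1)[OF YC] and Ys = C1_symmetric_onD(2)[OF YC]
  note Yd = C1_symmetric_onD(3)[OF YC, folded Y'_def] and Y'cont = C1_symmetric_onD(4)[OF YC, folded Y'_def]
  note Y'c = has_mat_derivative_onD(2)[OF Yd] and Y's = mat_deriv_symmetric[OF YC, folded Y'_def]

  \<comment> \<open>The storage function and its definiteness\<close>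
  have Ypd: "pos_def (Y \<tau>)" if t: "\<tau> \<in> S" for \<tau>
  proof (rule pos_defI[OF Yc[OF t] Ys[OF t]])
    fix v :: "real vec" assume v: "v \<in> carrier_vec N" "v \<noteq> 0\<^sub>v N"
    have "bform (X \<tau>) (0\<^sub>v N) (0\<^sub>v N) = 0" using bform_zero_left[of "X \<tau>"] Xc[OF t] by simp
    then show "bform (Y \<tau>) v v > 0" using coupling[OF t v(1), of "0\<^sub>v N"] v by simp
  qed
  define P where "P \<tau> = inv_mat (Y \<tau>)" for \<tau>
  define P' where "P' \<tau> = - (inv_mat (Y \<tau>) * Y' \<tau> * inv_mat (Y \<tau>))" for \<tau>
  have Pd: "has_mat_derivative_on S N N P P'"
    unfolding P_def[abs_def] P'_def[abs_def] by (rule has_mat_derivative_on_inv_mat[OF Yd Ypd])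
  note Pcont = has_mat_derivative_on_continuous[OF Pd]
  have P'cont: "continuous_mat_on S N N P'"
    unfolding P'_def[abs_def] using Pcont[unfolded P_def[abs_def]] Y'cont
    by (intro continuous_mat_on_uminus continuous_mat_on_mult)
  note Pc = has_mat_derivative_onD(1)[OF Pd] and P'c = has_mat_derivative_onD(2)[OF Pd]
  have Ps: "transpose_mat (P \<tau>) = P \<tau>" if "\<tau> \<in> S" for \<tau>
    unfolding P_def by (rule inv_mat_symmetric[OF Ypd[OF that] Yc[OF that]])
  have Ppd: "pos_def (P \<tau>)" if "\<tau> \<in> S" for \<tau>
    unfolding P_def by (rule inv_mat_pos_def[OF Ypd[OF that] Yc[OF that]])
  have PC: "C1_symmetric_on S N P"
    unfolding S_def by (rule C1_symmetric_onI[OF T' Pd[unfolded S_def] P'cont[unfolded S_def]]) (use Ps S_def in simp)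
  have P's: "transpose_mat (P' \<tau>) = P' \<tau>" if "\<tau> \<in> S" for \<tau>
    using mat_deriv_symmetric[OF PC that] mat_deriv_eq[OF T' Pd[unfolded S_def]] that by (simp add: S_def)
  have YP: "Y \<tau> *\<^sub>v (P \<tau> *\<^sub>v v) = v" "P \<tau> *\<^sub>v (Y \<tau> *\<^sub>v v) = v" if "\<tau> \<in> S" "v \<in> carrier_vec N" for \<tau> v
    unfolding P_def by (rule inv_mat_cancel[OF Ypd[OF that(1)] Yc[OF that(1)] that(2)])+
  \<comment> \<open>This is the matrix called \<open>S\<close> in the overview; here
    \<open>S\<close> is the clock interval.\<close>
  define W where "W \<tau> = X \<tau> - P \<tau>" for \<tau>
  have Wc: "W \<tau> \<in> carrier_mat N N" if "\<tau> \<in> S" for \<tau> unfolding W_def by (rule minus_carrier_mat[OF Pc[OF that]])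
  have Ws: "transpose_mat (W \<tau>) = W \<tau>" if "\<tau> \<in> S" for \<tau>
    unfolding W_def by (simp add: transpose_minus[OF Xc[OF that] Pc[OF that]] Xs[OF that] Ps[OF that])
  have Wcont: "continuous_mat_on S N N W"
    unfolding W_def[abs_def] by (rule continuous_mat_on_minus[OF has_mat_derivative_on_continuous[OF Xd] Pcont])
  have Wpd: "pos_def (W \<tau>)" if t: "\<tau> \<in> S" for \<tau>
  proof (rule pos_defI[OF Wc[OF t] Ws[OF t]])
    fix v :: "real vec" assume v: "v \<in> carrier_vec N" "v \<noteq> 0\<^sub>v N"
    \<comment> \<open>A Schur complement: for fixed \<open>b = v\<close> the coupling form is
      minimal at \<open>a = - z\<close>, and its minimum is the form of \<open>X - P\<close> at
      \<open>v\<close>.\<close>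
    define z where "z = P \<tau> *\<^sub>v v"
    have z: "z \<in> carrier_vec N" using Pc[OF t] v by (auto simp: z_def)
    have "(- z) \<bullet> v = - (z \<bullet> v)" using z v by (simp add: scalar_prod_def sum_negf)
    moreover have "z \<bullet> v = bform (P \<tau>) v v"
      using z v by (simp add: bform_def scalar_prod_commute[of v] z_def[symmetric])
    moreover have "bform (Y \<tau>) (- z) (- z) = bform (P \<tau>) v v"
    proof -
      have "bform (Y \<tau>) (- z) (- z) = bform (Y \<tau>) (-1 \<cdot>\<^sub>v z) (-1 \<cdot>\<^sub>v z)"
        by (rule arg_cong2[where f = "bform (Y \<tau>)"]) (intro eq_vecI; simp)+
      also have "\<dots> = bform (Y \<tau>) z z" using bform_smult_vec[of z "Y \<tau>" z "-1" "-1"] z Yc[OF t] by simp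
      also have "\<dots> = bform (P \<tau>) v v"
        unfolding P_def z_def by (rule bform_inv_mat[OF Ypd[OF t] Yc[OF t] v(1) v(1), symmetric])
      finally show ?thesis .
    qed
    moreover have "bform (Y \<tau>) (- z) (- z) + 2 * ((- z) \<bullet> v) + bform (X \<tau>) v v > 0"
      by (rule coupling[OF t]) (use z v in auto)
    moreover have "bform (W \<tau>) v v = bform (X \<tau>) v v - bform (P \<tau>) v v"
      unfolding W_def using Xc[OF t] Pc[OF t] v by (intro bform_minus_mat) auto
    ultimately show "bform (W \<tau>) v v > 0" by linarith
  qed
  define XX where "XX \<tau> = storage (X \<tau>) (P \<tau>)" for \<tau>
  define XX' where "XX' \<tau> = storage (X' \<tau>) (P' \<tau>)" for \<tau>
  have XXc: "XX \<tau> \<in> carrier_mat (N + N) (N + N)" if "\<tau> \<in> S" for \<tau>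
    unfolding XX_def by (rule storage_carrier[OF Xc[OF that] Pc[OF that]])
  have XXs: "transpose_mat (XX \<tau>) = XX \<tau>" if "\<tau> \<in> S" for \<tau>
    unfolding XX_def by (rule storage_symmetric[OF Xc[OF that] Pc[OF that] Xs[OF that] Ps[OF that]])
  have XX'c: "XX' \<tau> \<in> carrier_mat (N + N) (N + N)" if "\<tau> \<in> S" for \<tau>
    unfolding XX'_def by (rule storage_carrier[OF X'c[OF that] P'c[OF that]])
  have XX's: "transpose_mat (XX' \<tau>) = XX' \<tau>" if "\<tau> \<in> S" for \<tau>
    unfolding XX'_def by (rule storage_symmetric[OF X'c[OF that] P'c[OF that] X's[OF that] P's[OF that]])
  have XXd: "has_mat_derivative_on S (N + N) (N + N) XX XX'"
    unfolding XX_def[abs_def] XX'_def[abs_def] storage_def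
    by (intro has_mat_derivative_on_four_block has_mat_derivative_on_minus Xd Pd)
  have XX'cont: "continuous_mat_on S (N + N) (N + N) XX'"
    unfolding XX'_def[abs_def] storage_def
    by (intro continuous_mat_on_four_block continuous_mat_on_minus X'cont P'cont)
  have XXC: "C1_symmetric_on S (N + N) XX"
    unfolding S_def by (rule C1_symmetric_onI[OF T' XXd[unfolded S_def] XX'cont[unfolded S_def]]) (use XXs S_def in simp)
  have XXderiv: "mat_deriv S XX \<tau> = XX' \<tau>" if "\<tau> \<in> S" for \<tau>
    using mat_deriv_eq[OF T' XXd[unfolded S_def]] that by (simp add: S_def)
  have XXf: "bform (XX \<tau>) (a @\<^sub>v c) (a @\<^sub>v c) = bform (P \<tau>) a a + bform (W \<tau>) (a - c) (a - c)"
    if "\<tau> \<in> S" "a \<in> carrier_vec N" "c \<in> carrier_vec N" for \<tau> a c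
    unfolding XX_def W_def using bform_storage[OF Xc[OF that(1)] Pc[OF that(1)] that(2,3) that(2,3)] .
  have XXpd: "pos_def (XX \<tau>)" if t: "\<tau> \<in> S" for \<tau>
  proof (rule pos_defI[OF XXc[OF t] XXs[OF t]])
    fix v :: "real vec" assume v: "v \<in> carrier_vec (N + N)" "v \<noteq> 0\<^sub>v (N + N)"
    obtain a c where ac: "a \<in> carrier_vec N" "c \<in> carrier_vec N" "v = a @\<^sub>v c" using append_vecE[OF v(1)] by blast
    have amc: "a - c \<in> carrier_vec N" using ac by auto
    have ge: "bform (P \<tau>) a a \<ge> 0" "bform (W \<tau>) (a - c) (a - c) \<ge> 0"
      by (rule pos_def_bform_nonneg[OF Ppd[OF t] Pc[OF t] ac(1)], rule pos_def_bform_nonneg[OF Wpd[OF t] Wc[OF t] amc])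
    have "a \<noteq> 0\<^sub>v N \<or> a - c \<noteq> 0\<^sub>v N"
      using v ac append_vec_eq_zero_iff[OF ac(1,2)] vec_diff_zero_iff[OF ac(1,2)] by metis
    then have "bform (P \<tau>) a a > 0 \<or> bform (W \<tau>) (a - c) (a - c) > 0"
      using pos_def_bform[OF Ppd[OF t] Pc[OF t] ac(1)] pos_def_bform[OF Wpd[OF t] Wc[OF t] amc] by blast
    then show "bform (XX \<tau>) v v > 0" using ge XXf[OF t ac(1,2)] ac(3) by auto
  qed

  \<comment> \<open>Controller dynamics during flow\<close>
  define L where "L \<tau> = P' \<tau> + transpose_mat Ahat * P \<tau> + P \<tau> * Ahat" for \<tau>
  define Ac where "Ac \<tau> = Ahat + inv_mat (W \<tau>) * L \<tau>" for \<tau>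
  note Le = lyapunov_expression[OF Ah Pc Ps P'c P's]
  have Lcont: "continuous_mat_on S N N L"
    unfolding L_def[abs_def] using Pcont P'cont Ah
    by (intro continuous_mat_on_add continuous_mat_on_mult continuous_mat_on_const) auto
  have Accont: "continuous_mat_on S N N Ac"
    unfolding Ac_def[abs_def]
    by (intro continuous_mat_on_add continuous_mat_on_const Ah
        continuous_mat_on_mult[OF continuous_mat_on_inv_mat[OF Wcont Wpd] Lcont])
  have Lneg: "bform (L \<tau>) v v < 0" if t: "\<tau> \<in> S" and v: "v \<in> carrier_vec N" "v \<noteq> 0\<^sub>v N" for \<tau> v
  proof -
    define z where "z = P \<tau> *\<^sub>v v"
    have z: "z \<in> carrier_vec N" using Pc[OF t] v by (auto simp: z_def)
    have z0: "z \<noteq> 0\<^sub>v N" using YP(1)[OF t v(1)] v(2) mult_mat_zero_vec[OF Yc[OF t]] by (auto simp: z_def)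
    have At: "- transpose_mat Ahat \<in> carrier_mat N N" using Ah by auto
    have Att: "transpose_mat (- transpose_mat Ahat) = - Ahat" by (intro eq_matI) auto
    \<comment> \<open>The dual inequality for \<open>Y\<close> is a Lyapunov inequality for
      \<open>- transpose_mat Ahat\<close> with the opposite sign. Passing to the inverse transposes
      and negates the matrix once more, which leaves the Lyapunov inequality for \<open>P\<close>
      and \<open>Ahat\<close>.\<close>
    have e: "bform (P' \<tau>) v v - 2 * bform (P \<tau>) v (- Ahat *\<^sub>v v) =
        - (bform (Y' \<tau>) z z + 2 * bform (Y \<tau>) z (- transpose_mat Ahat *\<^sub>v z))"
      using dual_flow_form_inv_mat[OF At Yc[OF t] Ypd[OF t] Y'c[OF t] v(1)]
      unfolding Att P_def P'_def z_def .
    have "bform (P \<tau>) v (- Ahat *\<^sub>v v) = - bform (P \<tau>) v (Ahat *\<^sub>v v)"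
      using Ah v Pc[OF t] by (subst uminus_mult_mat_vec, simp, intro bform_uminus_right) auto
    moreover have "bform (Y \<tau>) z (- transpose_mat Ahat *\<^sub>v z) = - bform (Y \<tau>) z (transpose_mat Ahat *\<^sub>v z)"
      using Ah z Yc[OF t] by (subst uminus_mult_mat_vec, simp, intro bform_uminus_right) auto
    moreover have "bform (L \<tau>) v v = bform (P' \<tau>) v v + 2 * bform (P \<tau>) v (Ahat *\<^sub>v v)"
      unfolding L_def by (rule Le(3)[OF t t t t v(1)])
    ultimately show ?thesis using e dual[OF t z z0] unfolding Y'_def[symmetric] by linarith
  qed

  \<comment> \<open>The reset of the control\<close>
  define E where "E = proj_first n p"
  have E: "E \<in> carrier_mat n N" by (simp add: E_def N_def)
  have Ev: "E *\<^sub>v v \<in> carrier_vec n" if "v \<in> carrier_vec N" for v using E that by auto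
  define Y1 where "Y1 \<tau> = upper_left_block n (Y \<tau>)" for \<tau>
  have Y1c: "Y1 \<tau> \<in> carrier_mat n n" for \<tau> unfolding Y1_def by (rule upper_left_block_carrier)
  have Y1pd: "pos_def (Y1 0)"
    unfolding Y1_def by (rule upper_left_block_pos_def[OF Yc[OF zS, unfolded N_def] Ypd[OF zS]])
  \<comment> \<open>\<open>bform R x x\<close> is the minimum of the form of \<open>P 0\<close> over
    all states with first component \<open>x\<close>: the Schur complement of a block of
    \<open>P 0\<close> is the inverse of the corresponding block of \<open>Y 0\<close>.\<close>
  define R where "R = inv_mat (Y1 0)"
  have R: "R \<in> carrier_mat n n" unfolding R_def by (rule inv_mat_carrier[OF Y1pd Y1c])
  have Rs: "transpose_mat R = R" unfolding R_def by (rule inv_mat_symmetric[OF Y1pd Y1c])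
  \<comment> \<open>The minimiser as a linear map: \<open>\<Gamma>\<close> sends \<open>x\<close> to
    \<open>Y 0\<close> applied to \<open>(R x, 0)\<close>, whose first component is
    \<open>Y1 0\<close> applied to \<open>R x\<close>, that is \<open>x\<close>.\<close>
  define \<Gamma> where "\<Gamma> = Y 0 * (transpose_mat E * R)"
  have EtR: "transpose_mat E * R \<in> carrier_mat N n" using E R by (intro mult_carrier_mat[of _ N n]) auto
  have \<Gamma>: "\<Gamma> \<in> carrier_mat N n" unfolding \<Gamma>_def by (rule mult_carrier_mat[OF Yc[OF zS] EtR])
  have \<Gamma>v: "\<Gamma> *\<^sub>v x = Y 0 *\<^sub>v ((R *\<^sub>v x) @\<^sub>v 0\<^sub>v p)" if x: "x \<in> carrier_vec n" for x
  proof -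
    have Rx: "R *\<^sub>v x \<in> carrier_vec n" using R x by auto
    have "\<Gamma> *\<^sub>v x = Y 0 *\<^sub>v ((transpose_mat E * R) *\<^sub>v x)"
      unfolding \<Gamma>_def by (rule assoc_mult_mat_vec[OF Yc[OF zS] EtR x])
    also have "(transpose_mat E * R) *\<^sub>v x = transpose_mat E *\<^sub>v (R *\<^sub>v x)"
      using E R x by (intro assoc_mult_mat_vec[of _ N n]) auto
    also have "\<dots> = (R *\<^sub>v x) @\<^sub>v 0\<^sub>v p"
      unfolding E_def by (rule proj_first_transpose[OF Rx])
    finally show ?thesis .
  qed
  have P\<Gamma>: "P 0 *\<^sub>v (\<Gamma> *\<^sub>v x) = (R *\<^sub>v x) @\<^sub>v 0\<^sub>v p" if x: "x \<in> carrier_vec n" for x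
    unfolding \<Gamma>v[OF x] by (rule YP(2)[OF zS]) (use R x in \<open>auto simp: N_def\<close>)
  have E\<Gamma>: "proj_first n p *\<^sub>v (\<Gamma> *\<^sub>v x) = x" if x: "x \<in> carrier_vec n" for x
  proof -
    have Rx: "R *\<^sub>v x \<in> carrier_vec n" using R x by auto
    have "proj_first n p *\<^sub>v (\<Gamma> *\<^sub>v x) = Y1 0 *\<^sub>v (R *\<^sub>v x)"
      unfolding \<Gamma>v[OF x] Y1_def by (rule upper_left_block_eq_proj[OF Yc[OF zS, unfolded N_def] Rx, symmetric])
    also have "\<dots> = x" unfolding R_def by (rule inv_mat_cancel(1)[OF Y1pd Y1c x])
    finally show ?thesis .
  qed

  \<comment> \<open>The weight of the measurement\<close>
  define X1 where "X1 = upper_left_block n (X 0)"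
  have X1: "X1 \<in> carrier_mat n n" unfolding X1_def by (rule upper_left_block_carrier)
  define H where "H = CJ * E"
  have H: "H \<in> carrier_mat qJ N" unfolding H_def by (rule mult_carrier_mat[OF C E])
  have Hv: "H *\<^sub>v v = CJ *\<^sub>v (E *\<^sub>v v)" if "v \<in> carrier_vec N" for v
    unfolding H_def by (rule assoc_mult_mat_vec[OF C E that])
  have HtH: "transpose_mat H * H \<in> carrier_mat N N" using H by (intro mult_carrier_mat[of _ N qJ]) auto
  have HtHf: "bform (transpose_mat H * H) v w = (H *\<^sub>v v) \<bullet> (H *\<^sub>v w)"
    if "v \<in> carrier_vec N" "w \<in> carrier_vec N" for v w
    using that H by (subst bform_mult_left) (auto simp: bform_def)
  have EXE: "transpose_mat E * X1 * E \<in> carrier_mat N N" by (rule congruence_carrier[OF E])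
  have Qf: "bform (X \<tau> - transpose_mat E * X1 * E) v v = bform (X \<tau>) v v - bform X1 (E *\<^sub>v v) (E *\<^sub>v v)"
    if "\<tau> \<in> S" "v \<in> carrier_vec N" for \<tau> v
  proof -
    have "bform (X \<tau> - transpose_mat E * X1 * E) v v = bform (X \<tau>) v v - bform (transpose_mat E * X1 * E) v v"
      using carrier_matD[OF EXE] carrier_matD[OF Xc[OF that(1)]] carrier_vecD[OF that(2)]
      by (intro bform_minus_mat) (simp_all only:)
    then show ?thesis by (simp only: bform_congruence[OF X1 E that(2) that(2)])
  qed
  \<comment> \<open>\<open>H\<close> reads the measurement off the full state, and on its kernel
    this form of \<open>X \<tau>\<close> is the slack in the primal jump inequality. Outside the
    kernel the weighted measurement makes up for a possible deficit.\<close>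
  have "\<exists>\<mu>>0. \<forall>\<tau>\<in>J. \<forall>v\<in>carrier_vec N. v \<noteq> 0\<^sub>v N \<longrightarrow>
      bform (X \<tau> - transpose_mat E * X1 * E) v v + \<mu> * bform (transpose_mat H * H) v v > 0"
  proof (rule uniform_finsler[OF _ _ continuous_mat_on_const[OF HtH]])
    show "compact J" by (simp add: J_def)
    show "continuous_mat_on J N N (\<lambda>\<tau>. X \<tau> - transpose_mat E * X1 * E)"
      by (rule continuous_mat_on_minus[OF continuous_mat_on_subset[OF has_mat_derivative_on_continuous[OF Xd] JS]
            continuous_mat_on_const[OF EXE]])
    show "bform (transpose_mat H * H) v v \<ge> 0" if "v \<in> carrier_vec N" for v
      unfolding HtHf[OF that that] by (rule scalar_prod_self_nonneg)
    fix \<tau> v assume t: "\<tau> \<in> J" and v: "v \<in> carrier_vec N" "v \<noteq> 0\<^sub>v N" and z: "bform (transpose_mat H * H) v v = 0"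
    have "H *\<^sub>v v = 0\<^sub>v qJ"
    proof (rule ccontr)
      assume "H *\<^sub>v v \<noteq> 0\<^sub>v qJ"
      then have "(H *\<^sub>v v) \<bullet> (H *\<^sub>v v) > 0" using H v by (intro scalar_prod_self_pos[of _ qJ]) auto
      then show False using z HtHf[OF v(1) v(1)] by simp
    qed
    obtain x u where xu: "x \<in> carrier_vec n" "u \<in> carrier_vec p" "v = x @\<^sub>v u"
      using append_vecE[of v n p] v(1) by (auto simp: N_def)
    have Ex: "E *\<^sub>v v = x" unfolding E_def xu(3) by (rule proj_append(1)[OF xu(1,2)])
    have "CJ *\<^sub>v x = 0\<^sub>v qJ" using \<open>H *\<^sub>v v = 0\<^sub>v qJ\<close> Hv[OF v(1)] Ex by simp
    moreover have "x \<noteq> 0\<^sub>v n \<or> u \<noteq> 0\<^sub>v p" using v(2) append_vec_eq_zero_iff[OF xu(1,2)] by (simp add: xu(3) N_def)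
    ultimately show "bform (X \<tau> - transpose_mat E * X1 * E) v v > 0"
      unfolding Qf[OF sub[OF t] v(1)] Ex using primal_jump[OF t xu(1,2)] by (simp add: X1_def xu(3))
  qed
  then obtain \<mu> where \<mu>: "\<mu> > 0" and
    fin: "\<And>\<tau> v. \<tau> \<in> J \<Longrightarrow> v \<in> carrier_vec N \<Longrightarrow> v \<noteq> 0\<^sub>v N \<Longrightarrow>
      bform (X \<tau>) v v - bform X1 (E *\<^sub>v v) (E *\<^sub>v v) + \<mu> * ((H *\<^sub>v v) \<bullet> (H *\<^sub>v v)) > 0"
    using Qf[OF sub] HtHf by metis
  \<comment> \<open>Factoring \<open>D\<close> as \<open>Hm * H\<close> shows that
    \<open>D *\<^sub>v a\<close> is \<open>Hm\<close> applied to the measurement, so the controller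
    can form it without knowing \<open>a\<close>.\<close>
  define Hm where "Hm = \<mu> \<cdot>\<^sub>m transpose_mat H"
  have Hm: "Hm \<in> carrier_mat N qJ" using H by (auto simp: Hm_def)
  define D where "D = Hm * H"
  have D: "D \<in> carrier_mat N N" unfolding D_def by (rule mult_carrier_mat[OF Hm H])
  have Df: "bform D v w = \<mu> * ((H *\<^sub>v v) \<bullet> (H *\<^sub>v w))" if "v \<in> carrier_vec N" "w \<in> carrier_vec N" for v w
  proof -
    have "bform D v w = bform Hm v (H *\<^sub>v w)" unfolding D_def using Hm H that by (intro bform_mult_right) auto
    also have "\<dots> = \<mu> * bform (transpose_mat H) v (H *\<^sub>v w)" unfolding Hm_def using H that by (intro bform_smult_mat) auto
    also have "bform (transpose_mat H) v (H *\<^sub>v w) = bform H (H *\<^sub>v w) v" using H that by (intro bform_transpose) auto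
    also have "\<dots> = (H *\<^sub>v v) \<bullet> (H *\<^sub>v w)" using H that by (simp add: bform_def scalar_prod_commute[of "H *\<^sub>v w"])
    finally show ?thesis .
  qed
  have Ds: "transpose_mat D = D"
  proof (rule symmetric_bformI[OF D])
    fix v w :: "real vec" assume vw: "v \<in> carrier_vec N" "w \<in> carrier_vec N"
    have "(H *\<^sub>v v) \<bullet> (H *\<^sub>v w) = (H *\<^sub>v w) \<bullet> (H *\<^sub>v v)" using H by (intro scalar_prod_commute) auto
    then show "bform D v w = bform D w v" using Df vw by simp
  qed
  have D0: "bform D v v \<ge> 0" if "v \<in> carrier_vec N" for v
    using Df[OF that that] \<mu> scalar_prod_self_nonneg[of "H *\<^sub>v v"] by simp
  define ERE where "ERE = transpose_mat E * R * E"
  have ERE: "ERE \<in> carrier_mat N N" unfolding ERE_def by (rule congruence_carrier[OF E])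
  have EREs: "transpose_mat ERE = ERE" unfolding ERE_def by (rule congruence_symmetric[OF R Rs E])
  have EREf: "bform ERE v w = bform R (E *\<^sub>v v) (E *\<^sub>v w)" if "v \<in> carrier_vec N" "w \<in> carrier_vec N" for v w
    unfolding ERE_def by (rule bform_congruence[OF R E that])
  \<comment> \<open>The slack of the jump under full state feedback: \<open>P \<tau>\<close> before
    the impulse against the optimally reset \<open>P 0\<close> after it. Its definiteness is the
    dual jump inequality carried over to inverses.\<close>
  define U where "U \<tau> = P \<tau> - ERE" for \<tau>
  have Uc: "U \<tau> \<in> carrier_mat N N" for \<tau> unfolding U_def by (rule minus_carrier_mat[OF ERE])
  have Us: "transpose_mat (U \<tau>) = U \<tau>" if "\<tau> \<in> S" for \<tau>
    unfolding U_def by (simp add: transpose_minus[OF Pc[OF that] ERE] Ps[OF that] EREs)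
  have Uf: "bform (U \<tau>) v v = bform (P \<tau>) v v - bform R (E *\<^sub>v v) (E *\<^sub>v v)" if "\<tau> \<in> S" "v \<in> carrier_vec N" for \<tau> v
  proof -
    have "bform (U \<tau>) v v = bform (P \<tau>) v v - bform ERE v v"
      unfolding U_def using ERE Pc[OF that(1)] that(2) by (intro bform_minus_mat) auto
    then show ?thesis by (simp only: EREf[OF that(2) that(2)])
  qed
  have Upd: "pos_def (U \<tau>)" if t: "\<tau> \<in> J" for \<tau>
  proof (rule pos_defI[OF Uc Us[OF sub[OF t]]])
    fix v :: "real vec" assume v: "v \<in> carrier_vec N" "v \<noteq> 0\<^sub>v N"
    obtain x u where xu: "x \<in> carrier_vec n" "u \<in> carrier_vec p" "v = x @\<^sub>v u"
      using append_vecE[of v n p] v(1) by (auto simp: N_def)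
    have nz: "x \<noteq> 0\<^sub>v n \<or> u \<noteq> 0\<^sub>v p" using v(2) append_vec_eq_zero_iff[OF xu(1,2)] by (simp add: xu(3) N_def)
    have Ex: "E *\<^sub>v v = x" unfolding E_def xu(3) by (rule proj_append(1)[OF xu(1,2)])
    have t': "\<tau> \<in> S" by (rule sub[OF t])
    have "bform (inv_mat (P \<tau>)) w w = bform (Y \<tau>) w w" if w: "w \<in> carrier_vec N" for w
    proof -
      have iP: "inv_mat (P \<tau>) \<in> carrier_mat N N" by (rule inv_mat_carrier[OF Ppd[OF t'] Pc[OF t']])
      have "inv_mat (P \<tau>) *\<^sub>v w = inv_mat (P \<tau>) *\<^sub>v (P \<tau> *\<^sub>v (Y \<tau> *\<^sub>v w))" using YP(2)[OF t' w] by simp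
      also have "\<dots> = Y \<tau> *\<^sub>v w" using Yc[OF t'] w by (intro inv_mat_cancel(2)[OF Ppd[OF t'] Pc[OF t']]) auto
      finally show ?thesis by (simp add: bform_def)
    qed
    then have less: "bform (inv_mat (P \<tau>)) (r @\<^sub>v 0\<^sub>v p) (r @\<^sub>v 0\<^sub>v p) < bform (Y1 0) r r"
      if "r \<in> carrier_vec n" "r \<noteq> 0\<^sub>v n" for r
      using dual_jump[OF t that] bform_upper_left_block[OF Yc[OF t', unfolded N_def] that(1) that(1)] that
      by (simp add: Y1_def N_def)
    have "bform R x x < bform (P \<tau>) (x @\<^sub>v u) (x @\<^sub>v u)"
      unfolding R_def using Pc[OF t'] Ppd[OF t'] Y1c Y1pd less xu(1,2) nz
      by (intro state_feedback_jump) (auto simp: N_def)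
    then show "bform (U \<tau>) v v > 0" using Uf[OF t' v(1)] Ex xu(3) by simp
  qed
  \<comment> \<open>The matrix of the normal equation of the least squares problem. It is also
    \<open>X \<tau> - ERE + D\<close>, since \<open>P \<tau>\<close> cancels between
    \<open>U\<close> and \<open>W\<close>.\<close>
  define M where "M \<tau> = U \<tau> + W \<tau> + D" for \<tau>
  have Mc: "M \<tau> \<in> carrier_mat N N" for \<tau> unfolding M_def by (rule add_carrier_mat[OF D])
  have Ms: "transpose_mat (M \<tau>) = M \<tau>" if t: "\<tau> \<in> S" for \<tau>
    unfolding M_def using transpose_add[OF add_carrier_mat[OF Wc[OF t], of "U \<tau>"] D] transpose_add[OF Uc Wc[OF t]]
    by (simp add: Us[OF t] Ws[OF t] Ds)
  have Mf: "bform (M \<tau>) v v = bform (U \<tau>) v v + bform (W \<tau>) v v + bform D v v"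
    if "\<tau> \<in> S" "v \<in> carrier_vec N" for \<tau> v
    unfolding M_def using Uc[of \<tau>] Wc[OF that(1)] D that(2) by (simp add: bform_add_mat)
  have Mpd: "pos_def (M \<tau>)" if t: "\<tau> \<in> J" for \<tau>
  proof (rule pos_defI[OF Mc Ms[OF sub[OF t]]])
    fix v :: "real vec" assume v: "v \<in> carrier_vec N" "v \<noteq> 0\<^sub>v N"
    show "bform (M \<tau>) v v > 0"
      using Mf[OF sub[OF t] v(1)] D0[OF v(1)] pos_def_bform[OF Upd[OF t] Uc v]
        pos_def_bform[OF Wpd[OF sub[OF t]] Wc[OF sub[OF t]] v] by linarith
  qed
  have WcontJ: "continuous_mat_on J N N W" by (rule continuous_mat_on_subset[OF Wcont JS])
  have Mcont: "continuous_mat_on J N N M"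
    unfolding M_def[abs_def] U_def[abs_def]
    by (intro continuous_mat_on_add continuous_mat_on_minus continuous_mat_on_const D ERE WcontJ
        continuous_mat_on_subset[OF Pcont JS])
  \<comment> \<open>Applied to \<open>Hm y + W c\<close>, the right-hand side of the normal
    equation, \<open>Th\<close> solves for the estimate, extracts its first component by
    \<open>E\<close> and returns the reset state by \<open>\<Gamma>\<close>. \<open>ctrl_AJ\<close>
    and \<open>ctrl_BJ\<close> are its parts acting on \<open>c\<close> and \<open>y\<close>;
    \<open>G2\<close> reads off the control.\<close>
  define Th where "Th \<tau> = \<Gamma> * (E * inv_mat (M \<tau>))" for \<tau>
  have Thcont: "continuous_mat_on J N N Th"
    unfolding Th_def[abs_def]
    by (intro continuous_mat_on_mult[OF continuous_mat_on_const[OF \<Gamma>]] continuous_mat_on_mult[OF continuous_mat_on_const[OF E]]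
        continuous_mat_on_inv_mat[OF Mcont Mpd])
  define G2 where "G2 = proj_last n p"
  have G2: "G2 \<in> carrier_mat p N" by (simp add: G2_def N_def)
  define K where "K = \<lparr> ctrl_A = Ac, ctrl_B = (\<lambda>_. 0\<^sub>m N q), ctrl_C = (\<lambda>_. 0\<^sub>m m N), ctrl_D = (\<lambda>_. 0\<^sub>m m q),
    ctrl_AJ = (\<lambda>\<tau>. Th \<tau> * W \<tau>), ctrl_BJ = (\<lambda>\<tau>. Th \<tau> * Hm),
    ctrl_CJ = (\<lambda>\<tau>. G2 * (Th \<tau> * W \<tau>)), ctrl_DJ = (\<lambda>\<tau>. G2 * (Th \<tau> * Hm)) \<rparr>"
  have AJcont: "continuous_mat_on J N N (\<lambda>\<tau>. Th \<tau> * W \<tau>)" by (rule continuous_mat_on_mult[OF Thcont WcontJ])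
  have BJcont: "continuous_mat_on J N qJ (\<lambda>\<tau>. Th \<tau> * Hm)"
    by (rule continuous_mat_on_mult[OF Thcont continuous_mat_on_const[OF Hm]])
  have ctrl: "is_clock_controller Tmin Tmax m q p qJ N K"
    unfolding is_clock_controller_def K_def S_def[symmetric] J_def[symmetric]
    using Accont AJcont BJcont continuous_mat_on_mult[OF continuous_mat_on_const[OF G2] AJcont]
      continuous_mat_on_mult[OF continuous_mat_on_const[OF G2] BJcont]
    by (simp add: continuous_mat_on_const)

  \<comment> \<open>The closed-loop flow inequality\<close>
  have flow: "neg_def (mat_deriv S XX \<tau> + transpose_mat (closed_loop_flow (G m q qJ) K \<tau>) * XX \<tau>
      + XX \<tau> * closed_loop_flow (G m q qJ) K \<tau>)" if t: "\<tau> \<in> S" for \<tau>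
  proof -
    define F where "F = closed_loop_flow (G m q qJ) K \<tau>"
    have Acc: "Ac \<tau> \<in> carrier_mat N N" by (rule continuous_mat_onD(1)[OF Accont t])
    have Feq: "F = four_block_mat Ahat (0\<^sub>m N N) (0\<^sub>m N N) (Ac \<tau>)"
      using closed_loop_flow_sampled_data[OF A B ctrl, of \<tau>] t
      by (simp add: F_def G_def S_def N_def Ahat_def K_def)
    have F: "F \<in> carrier_mat (N + N) (N + N)" unfolding Feq by (rule four_block_carrier_mat[OF Ah Acc])
    note e = lyapunov_expression[OF F XXc[OF t] XXs[OF t] XX'c[OF t] XX's[OF t]]
    have "neg_def (XX' \<tau> + transpose_mat F * XX \<tau> + XX \<tau> * F)"
    proof (rule neg_defI[OF e(1,2)])
      fix v :: "real vec" assume v: "v \<in> carrier_vec (N + N)" "v \<noteq> 0\<^sub>v (N + N)"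
      obtain a c where ac: "a \<in> carrier_vec N" "c \<in> carrier_vec N" "v = a @\<^sub>v c" using append_vecE[OF v(1)] by blast
      define d where "d = a - c"
      have d: "d \<in> carrier_vec N" using ac by (auto simp: d_def)
      have Fv: "F *\<^sub>v (a @\<^sub>v c) = (Ahat *\<^sub>v a) @\<^sub>v (Ac \<tau> *\<^sub>v c)"
        unfolding Feq using Ah Acc ac(1,2)
        by (subst four_block_mat_mult_vec[of _ N N _ N _ N]) (auto simp: zero_mat_mult_vec)
      have "bform (XX' \<tau> + transpose_mat F * XX \<tau> + XX \<tau> * F) v v = bform (XX' \<tau>) v v + 2 * bform (XX \<tau>) v (F *\<^sub>v v)"
        by (rule e(3)[OF v(1)])
      also have "\<dots> = bform (L \<tau>) c c + (bform (X' \<tau>) d d + 2 * bform (X \<tau>) d (Ahat *\<^sub>v d))"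
        unfolding ac(3) Fv XX'_def XX_def d_def Ac_def L_def W_def
        by (rule storage_flow_form[OF Ah Xc[OF t] Xs[OF t] X'c[OF t] Pc[OF t] Ps[OF t] P'c[OF t] P's[OF t]
              Wpd[OF t, unfolded W_def] ac(1,2)])
      also have "\<dots> < 0"
      proof -
        have nz: "c \<noteq> 0\<^sub>v N \<or> d \<noteq> 0\<^sub>v N"
          using v ac append_vec_eq_zero_iff[OF ac(1,2)] vec_diff_zero_iff[OF ac(1,2)] unfolding d_def by metis
        have l: "bform (L \<tau>) c c \<le> 0"
        proof (cases "c = 0\<^sub>v N")
          case True
          then show ?thesis using bform_zero_left[of "L \<tau>" c] continuous_mat_onD(3)[OF Lcont t] by simp
        qed (use Lneg[OF t ac(2)] in simp)
        have r: "bform (X' \<tau>) d d + 2 * bform (X \<tau>) d (Ahat *\<^sub>v d) \<le> 0"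
        proof (cases "d = 0\<^sub>v N")
          case True
          then show ?thesis
            using bform_zero_left[of "X' \<tau>" d] bform_zero_left[of "X \<tau>" "Ahat *\<^sub>v d"] Xc[OF t] X'c[OF t] by simp
        qed (use primal[OF t d] in \<open>simp add: X'_def\<close>)
        show ?thesis
        proof (cases "d = 0\<^sub>v N")
          case True
          then show ?thesis using nz Lneg[OF t ac(2)] r by auto
        next
          case False
          then show ?thesis using primal[OF t d] l by (simp add: X'_def)
        qed
      qed
      finally show "bform (XX' \<tau> + transpose_mat F * XX \<tau> + XX \<tau> * F) v v < 0" .
    qed
    then show ?thesis unfolding XXderiv[OF t] F_def .
  qed

  \<comment> \<open>The closed-loop jump inequality\<close>
  have jump: "neg_def (transpose_mat (closed_loop_jump (G m q qJ) K \<tau>) * XX 0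
      * closed_loop_jump (G m q qJ) K \<tau> - XX \<tau>)" if t: "\<tau> \<in> J" for \<tau>
  proof -
    have t': "\<tau> \<in> S" by (rule sub[OF t])
    define F where "F = closed_loop_jump (G m q qJ) K \<tau>"
    have F: "F \<in> carrier_mat (N + N) (N + N)"
      using closed_loop_jump_sampled_data_carrier[OF C ctrl, of \<tau>] t by (simp add: F_def G_def N_def J_def)
    note c1 = congruence_carrier[OF F, of "XX 0"]
    have "neg_def (transpose_mat F * XX 0 * F - XX \<tau>)"
    proof (rule neg_defI[OF minus_carrier_mat[OF XXc[OF t']]])
      show "transpose_mat (transpose_mat F * XX 0 * F - XX \<tau>) = transpose_mat F * XX 0 * F - XX \<tau>"
        unfolding transpose_minus[OF c1 XXc[OF t']]
        by (simp only: congruence_symmetric[OF XXc[OF zS] XXs[OF zS] F] XXs[OF t'])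
      fix v :: "real vec" assume v: "v \<in> carrier_vec (N + N)" "v \<noteq> 0\<^sub>v (N + N)"
      obtain a c where ac: "a \<in> carrier_vec N" "c \<in> carrier_vec N" "v = a @\<^sub>v c" using append_vecE[OF v(1)] by blast
      obtain x u where xu: "x \<in> carrier_vec n" "u \<in> carrier_vec p" "a = x @\<^sub>v u"
        using append_vecE[of a n p] ac(1) by (auto simp: N_def)
      have Ea: "E *\<^sub>v a = x" unfolding E_def xu(3) by (rule proj_append(1)[OF xu(1,2)])
      define y where "y = CJ *\<^sub>v x"
      have y: "y \<in> carrier_vec qJ" using C xu by (auto simp: y_def)
      have Da: "D *\<^sub>v a = Hm *\<^sub>v y"
        unfolding D_def y_def using assoc_mult_mat_vec[OF Hm H ac(1)] Hv[OF ac(1)] Ea by simp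
      define s where "s = Hm *\<^sub>v y + W \<tau> *\<^sub>v c"
      have Hy: "Hm *\<^sub>v y \<in> carrier_vec N" and Wv: "W \<tau> *\<^sub>v c \<in> carrier_vec N"
        using Hm y Wc[OF t'] ac by auto
      have s: "s \<in> carrier_vec N" using Hy Wv by (auto simp: s_def)
      define g where "g = inv_mat (M \<tau>) *\<^sub>v s"
      have iM: "inv_mat (M \<tau>) \<in> carrier_mat N N" by (rule inv_mat_carrier[OF Mpd[OF t] Mc])
      have g: "g \<in> carrier_vec N" using iM s by (auto simp: g_def)
      \<comment> \<open>The normal equation for the estimate \<open>g\<close>. The true state enters
        it only through \<open>D *\<^sub>v a\<close>, that is, through the measurement
        \<open>y\<close>.\<close>
      have Mg: "(U \<tau> + W \<tau> + D) *\<^sub>v g = W \<tau> *\<^sub>v c + D *\<^sub>v a"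
        using inv_mat_cancel(1)[OF Mpd[OF t] Mc s] Hy Wv comm_add_vec[OF Hy Wv] by (simp add: M_def g_def s_def Da)
      define h where "h = E *\<^sub>v g"
      have h: "h \<in> carrier_vec n" unfolding h_def by (rule Ev[OF g])
      have Th: "Th \<tau> \<in> carrier_mat N N" by (rule continuous_mat_onD(1)[OF Thcont t])
      have Ths: "Th \<tau> *\<^sub>v s = \<Gamma> *\<^sub>v h"
        unfolding Th_def h_def g_def
        using assoc_mult_mat_vec[OF \<Gamma> mult_carrier_mat[OF E iM] s] assoc_mult_mat_vec[OF E iM s] by simp
      have ThW: "Th \<tau> * W \<tau> \<in> carrier_mat N N" by (rule mult_carrier_mat[OF Th Wc[OF t']])
      have ThH: "Th \<tau> * Hm \<in> carrier_mat N qJ" by (rule mult_carrier_mat[OF Th Hm])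
      have out: "(Th \<tau> * Hm) *\<^sub>v y + (Th \<tau> * W \<tau>) *\<^sub>v c = \<Gamma> *\<^sub>v h"
        unfolding Ths[symmetric] s_def assoc_mult_mat_vec[OF Th Hm y] assoc_mult_mat_vec[OF Th Wc[OF t'] ac(2)]
        by (rule mult_add_distrib_mat_vec[OF Th Hy Wv, symmetric])
      have out2: "(G2 * (Th \<tau> * Hm)) *\<^sub>v y + (G2 * (Th \<tau> * W \<tau>)) *\<^sub>v c = G2 *\<^sub>v (\<Gamma> *\<^sub>v h)"
        unfolding out[symmetric] assoc_mult_mat_vec[OF G2 ThH y] assoc_mult_mat_vec[OF G2 ThW ac(2)]
        by (rule mult_add_distrib_mat_vec[OF G2, symmetric]) (use ThH ThW y ac in auto)
      define a' where "a' = x @\<^sub>v (G2 *\<^sub>v (\<Gamma> *\<^sub>v h))"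
      have Gh: "\<Gamma> *\<^sub>v h \<in> carrier_vec N" using \<Gamma> h by auto
      have a': "a' \<in> carrier_vec N" unfolding a'_def N_def
        by (rule append_carrier_vec[OF xu(1) mult_mat_vec_carrier[OF G2 Gh]])
      have "F *\<^sub>v v = (x @\<^sub>v ((G2 * (Th \<tau> * Hm)) *\<^sub>v y + (G2 * (Th \<tau> * W \<tau>)) *\<^sub>v c)) @\<^sub>v
          ((Th \<tau> * Hm) *\<^sub>v y + (Th \<tau> * W \<tau>) *\<^sub>v c)"
        unfolding F_def G_def ac(3) xu(3)
        using closed_loop_jump_sampled_data[OF C ctrl t[unfolded J_def] xu(1,2) ac(2)]
        unfolding K_def y_def by (simp only: clock_controller.simps)
      then have Fv: "F *\<^sub>v v = a' @\<^sub>v (\<Gamma> *\<^sub>v h)" unfolding out out2 a'_def .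
      define d where "d = a - g"
      have d: "d \<in> carrier_vec N" using ac g by (auto simp: d_def)
      have Ed: "E *\<^sub>v d = x - h"
        unfolding d_def h_def Ea[symmetric] by (rule mult_minus_distrib_mat_vec[OF E ac(1) g])
      have "bform (transpose_mat F * XX 0 * F - XX \<tau>) v v = bform (transpose_mat F * XX 0 * F) v v - bform (XX \<tau>) v v"
        using carrier_matD[OF c1] carrier_matD[OF XXc[OF t']] carrier_vecD[OF v(1)]
        by (intro bform_minus_mat) (simp_all only:)
      also have "bform (transpose_mat F * XX 0 * F) v v = bform (XX 0) (a' @\<^sub>v (\<Gamma> *\<^sub>v h)) (a' @\<^sub>v (\<Gamma> *\<^sub>v h))"
        using bform_congruence[OF XXc[OF zS] F v(1) v(1)] unfolding Fv .
      also have "\<dots> = bform (P 0) a' a' + bform (X 0 - P 0) (a' - \<Gamma> *\<^sub>v h) (a' - \<Gamma> *\<^sub>v h)"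
        using XXf[OF zS a' Gh] unfolding W_def .
      also have "\<dots> = bform R x x + (bform X1 (x - h) (x - h) - bform R (x - h) (x - h))"
        unfolding a'_def G2_def X1_def
        by (rule reset_form[OF Pc[OF zS, unfolded N_def] Ps[OF zS] Xc[OF zS, unfolded N_def] \<Gamma>[unfolded N_def] R P\<Gamma> E\<Gamma> xu(1) h])
      finally have 1: "bform (transpose_mat F * XX 0 * F - XX \<tau>) v v =
          bform R x x + (bform X1 (x - h) (x - h) - bform R (x - h) (x - h)) - bform (XX \<tau>) v v" .
      have 2: "bform (XX \<tau>) v v = bform (P \<tau>) a a + bform (W \<tau>) (a - c) (a - c)"
        unfolding ac(3) by (rule XXf[OF t' ac(1,2)])
      have 3: "bform (U \<tau>) a a = bform (P \<tau>) a a - bform R x x"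
        using Uf[OF t' ac(1)] unfolding Ea .
      \<comment> \<open>In the roles of \<open>W\<close>, \<open>S\<close> and \<open>D\<close> of
        the square completion stand \<open>U \<tau>\<close>, \<open>W \<tau>\<close> and
        \<open>D\<close>.\<close>
      have 4: "bform (U \<tau>) a a + bform (W \<tau>) (a - c) (a - c) = bform (M \<tau>) d d +
          (bform (U \<tau>) g g + bform (W \<tau>) (g - c) (g - c) + bform D d d)"
        unfolding M_def d_def
        by (rule observer_square_completion[OF Uc Us[OF t'] Wc[OF t'] Ws[OF t'] D Ds ac(1,2) g Mg])
      \<comment> \<open>The term with \<open>R\<close> at \<open>x - h\<close> is exactly the one
        left over by the reset, so it cancels and only \<open>X1\<close> at \<open>x - h\<close> has
        to be dominated.\<close>
      have 5: "bform (M \<tau>) d d = bform (X \<tau>) d d - bform R (x - h) (x - h) + \<mu> * ((H *\<^sub>v d) \<bullet> (H *\<^sub>v d))"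
      proof -
        have "bform (W \<tau>) d d = bform (X \<tau>) d d - bform (P \<tau>) d d"
          unfolding W_def using Xc[OF t'] Pc[OF t'] d by (intro bform_minus_mat) auto
        then show ?thesis using Mf[OF t' d] Uf[OF t' d] Df[OF d d] unfolding Ed by linarith
      qed
      have gc: "g - c \<in> carrier_vec N" using g ac by auto
      note nn = pos_def_bform_nonneg[OF Upd[OF t] Uc g] pos_def_bform_nonneg[OF Wpd[OF t'] Wc[OF t'] gc] D0[OF d]
      \<comment> \<open>The quantity that the choice of \<open>\<mu>\<close> makes positive,
        evaluated at the estimation error \<open>d\<close>.\<close>
      define \<Delta> where "\<Delta> = bform (X \<tau>) d d - bform X1 (x - h) (x - h) + \<mu> * ((H *\<^sub>v d) \<bullet> (H *\<^sub>v d))"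
      have \<Delta>: "\<Delta> > 0" if "d \<noteq> 0\<^sub>v N" using fin[OF t d that] unfolding Ed \<Delta>_def .
      have \<Delta>0: "\<Delta> = 0" if dz: "d = 0\<^sub>v N"
      proof -
        have "x - h = 0\<^sub>v n" using Ed mult_mat_zero_vec[OF E] dz by simp
        then have "bform X1 (x - h) (x - h) = 0" using bform_zero_left[of X1 "x - h"] X1 by simp
        moreover have "bform (X \<tau>) d d = 0" using bform_zero_left[of "X \<tau>" d] Xc[OF t'] dz by simp
        moreover have "(H *\<^sub>v d) \<bullet> (H *\<^sub>v d) = 0" using mult_mat_zero_vec[OF H] dz by simp
        ultimately show ?thesis by (simp add: \<Delta>_def)
      qed
      have total: "bform (transpose_mat F * XX 0 * F - XX \<tau>) v v =
          - (\<Delta> + bform (U \<tau>) g g + bform (W \<tau>) (g - c) (g - c) + bform D d d)"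
        using 1 2 3 4 5 unfolding \<Delta>_def by linarith
      \<comment> \<open>If \<open>d\<close>, \<open>g\<close> and \<open>g - c\<close> all vanished,
        then \<open>a = g = c = 0\<close> and \<open>v\<close> would be zero.\<close>
      consider "d \<noteq> 0\<^sub>v N" | "d = 0\<^sub>v N" "g \<noteq> 0\<^sub>v N" | "d = 0\<^sub>v N" "g - c \<noteq> 0\<^sub>v N"
        using v(2) ac append_vec_eq_zero_iff[OF ac(1,2)] vec_diff_zero_iff[OF ac(1) g] vec_diff_zero_iff[OF g ac(2)]
        unfolding d_def by metis
      then show "bform (transpose_mat F * XX 0 * F - XX \<tau>) v v < 0"
      proof cases
        case 1
        then show ?thesis using total \<Delta> nn by linarith
      next
        case 2
        then show ?thesis using total \<Delta>0 nn pos_def_bform[OF Upd[OF t] Uc g] by linarith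
      next
        case 3
        then show ?thesis using total \<Delta>0 nn pos_def_bform[OF Wpd[OF t'] Wc[OF t'] gc] by linarith
      qed
    qed
    then show ?thesis unfolding F_def .
  qed
  have "stability_LMIs_feasible Tmin Tmax (N + N) (closed_loop_flow (G m q qJ) K) (closed_loop_jump (G m q qJ) K)"
    unfolding stability_LMIs_feasible_def S_def[symmetric] J_def[symmetric]
    using XXC XXpd flow jump by blast
  then show ?thesis using ctrl by blast
qed

theorem corollary7:
  fixes Tmin Tmax :: real and n p m q qJ :: nat and A B CJ Ahat VJ :: "real mat"
  assumes "0 < Tmin" and "Tmin < Tmax"
    and "A \<in> carrier_mat n n" and "B \<in> carrier_mat n p" and "CJ \<in> carrier_mat qJ n"
    and "Ahat = four_block_mat A B (0\<^sub>m p n) (0\<^sub>m p p)"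
    and "kernel_basis_matrix CJ VJ"
  shows "(\<exists>nc K. is_clock_controller Tmin Tmax m q p qJ nc K \<and>
           stability_LMIs_feasible Tmin Tmax (n + p + nc)
             (closed_loop_flow (sampled_data_system n p m q qJ A B CJ) K)
             (closed_loop_jump (sampled_data_system n p m q qJ A B CJ) K))
     \<longleftrightarrow>
     (\<exists>X Y. C1_symmetric_on {0..Tmax} (n + p) X \<and> C1_symmetric_on {0..Tmax} (n + p) Y \<and>
        (\<forall>\<tau> \<in> {0..Tmax}.
           pos_def (four_block_mat (Y \<tau>) (1\<^sub>m (n + p)) (1\<^sub>m (n + p)) (X \<tau>)) \<and>
           neg_def (transpose_mat (1\<^sub>m (n + p) @\<^sub>r Ahat)
             * four_block_mat (mat_deriv {0..Tmax} X \<tau>) (X \<tau>) (X \<tau>) (0\<^sub>m (n + p) (n + p))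
             * (1\<^sub>m (n + p) @\<^sub>r Ahat)) \<and>
           pos_def (transpose_mat (- transpose_mat Ahat @\<^sub>r 1\<^sub>m (n + p))
             * four_block_mat (0\<^sub>m (n + p) (n + p)) (Y \<tau>) (Y \<tau>) (mat_deriv {0..Tmax} Y \<tau>)
             * (- transpose_mat Ahat @\<^sub>r 1\<^sub>m (n + p)))) \<and>
        (\<forall>\<tau> \<in> {Tmin..Tmax}.
           neg_def (transpose_mat (four_block_mat VJ (0\<^sub>m n p) (0\<^sub>m p (dim_col VJ)) (1\<^sub>m p))
             * (four_block_mat (upper_left_block n (X 0)) (0\<^sub>m n p) (0\<^sub>m p n) (0\<^sub>m p p) - X \<tau>)
             * four_block_mat VJ (0\<^sub>m n p) (0\<^sub>m p (dim_col VJ)) (1\<^sub>m p)) \<and>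
           pos_def (upper_left_block n (Y 0) - upper_left_block n (Y \<tau>))))"
  (is "?controller \<longleftrightarrow> (\<exists>X Y. ?C X \<and> ?C Y \<and> ?LMI X Y)")
proof -
  have Ahat: "Ahat \<in> carrier_mat (n + p) (n + p)" using assms(3) by (auto simp: assms(6))
  have iff: "?LMI X Y \<longleftrightarrow> reduced_forms Tmin Tmax n p Ahat CJ X Y" if "?C X" "?C Y" for X Y
    by (rule reduced_forms_iff[OF assms(1,2) Ahat assms(5,7) that, symmetric])
  \<comment> \<open>Necessity accepts any controller order, while sufficiency supplies one of order
    \<open>n + p\<close>.\<close>
  have "?controller \<longleftrightarrow> (\<exists>X Y. ?C X \<and> ?C Y \<and> reduced_forms Tmin Tmax n p Ahat CJ X Y)"
    using reduced_forms_necessary[OF assms(1-5)] reduced_forms_sufficient[OF assms(1-5)]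
    unfolding assms(6) by blast
  also have "\<dots> \<longleftrightarrow> (\<exists>X Y. ?C X \<and> ?C Y \<and> ?LMI X Y)"
    using iff by (intro ex_cong1) (rule conj_cong[OF refl conj_cong[OF refl]], simp only: iff)
  finally show ?thesis .
qed

end
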